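(* Assume (i) $q\ge c_q$ for some constant $c_q>0$; (ii) $q$ is Lipschitz continuous in $(\mu,a)$ with a Lipschitz constant $L_q$; (iii) $F,G$ are bounded by a constant $C_0$ and uniformly continuous in $(\mu,a)$ with a modulus of continuity function $\rho$. Let $t\in\mathbb T$ and let $\mu^N_{t,\vec{\mathbf x}}\in\mathcal P_N(\mathbb X_t)$ (with $\vec{\mathbf x}=\vec{\mathbf x}^N\in\mathbb X^N_{0,t}$ depending on $N$) converge to $\mu\in\mathcal P_0(\mathbb X_t)$ under $W_1$ as $N\to\infty$. Then $$\bigcap_{\varepsilon>0}\bigcup_{L\ge0}\limsup_{N\to\infty}\mathbb V^{N,\varepsilon,L}_{hetero}(t,\mu^N_{t,\vec{\mathbf x}})\subset\mathbb V_{relax}(t,\mu)\subset\bigcap_{\varepsilon>0}\liminf_{N\to\infty}\mathbb V^{N,\varepsilon,0}_{hetero}(t,\mu^N_{t,\vec{\mathbf x}}).$$ In particular, since $\liminf_{N\to\infty}\mathbb V^{N,\varepsilon,0}_{hetero}(t,\mu^N_{t,\vec{\mathbf x}})\subset\bigcup_{L\ge0}\limsup_{N\to\infty}\mathbb V^{N,\varepsilon,L}_{hetero}(t,\mu^N_{t,\vec{\mathbf x}})$, both inclusions are actually equalities.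
   Context: For sets $E_N$: $\limsup_NE_N:=\bigcap_{n\ge1}\bigcup_{N\ge n}E_N$, $\liminf_NE_N:=\bigcup_{n\ge1}\bigcap_{N\ge n}E_N$. Path dependent setting. $\mathbb T=\{0,\dots,T\}$; $\mathbb S$ finite, $|\mathbb S|=d$; $\mathbb X=\mathbb S^{T+1}$ with elements $\mathbf x=(\mathbf x_0,\dots,\mathbf x_T)$; $\mathbf x_{t\wedge\cdot}:=(\mathbf x_0,\dots,\mathbf x_t,\mathbf x_t,\dots,\mathbf x_t)$; $\mathbb X_t:=\{\mathbf x_{t\wedge\cdot}:\mathbf x\in\mathbb X\}$; $\mathbf x=_t\tilde{\mathbf x}$ means $\mathbf x_{t\wedge\cdot}=\tilde{\mathbf x}_{t\wedge\cdot}$. $\mathcal P(\mathbb X_t)$: probability measures on $\mathbb X_t$ with $W_1(\mu,\nu):=\sum_{\mathbf x\in\mathbb X_t}|\mu(\mathbf x)-\nu(\mathbf x)|$; $\mathcal P_0(\mathbb X_t)$: those with full support. $X$ is the canonical process on $\mathbb X$; $\mu_{t\wedge\cdot}:=\mu\circ X_{t\wedge\cdot}^{-1}$ for $\mu\in\mathcal P(\mathbb X)$. A function is adapted if $\varphi(t,\mathbf x,\mu)=\varphi(t,\mathbf x_{t\wedge\cdot},\mu_{t\wedge\cdot})$. $\mathbb L^0(\mathbb X_t;\mathbb R)$: functions $\mathbb X_t\to\mathbb R$; $\|\varphi\|_{\mathbb X_t}:=\sup_{\mathbb X_t}|\varphi|$. Data: $\mathbb A\subset\mathbb R^{d_0}$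 measurable; $q:\mathbb T\times\mathbb X\times\mathcal P(\mathbb X)\times\mathbb A\times\mathbb S\to(0,1)$ adapted with $\sum_{\tilde x}q(t,\mathbf x,\mu,a;\tilde x)=1$; $F:\mathbb T\times\mathbb X\times\mathcal P(\mathbb X)\times\mathbb A\to\mathbb R$ adapted; $G:\mathbb X\times\mathcal P(\mathbb X)\to\mathbb R$. Mean field game with relaxed controls. $\mathcal A_{relax}$: adapted $\gamma:\mathbb T\times\mathbb X\to\mathcal P(\mathbb A)$. For $\mu\in\mathcal P(\mathbb X_t)$, $\gamma\in\mathcal A_{relax}$: $\mathbb P^{t,\mu,\gamma}\circ X_{t\wedge\cdot}^{-1}=\mu$, $\mathbb P^{t,\mu,\gamma}(X_{s+1}=\tilde x|X=_s\mathbf x)=\int_{\mathbb A}q(s,\mathbf x,\mu^\gamma,a;\tilde x)\gamma(s,\mathbf x;da)$, $\mu^\gamma_{s\wedge\cdot}:=\mathbb P^{t,\mu,\gamma}\circ X_{s\wedge\cdot}^{-1}$, $s\ge t$. For $\mathbf x\in\mathbb X_t$, $\tilde\gamma\in\mathcal A_{relax}$: $\mathbb P^{\mu^\gamma;t,\mathbf x,\tilde\gamma}(X=_t\mathbf x)=1$, $\mathbb P^{\mu^\gamma;t,\mathbf x,\tilde\gamma}(X_{s+1}=\bar x|X=_s\tilde{\mathbf x})=\int_{\mathbb A}q(s,\tilde{\mathbf x},\mu^\gamma,a;\bar x)\tilde\gamma(s,\tilde{\mathbf x};da)$. $J(t,\mu,\gamma;\mathbf x,\tilde\gamma):=\mathbb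 E^{\mathbb P^{\mu^\gamma;t,\mathbf x,\tilde\gamma}}[G(X,\mu^\gamma)+\sum_{r=t}^{T-1}\int_{\mathbb A}F(r,X,\mu^\gamma,a)\tilde\gamma(r,X;da)]$, $v(\mu^\gamma;t,\mathbf x):=\inf_{\tilde\gamma\in\mathcal A_{relax}}J(t,\mu,\gamma;\mathbf x,\tilde\gamma)$. For $\mu\in\mathcal P_0(\mathbb X_t)$: $\mathcal M^\varepsilon_{relax}(t,\mu)$ is the set of $\gamma^*\in\mathcal A_{relax}$ with $J(t,\mu,\gamma^*;\mathbf x,\gamma^* )\le v(\mu^{\gamma^*};t,\mathbf x)+\varepsilon$ for all $\mathbf x\in\mathbb X_t$; $\mathbb V^\varepsilon_{relax}(t,\mu):=\{\varphi\in\mathbb L^0(\mathbb X_t;\mathbb R):\exists\gamma^*\in\mathcal M^\varepsilon_{relax}(t,\mu)\text{ s.t. }\|\varphi-J(t,\mu,\gamma^*;\cdot,\gamma^* )\|_{\mathbb X_t}\le\varepsilon\}$; $\mathbb V_{relax}(t,\mu):=\bigcap_{\varepsilon>0}\mathbb V^\varepsilon_{relax}(t,\mu)$. $N$-player game with heterogeneous equilibria. $\vec X=(X^1,\dots,X^N)$ is canonical on $\mathbb X^N$; $\mu^N_{t,\vec{\mathbf x}}:=\frac1N\sum_{i=1}^N\delta_{\mathbf x^i}\in\mathcal P(\mathbb X_t)$ for $\vec{\mathbf x}=(\mathbf x^1,\dots,\mathbf x^N)\in\mathbb X_t^N$; $\mu^N$ is the random empirical measure of $(X^1,\dots,X^N)$,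 with $\mu^N_{t\wedge\cdot}=\mu^N_{t,\vec X_{t\wedge\cdot}}$. $\mathbb X^N_{0,t}:=\{\vec{\mathbf x}\in\mathbb X^N_t:\mathrm{supp}(\mu^N_{t,\vec{\mathbf x}})=\mathbb X_t\}$, $\mathcal P_N(\mathbb X_t):=\{\mu^N_{t,\vec{\mathbf x}}:\vec{\mathbf x}\in\mathbb X^N_{0,t}\}$. $\mathcal A^{t,L}_{path}$: adapted $\alpha:\{t,\dots,T-1\}\times\mathbb X\times\mathcal P(\mathbb X)\to\mathbb A$, uniformly Lipschitz continuous in $\mu$ under $W_1$ with Lipschitz constant $L$. For $\vec{\mathbf x}\in\mathbb X^N_{0,t}$, $\vec\alpha=(\alpha^1,\dots,\alpha^N)\in(\bigcup_L\mathcal A^{t,L}_{path})^N$: $\mathbb P^{t,\vec{\mathbf x},\vec\alpha}(\vec X=_t\vec{\mathbf x})=1$, $\mathbb P^{t,\vec{\mathbf x},\vec\alpha}(\vec X_{s+1}=\vec x''|\vec X=_s\vec{\mathbf x}')=\prod_{i=1}^Nq(s,\mathbf x'^i,\mu^N,\alpha^i(s,\mathbf x'^i,\mu^N);x''_i)$; $J_i(t,\vec{\mathbf x},\vec\alpha):=\mathbb E^{\mathbb P^{t,\vec{\mathbf x},\vec\alpha}}[G(X^i,\mu^N)+\sum_{s=t}^{T-1}F(s,X^i,\mu^N,\alpha^i(s,X^i,\mu^N))]$; $v^{N,L}_i(t,\vec{\mathbf x},\vec\alpha):=\inf_{\tilde\alpha\in\mathcal A^{t,L}_{path}}J_i(t,\vec{\mathbf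 x},(\vec\alpha^{-i},\tilde\alpha))$, where $(\vec\alpha^{-i},\tilde\alpha)$ replaces $\alpha^i$ by $\tilde\alpha$. $\mathcal M^{N,\varepsilon,L}_{hetero}(t,\vec{\mathbf x})$: all $\vec\alpha\in(\mathcal A^{t,L}_{path})^N$ with $\frac1N\sum_{i=1}^N[J_i(t,\vec{\mathbf x},\vec\alpha)-v^{N,L}_i(t,\vec{\mathbf x},\vec\alpha)]\le\varepsilon$. $\mathbb V^{N,\varepsilon,L}_{hetero}(t,\vec{\mathbf x})$: all $\varphi\in\mathbb L^0(\mathbb X_t;\mathbb R)$ for which there is $\vec\alpha\in\mathcal M^{N,\varepsilon,L}_{hetero}(t,\vec{\mathbf x})$ with $\max_{\mathbf x\in\mathbb X_t}\min_{\{i:\mathbf x^i=\mathbf x\}}|\varphi(\mathbf x)-v^{N,L}_i(t,\vec{\mathbf x},\vec\alpha)|\le\varepsilon$. This set depends on $\vec{\mathbf x}$ only through $\mu^N_{t,\vec{\mathbf x}}$ and is denoted $\mathbb V^{N,\varepsilon,L}_{hetero}(t,\mu^N_{t,\vec{\mathbf x}})$. *)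

theory Defs
  imports "HOL-Probability.Probability" "HOL-Probability.Product_PMF"
begin

section \<open>Paths and laws of paths\<close>

text \<open>
  A path \<open>(x\<^sub>0, \<dots>, x\<^sub>T)\<close> is a function on \<open>{..T}\<close>, extended by \<open>undefined\<close>; the finite state
  space is the type \<open>'s\<close>. Probability measures on a set \<open>E\<close> of paths are pmfs carried by \<open>E\<close>.
\<close>

type_synonym 's path = "nat \<Rightarrow> 's"

definition paths :: "nat \<Rightarrow> 's path set" where
  "paths T = {..T} \<rightarrow>\<^sub>E UNIV"

definition stop :: "nat \<Rightarrow> nat \<Rightarrow> 's path \<Rightarrow> 's path" where
  "stop T t x = (\<lambda>s\<in>{..T}. x (min s t))"

definition stopped_paths :: "nat \<Rightarrow> nat \<Rightarrow> 's path set" where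
  "stopped_paths T t = stop T t ` paths T"

text \<open>The path \<open>(x\<^sub>0, \<dots>, x\<^sub>s, y, \<dots>, y)\<close>.\<close>

definition extend :: "nat \<Rightarrow> nat \<Rightarrow> 's path \<Rightarrow> 's \<Rightarrow> 's path" where
  "extend T s x y = (\<lambda>r\<in>{..T}. if r \<le> s then x r else y)"

definition laws_on :: "'a set \<Rightarrow> 'a pmf set" where
  "laws_on E = {\<mu>. set_pmf \<mu> \<subseteq> E}"

definition full_laws_on :: "'a set \<Rightarrow> 'a pmf set" where
  "full_laws_on E = {\<mu>. set_pmf \<mu> = E}"

definition W1 :: "'a set \<Rightarrow> 'a pmf \<Rightarrow> 'a pmf \<Rightarrow> real" where
  "W1 E \<mu> \<nu> = (\<Sum>x\<in>E. \<bar>pmf \<mu> x - pmf \<nu> x\<bar>)"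

text \<open>\<open>1/N \<Sum>\<^sub>i \<delta>(x\<^sup>i)\<close> for \<open>N \<ge> 1\<close>; players are numbered \<open>1, \<dots>, N\<close>.\<close>

definition empirical :: "nat \<Rightarrow> (nat \<Rightarrow> 'a) \<Rightarrow> 'a pmf" where
  "empirical N xs = map_pmf xs (pmf_of_set {1..N})"

definition modulus_of_continuity :: "(real \<Rightarrow> real) \<Rightarrow> bool" where
  "modulus_of_continuity \<rho> \<longleftrightarrow> \<rho> 0 = 0 \<and> mono_on {0..} \<rho> \<and> (\<rho> \<longlongrightarrow> 0) (at_right 0)"

text \<open>Law at time \<open>t + n\<close> of the chain started in \<open>z\<close> at time \<open>t\<close> with transition kernels \<open>K s\<close>.\<close>

primrec chain :: "(nat \<Rightarrow> 'z \<Rightarrow> 'z pmf) \<Rightarrow> nat \<Rightarrow> 'z \<Rightarrow> nat \<Rightarrow> 'z pmf" where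
  "chain K t z 0 = return_pmf z"
| "chain K t z (Suc n) = bind_pmf (chain K t z n) (K (t + n))"

section \<open>The games\<close>

text \<open>
  Functions are total, but only their values on the domains of the data matter:
  times in \<open>{..T}\<close>, paths in \<open>paths T\<close>, laws in \<open>laws_on (paths T)\<close>, actions in \<open>A\<close>.
  \<open>A\<close> is nonempty, since otherwise there are no relaxed controls, whereas at \<open>t = T\<close>
  the \<open>N\<close>-player game still has the empty control.
\<close>

locale mean_field_game =
  fixes T :: nat
    and A :: "(real ^ 'k) set"
    and q :: "nat \<Rightarrow> 's::finite path \<Rightarrow> 's path pmf \<Rightarrow> real ^ 'k \<Rightarrow> 's \<Rightarrow> real"
    and F :: "nat \<Rightarrow> 's path \<Rightarrow> 's path pmf \<Rightarrow> real ^ 'k \<Rightarrow> real"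
    and G :: "'s path \<Rightarrow> 's path pmf \<Rightarrow> real"
  assumes A_borel: "A \<in> sets borel"
    and A_nonempty: "A \<noteq> {}"
    and q_range: "\<And>s x \<mu> a y. s \<le> T \<Longrightarrow> x \<in> paths T \<Longrightarrow> \<mu> \<in> laws_on (paths T) \<Longrightarrow> a \<in> A
      \<Longrightarrow> 0 < q s x \<mu> a y \<and> q s x \<mu> a y < 1"
    and q_sum: "\<And>s x \<mu> a. s \<le> T \<Longrightarrow> x \<in> paths T \<Longrightarrow> \<mu> \<in> laws_on (paths T) \<Longrightarrow> a \<in> A
      \<Longrightarrow> (\<Sum>y\<in>UNIV. q s x \<mu> a y) = 1"
    and q_adapted: "\<And>s x \<mu> a y. s \<le> T \<Longrightarrow> x \<in> paths T \<Longrightarrow> \<mu> \<in> laws_on (paths T) \<Longrightarrow> a \<in> A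
      \<Longrightarrow> q s x \<mu> a y = q s (stop T s x) (map_pmf (stop T s) \<mu>) a y"
    and F_adapted: "\<And>s x \<mu> a. s \<le> T \<Longrightarrow> x \<in> paths T \<Longrightarrow> \<mu> \<in> laws_on (paths T) \<Longrightarrow> a \<in> A
      \<Longrightarrow> F s x \<mu> a = F s (stop T s x) (map_pmf (stop T s) \<mu>) a"
begin

subsection \<open>Mean field game with relaxed controls\<close>

text \<open>\<open>space (prob_algebra (restrict_space borel A))\<close> is the set of Borel probability measures on \<open>A\<close>.\<close>

definition relaxed_controls :: "(nat \<Rightarrow> 's path \<Rightarrow> (real ^ 'k) measure) set" where
  "relaxed_controls = {\<gamma>. \<forall>s\<le>T. \<forall>x\<in>paths T.
     \<gamma> s x \<in> space (prob_algebra (restrict_space borel A)) \<and> \<gamma> s x = \<gamma> s (stop T s x)}"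

definition relaxed_step ::
  "(nat \<Rightarrow> 's path \<Rightarrow> (real ^ 'k) measure) \<Rightarrow> 's path pmf \<Rightarrow> nat \<Rightarrow> 's path \<Rightarrow> 's path pmf" where
  "relaxed_step \<gamma> m s x = map_pmf (extend T s x) (embed_pmf (\<lambda>y. \<integral>a. q s x m a y \<partial>\<gamma> s x))"

text \<open>
  \<open>mf_flow t \<mu> \<gamma> n\<close> is the law of the path stopped at \<open>t + n\<close>. The kernel at time \<open>t + n\<close> depends
  on the law of the whole path only through it, because \<open>q\<close> is adapted.
\<close>

primrec mf_flow ::
  "nat \<Rightarrow> 's path pmf \<Rightarrow> (nat \<Rightarrow> 's path \<Rightarrow> (real ^ 'k) measure) \<Rightarrow> nat \<Rightarrow> 's path pmf" where
  "mf_flow t \<mu> \<gamma> 0 = \<mu>"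
| "mf_flow t \<mu> \<gamma> (Suc n) = bind_pmf (mf_flow t \<mu> \<gamma> n) (relaxed_step \<gamma> (mf_flow t \<mu> \<gamma> n) (t + n))"

definition mf_law ::
  "nat \<Rightarrow> 's path pmf \<Rightarrow> (nat \<Rightarrow> 's path \<Rightarrow> (real ^ 'k) measure) \<Rightarrow> 's path pmf" where
  "mf_law t \<mu> \<gamma> = mf_flow t \<mu> \<gamma> (T - t)"

definition player_law ::
  "'s path pmf \<Rightarrow> nat \<Rightarrow> 's path \<Rightarrow> (nat \<Rightarrow> 's path \<Rightarrow> (real ^ 'k) measure) \<Rightarrow> 's path pmf" where
  "player_law m t x \<gamma> = chain (relaxed_step \<gamma> m) t x (T - t)"

definition J_relax ::
  "nat \<Rightarrow> 's path pmf \<Rightarrow> (nat \<Rightarrow> 's path \<Rightarrow> (real ^ 'k) measure)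
    \<Rightarrow> 's path \<Rightarrow> (nat \<Rightarrow> 's path \<Rightarrow> (real ^ 'k) measure) \<Rightarrow> real" where
  "J_relax t \<mu> \<gamma> x \<gamma>' = measure_pmf.expectation (player_law (mf_law t \<mu> \<gamma>) t x \<gamma>')
     (\<lambda>X. G X (mf_law t \<mu> \<gamma>) + (\<Sum>r = t..<T. \<integral>a. F r X (mf_law t \<mu> \<gamma>) a \<partial>\<gamma>' r X))"

definition v_relax ::
  "nat \<Rightarrow> 's path pmf \<Rightarrow> (nat \<Rightarrow> 's path \<Rightarrow> (real ^ 'k) measure) \<Rightarrow> 's path \<Rightarrow> real" where
  "v_relax t \<mu> \<gamma> x = (INF \<gamma>'\<in>relaxed_controls. J_relax t \<mu> \<gamma> x \<gamma>')"

definition M_relax ::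
  "real \<Rightarrow> nat \<Rightarrow> 's path pmf \<Rightarrow> (nat \<Rightarrow> 's path \<Rightarrow> (real ^ 'k) measure) set" where
  "M_relax \<epsilon> t \<mu> = {\<gamma> \<in> relaxed_controls.
     \<forall>x\<in>stopped_paths T t. J_relax t \<mu> \<gamma> x \<gamma> \<le> v_relax t \<mu> \<gamma> x + \<epsilon>}"

definition V_relax_eps :: "real \<Rightarrow> nat \<Rightarrow> 's path pmf \<Rightarrow> ('s path \<Rightarrow> real) set" where
  "V_relax_eps \<epsilon> t \<mu> = {\<phi> \<in> stopped_paths T t \<rightarrow>\<^sub>E UNIV.
     \<exists>\<gamma>\<in>M_relax \<epsilon> t \<mu>. (SUP x\<in>stopped_paths T t. \<bar>\<phi> x - J_relax t \<mu> \<gamma> x \<gamma>\<bar>) \<le> \<epsilon>}"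

definition V_relax :: "nat \<Rightarrow> 's path pmf \<Rightarrow> ('s path \<Rightarrow> real) set" where
  "V_relax t \<mu> = (\<Inter>\<epsilon>\<in>{0<..}. V_relax_eps \<epsilon> t \<mu>)"

subsection \<open>\<open>N\<close>-player game with heterogeneous controls\<close>

definition full_starts :: "nat \<Rightarrow> nat \<Rightarrow> (nat \<Rightarrow> 's path) set" where
  "full_starts N t = {xs \<in> {1..N} \<rightarrow>\<^sub>E stopped_paths T t.
     set_pmf (empirical N xs) = stopped_paths T t}"

definition path_controls ::
  "nat \<Rightarrow> real \<Rightarrow> (nat \<Rightarrow> 's path \<Rightarrow> 's path pmf \<Rightarrow> real ^ 'k) set" where
  "path_controls t L = {\<alpha>. \<forall>s\<in>{t..<T}. \<forall>x\<in>paths T. \<forall>\<mu>\<in>laws_on (paths T).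
     \<alpha> s x \<mu> \<in> A \<and> \<alpha> s x \<mu> = \<alpha> s (stop T s x) (map_pmf (stop T s) \<mu>) \<and>
     (\<forall>\<nu>\<in>laws_on (paths T). norm (\<alpha> s x \<mu> - \<alpha> s x \<nu>) \<le> L * W1 (paths T) \<mu> \<nu>)}"

text \<open>Given the current paths, the players move independently.\<close>

definition game_step ::
  "nat \<Rightarrow> (nat \<Rightarrow> nat \<Rightarrow> 's path \<Rightarrow> 's path pmf \<Rightarrow> real ^ 'k) \<Rightarrow> nat \<Rightarrow> (nat \<Rightarrow> 's path)
    \<Rightarrow> (nat \<Rightarrow> 's path) pmf" where
  "game_step N \<alpha> s xs = map_pmf (\<lambda>ys. \<lambda>i\<in>{1..N}. extend T s (xs i) (ys i))
     (Pi_pmf {1..N} undefined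
       (\<lambda>i. embed_pmf (q s (xs i) (empirical N xs) (\<alpha> i s (xs i) (empirical N xs)))))"

definition game_law ::
  "nat \<Rightarrow> nat \<Rightarrow> (nat \<Rightarrow> 's path) \<Rightarrow> (nat \<Rightarrow> nat \<Rightarrow> 's path \<Rightarrow> 's path pmf \<Rightarrow> real ^ 'k)
    \<Rightarrow> (nat \<Rightarrow> 's path) pmf" where
  "game_law N t xs \<alpha> = chain (game_step N \<alpha>) t xs (T - t)"

definition J_game ::
  "nat \<Rightarrow> nat \<Rightarrow> nat \<Rightarrow> (nat \<Rightarrow> 's path) \<Rightarrow> (nat \<Rightarrow> nat \<Rightarrow> 's path \<Rightarrow> 's path pmf \<Rightarrow> real ^ 'k)
    \<Rightarrow> real" where
  "J_game N i t xs \<alpha> = measure_pmf.expectation (game_law N t xs \<alpha>)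
     (\<lambda>X. G (X i) (empirical N X) +
       (\<Sum>s = t..<T. F s (X i) (empirical N X) (\<alpha> i s (X i) (empirical N X))))"

definition v_game ::
  "nat \<Rightarrow> real \<Rightarrow> nat \<Rightarrow> nat \<Rightarrow> (nat \<Rightarrow> 's path)
    \<Rightarrow> (nat \<Rightarrow> nat \<Rightarrow> 's path \<Rightarrow> 's path pmf \<Rightarrow> real ^ 'k) \<Rightarrow> real" where
  "v_game N L i t xs \<alpha> = (INF \<beta>\<in>path_controls t L. J_game N i t xs (\<alpha>(i := \<beta>)))"

definition M_hetero ::
  "nat \<Rightarrow> real \<Rightarrow> real \<Rightarrow> nat \<Rightarrow> (nat \<Rightarrow> 's path)
    \<Rightarrow> (nat \<Rightarrow> nat \<Rightarrow> 's path \<Rightarrow> 's path pmf \<Rightarrow> real ^ 'k) set" where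
  "M_hetero N \<epsilon> L t xs = {\<alpha> \<in> {1..N} \<rightarrow> path_controls t L.
     1 / real N * (\<Sum>i = 1..N. J_game N i t xs \<alpha> - v_game N L i t xs \<alpha>) \<le> \<epsilon>}"

definition V_hetero ::
  "nat \<Rightarrow> real \<Rightarrow> real \<Rightarrow> nat \<Rightarrow> (nat \<Rightarrow> 's path) \<Rightarrow> ('s path \<Rightarrow> real) set" where
  "V_hetero N \<epsilon> L t xs = {\<phi> \<in> stopped_paths T t \<rightarrow>\<^sub>E UNIV. \<exists>\<alpha>\<in>M_hetero N \<epsilon> L t xs.
     (MAX x\<in>stopped_paths T t. MIN i\<in>{i \<in> {1..N}. xs i = x}. \<bar>\<phi> x - v_game N L i t xs \<alpha>\<bar>) \<le> \<epsilon>}"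

end

section \<open>Consistency checks\<close>

text \<open>
  The laws of the two games have the prescribed initial laws and transition probabilities,
  stated in the form \<open>P(X\<^sub>s\<^sub>+\<^sub>1 = y, X =\<^sub>s x) = P(X =\<^sub>s x) p(y)\<close>.
\<close>

text \<open>
  The chains of both games at once: \<open>M n\<close> is the law at time \<open>t + n\<close>, \<open>stp s z\<close> stops \<open>z\<close> at time \<open>s\<close>,
  \<open>cur s z\<close> is its value at \<open>s\<close>, and \<open>Z s\<close> contains the states stopped at \<open>s\<close>.
\<close>

locale extension_chain =
  fixes t T :: nat and Z :: "nat \<Rightarrow> 'z set" and M :: "nat \<Rightarrow> 'z pmf" and \<kappa> :: "nat \<Rightarrow> 'z \<Rightarrow> 'y pmf"
    and stp :: "nat \<Rightarrow> 'z \<Rightarrow> 'z" and ext :: "nat \<Rightarrow> 'z \<Rightarrow> 'y \<Rightarrow> 'z" and cur :: "nat \<Rightarrow> 'z \<Rightarrow> 'y"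
  assumes M_0: "set_pmf (M 0) \<subseteq> Z t"
    and M_Suc: "\<And>n. t + n < T \<Longrightarrow>
      M (Suc n) = bind_pmf (M n) (\<lambda>z. map_pmf (ext (t + n) z) (\<kappa> (t + n) z))"
    and ext_Z: "\<And>s z y. s < T \<Longrightarrow> z \<in> Z s \<Longrightarrow> ext s z y \<in> Z (Suc s)"
    and stp_ext: "\<And>s z y. s < T \<Longrightarrow> z \<in> Z s \<Longrightarrow> stp s (ext s z y) = z"
    and cur_ext: "\<And>s z y. s < T \<Longrightarrow> z \<in> Z s \<Longrightarrow> y \<in> set_pmf (\<kappa> s z) \<Longrightarrow> cur (Suc s) (ext s z y) = y"
    and stp_id: "\<And>s z. z \<in> Z s \<Longrightarrow> stp s z = z"
    and stp_stp: "\<And>s r z. s \<le> r \<Longrightarrow> stp s (stp r z) = stp s z"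
    and cur_stp: "\<And>s z. s \<le> T \<Longrightarrow> cur s (stp s z) = cur s z"
begin

lemma
  shows law_support: "t + n \<le> T \<Longrightarrow> set_pmf (M n) \<subseteq> Z (t + n)"
    and law_stopped: "n \<le> m \<Longrightarrow> t + m \<le> T \<Longrightarrow> map_pmf (stp (t + n)) (M m) = M n"
    and law_transition: "s \<in> {t..<T} \<Longrightarrow>
      measure_pmf.prob (M (T - t)) {X. stp s X = z \<and> cur (Suc s) X = y}
        = measure_pmf.prob (M (T - t)) {X. stp s X = z} * pmf (\<kappa> s z) y"
proof -
  show supp: "set_pmf (M n) \<subseteq> Z (t + n)" if "t + n \<le> T" for n
    using that
  proof (induction n)
    case 0
    then show ?case using M_0 by simp
  next
    case (Suc n)
    then have "t + n < T" "set_pmf (M n) \<subseteq> Z (t + n)" by auto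
    then show ?case using M_Suc[of n] ext_Z by auto
  qed
  show stopped: "map_pmf (stp (t + n)) (M m) = M n" if "n \<le> m" "t + m \<le> T" for n m
    using that
  proof (induction m rule: dec_induct)
    case base
    then have "map_pmf (stp (t + n)) (M n) = map_pmf id (M n)"
      using supp[of n] stp_id by (intro map_pmf_cong) auto
    then show ?case by simp
  next
    case (step m)
    then have m: "t + m < T" by simp
    have "map_pmf (stp (t + n)) (M (Suc m)) =
        bind_pmf (M m) (\<lambda>z. map_pmf (\<lambda>y. stp (t + n) (ext (t + m) z y)) (\<kappa> (t + m) z))"
      by (simp add: M_Suc[OF m] map_bind_pmf map_pmf_comp)
    also have "\<dots> = bind_pmf (M m) (\<lambda>z. return_pmf (stp (t + n) z))"
    proof (intro bind_pmf_cong refl)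
      fix z assume "z \<in> set_pmf (M m)"
      then have "z \<in> Z (t + m)" using supp[of m] m by auto
      then have "stp (t + n) (ext (t + m) z y) = stp (t + n) z" for y
        using stp_ext[OF m] stp_stp[of "t + n" "t + m"] step.hyps
        by (metis add_le_cancel_left)
      then show "map_pmf (\<lambda>y. stp (t + n) (ext (t + m) z y)) (\<kappa> (t + m) z)
          = return_pmf (stp (t + n) z)" by simp
    qed
    also have "\<dots> = map_pmf (stp (t + n)) (M m)"
      by (simp add: map_pmf_def)
    finally show ?case using step by simp
  qed
  show "measure_pmf.prob (M (T - t)) {X. stp s X = z \<and> cur (Suc s) X = y}
      = measure_pmf.prob (M (T - t)) {X. stp s X = z} * pmf (\<kappa> s z) y" if s: "s \<in> {t..<T}"
  proof -
    define n where "n = s - t"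
    have n: "s = t + n" "t + n < T" using s by (auto simp: n_def)
    define Q where "Q = bind_pmf (M n) (\<lambda>z. map_pmf (Pair z) (\<kappa> s z))"
    have M_Q: "M (Suc n) = map_pmf (\<lambda>(z, y). ext s z y) Q"
      using M_Suc[OF n(2)] by (simp add: Q_def n(1) map_bind_pmf map_pmf_comp)
    have Q_supp: "z' \<in> Z s \<and> y' \<in> set_pmf (\<kappa> s z')" if "(z', y') \<in> set_pmf Q" for z' y'
      using that supp[of n] n by (auto simp: Q_def)
    have "pmf (map_pmf (Pair z') (\<kappa> s z')) (z, y) = indicator {z} z' * pmf (\<kappa> s z) y" for z'
    proof (cases "z' = z")
      case True
      then show ?thesis by (simp add: pmf_map_inj' inj_on_def inj_def)
    next
      case False
      then have "(z, y) \<notin> set_pmf (map_pmf (Pair z') (\<kappa> s z'))" by auto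
      then show ?thesis using False by (simp add: pmf_eq_0_set_pmf)
    qed
    then have Q: "pmf Q (z, y) = pmf (M n) z * pmf (\<kappa> s z) y"
      by (simp add: Q_def pmf_bind measure_pmf_single)
    have "measure_pmf.prob (M (T - t)) {X. stp s X = z \<and> cur (Suc s) X = y}
        = measure_pmf.prob (map_pmf (stp (Suc s)) (M (T - t))) {X. stp s X = z \<and> cur (Suc s) X = y}"
      using s by (simp add: measure_map_pmf vimage_def stp_stp cur_stp)
    also have "map_pmf (stp (Suc s)) (M (T - t)) = M (Suc n)"
      using stopped[of "Suc n" "T - t"] n by simp
    also have "measure_pmf.prob (M (Suc n)) {X. stp s X = z \<and> cur (Suc s) X = y}
        = measure_pmf.prob Q {(z, y)}"
      unfolding M_Q measure_map_pmf
      using n Q_supp stp_ext cur_ext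
      by (intro measure_pmf.finite_measure_eq_AE) (auto simp: AE_measure_pmf_iff)
    also have "\<dots> = pmf (M n) z * pmf (\<kappa> s z) y"
      by (simp add: Q measure_pmf_single)
    also have "M n = map_pmf (stp s) (M (T - t))"
      using stopped[of n "T - t"] n by simp
    also have "pmf (map_pmf (stp s) (M (T - t))) z = measure_pmf.prob (M (T - t)) {X. stp s X = z}"
      by (simp add: pmf_map vimage_def)
    finally show ?thesis .
  qed
qed

end

lemma stop_in_paths: "x \<in> paths T \<Longrightarrow> stop T s x \<in> paths T"
  by (auto simp: paths_def stop_def)

lemma stop_stop: "s \<le> r \<Longrightarrow> stop T s (stop T r x) = stop T s x"
  by (auto simp: stop_def fun_eq_iff restrict_def min_def)

lemma stopped_paths_iff: "x \<in> stopped_paths T s \<longleftrightarrow> x \<in> paths T \<and> stop T s x = x"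
  unfolding stopped_paths_def using stop_in_paths stop_stop[of s s] by (metis imageE imageI order_refl)

lemma stop_stopped: "x \<in> stopped_paths T s \<Longrightarrow> stop T s x = x"
  by (simp add: stopped_paths_iff)

lemma stop_apply: "s \<le> T \<Longrightarrow> stop T s x s = x s"
  by (simp add: stop_def)

lemma extend_facts:
  assumes "s < T" "x \<in> stopped_paths T s"
  shows "extend T s x y \<in> stopped_paths T (Suc s)" "stop T s (extend T s x y) = x"
    "extend T s x y (Suc s) = y"
proof -
  have "x \<in> paths T" "stop T s x = x" using assms(2) by (auto simp: stopped_paths_iff)
  then have *: "stop T s x u = x u" for u
    by simp
  show "stop T s (extend T s x y) = x"
  proof
    fix u
    show "stop T s (extend T s x y) u = x u"
      using assms(1) *[of u] by (auto simp: stop_def extend_def)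
  qed
  show "extend T s x y (Suc s) = y" using assms(1) by (simp add: extend_def)
  show "extend T s x y \<in> stopped_paths T (Suc s)"
    using assms(1)
    by (auto simp: stopped_paths_iff paths_def stop_def extend_def fun_eq_iff restrict_def min_def
        split: if_splits)
qed

context mean_field_game
begin

lemma pmf_relaxed_kernel:
  assumes "\<gamma> \<in> relaxed_controls" "s \<le> T" "x \<in> paths T" "m \<in> laws_on (paths T)"
    and meas: "\<And>y. (\<lambda>a. q s x m a y) \<in> borel_measurable (restrict_space borel A)"
  shows "pmf (embed_pmf (\<lambda>y. \<integral>a. q s x m a y \<partial>\<gamma> s x)) y = (\<integral>a. q s x m a y \<partial>\<gamma> s x)"
proof -
  let ?\<gamma> = "\<gamma> s x"
  have \<gamma>: "sets ?\<gamma> = sets (restrict_space borel A)" "prob_space ?\<gamma>"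
    using assms(1-3) unfolding relaxed_controls_def space_prob_algebra by blast+
  interpret prob_space ?\<gamma> by fact
  have sp: "space ?\<gamma> = A"
    using sets_eq_imp_space_eq[OF \<gamma>(1)] by (simp add: space_restrict_space)
  have bd: "0 < q s x m a y \<and> q s x m a y < 1" if "a \<in> A" for a y
    using q_range assms(2-4) that by blast
  have int: "integrable ?\<gamma> (\<lambda>a. q s x m a y)" for y
    using meas[of y] bd sp
    by (intro integrable_const_bound[where B = 1] AE_I2)
      (auto simp: abs_le_iff less_imp_le intro: order_trans[of _ 0] cong: measurable_cong_sets[OF \<gamma>(1) refl])
  have nn: "0 \<le> (\<integral>a. q s x m a y \<partial>?\<gamma>)" for y
    using bd sp by (intro integral_nonneg_AE AE_I2) (auto simp: less_imp_le)
  have "(\<Sum>y\<in>UNIV. \<integral>a. q s x m a y \<partial>?\<gamma>) = (\<integral>a. (\<Sum>y\<in>UNIV. q s x m a y) \<partial>?\<gamma>)"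
    using int by (subst Bochner_Integration.integral_sum) auto
  also have "\<dots> = (\<integral>a. 1 \<partial>?\<gamma>)"
    using q_sum assms(2-4) sp by (intro Bochner_Integration.integral_cong) auto
  finally have "(\<Sum>y\<in>UNIV. \<integral>a. q s x m a y \<partial>?\<gamma>) = 1"
    by (simp add: prob_space)
  then show ?thesis
    using nn by (intro pmf_embed_pmf) (auto simp: nn_integral_count_space_finite sum_ennreal)
qed

lemma mf_law_characterization:
  assumes \<gamma>: "\<gamma> \<in> relaxed_controls" and t: "t \<le> T" and \<mu>: "\<mu> \<in> laws_on (stopped_paths T t)"
    and meas: "\<And>s x m y. s \<le> T \<Longrightarrow> x \<in> paths T \<Longrightarrow> m \<in> laws_on (paths T) \<Longrightarrow>
      (\<lambda>a. q s x m a y) \<in> borel_measurable (restrict_space borel A)"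
  defines "P \<equiv> mf_law t \<mu> \<gamma>"
  shows "set_pmf P \<subseteq> paths T" and "map_pmf (stop T t) P = \<mu>"
    and "\<And>s x y. s \<in> {t..<T} \<Longrightarrow> x \<in> stopped_paths T s \<Longrightarrow>
      measure_pmf.prob P {X. stop T s X = x \<and> X (Suc s) = y}
        = measure_pmf.prob P {X. stop T s X = x} * (\<integral>a. q s x P a y \<partial>\<gamma> s x)"
proof -
  define \<kappa> where "\<kappa> s x = embed_pmf (\<lambda>y. \<integral>a. q s x (mf_flow t \<mu> \<gamma> (s - t)) a y \<partial>\<gamma> s x)" for s x
  have 1: "set_pmf (mf_flow t \<mu> \<gamma> 0) \<subseteq> stopped_paths T t"
    using \<mu> by (simp add: laws_on_def)
  have 2: "mf_flow t \<mu> \<gamma> (Suc n) =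
      bind_pmf (mf_flow t \<mu> \<gamma> n) (\<lambda>z. map_pmf (extend T (t + n) z) (\<kappa> (t + n) z))" for n
    by (simp add: \<kappa>_def relaxed_step_def[abs_def])
  interpret D: extension_chain t T "stopped_paths T" "mf_flow t \<mu> \<gamma>" \<kappa> "stop T" "extend T" "\<lambda>s X. X s"
    by unfold_locales (rule 1 2 extend_facts stop_stopped stop_stop stop_apply; assumption)+
  note flow = D.law_support and stopped = D.law_stopped
  have P: "P = mf_flow t \<mu> \<gamma> (T - t)" by (simp add: P_def mf_law_def)
  show supp: "set_pmf P \<subseteq> paths T"
    using flow[of "T - t"] t by (auto simp: P stopped_paths_iff)
  show "map_pmf (stop T t) P = \<mu>"
    using stopped[of 0 "T - t"] t by (simp add: P)
  show "measure_pmf.prob P {X. stop T s X = x \<and> X (Suc s) = y}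
        = measure_pmf.prob P {X. stop T s X = x} * (\<integral>a. q s x P a y \<partial>\<gamma> s x)"
    if s: "s \<in> {t..<T}" and x: "x \<in> stopped_paths T s" for s x y
  proof -
    define m where "m = mf_flow t \<mu> \<gamma> (s - t)"
    have m: "map_pmf (stop T s) P = m"
      using stopped[of "s - t" "T - t"] s by (auto simp: P m_def)
    have mL: "m \<in> laws_on (paths T)" using flow[of "s - t"] s by (auto simp: m_def laws_on_def stopped_paths_iff)
    have x': "x \<in> paths T" "stop T s x = x" using x by (auto simp: stopped_paths_iff)
    have "measure_pmf.prob P {X. stop T s X = x \<and> X (Suc s) = y}
        = measure_pmf.prob P {X. stop T s X = x} * pmf (\<kappa> s x) y"
      unfolding P
      by (rule D.law_transition[OF s])
    also have "pmf (\<kappa> s x) y = (\<integral>a. q s x m a y \<partial>\<gamma> s x)"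
      unfolding \<kappa>_def m_def[symmetric]
      using \<gamma> s x' mL meas by (intro pmf_relaxed_kernel) auto
    also have "\<dots> = (\<integral>a. q s x P a y \<partial>\<gamma> s x)"
    proof (rule Bochner_Integration.integral_cong[OF refl])
      have "sets (\<gamma> s x) = sets (restrict_space borel A)"
        using \<gamma> s x'(1) less_imp_le[of s T] unfolding relaxed_controls_def space_prob_algebra atLeastLessThan_iff by blast
      from sets_eq_imp_space_eq[OF this] have "space (\<gamma> s x) = A"
        by (simp add: space_restrict_space)
      moreover fix a assume "a \<in> space (\<gamma> s x)"
      ultimately have "a \<in> A" by simp
      then show "q s x m a y = q s x P a y"
        using q_adapted[OF _ x'(1) _ \<open>a \<in> A\<close>, of s P y] s x'(2) supp m by (simp add: laws_on_def)
    qed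
    finally show ?thesis .
  qed
qed

lemma player_law_characterization:
  assumes \<gamma>: "\<gamma> \<in> relaxed_controls" and t: "t \<le> T" and x: "x \<in> stopped_paths T t"
    and m: "m \<in> laws_on (paths T)"
    and meas: "\<And>s x y. s \<le> T \<Longrightarrow> x \<in> paths T \<Longrightarrow>
      (\<lambda>a. q s x m a y) \<in> borel_measurable (restrict_space borel A)"
  defines "P \<equiv> player_law m t x \<gamma>"
  shows "set_pmf P \<subseteq> paths T" and "map_pmf (stop T t) P = return_pmf x"
    and "\<And>s x' y. s \<in> {t..<T} \<Longrightarrow> x' \<in> stopped_paths T s \<Longrightarrow>
      measure_pmf.prob P {X. stop T s X = x' \<and> X (Suc s) = y}
        = measure_pmf.prob P {X. stop T s X = x'} * (\<integral>a. q s x' m a y \<partial>\<gamma> s x')"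
proof -
  define \<kappa> where "\<kappa> s x = embed_pmf (\<lambda>y. \<integral>a. q s x m a y \<partial>\<gamma> s x)" for s x
  have 1: "set_pmf (chain (relaxed_step \<gamma> m) t x 0) \<subseteq> stopped_paths T t"
    using x by simp
  have 2: "chain (relaxed_step \<gamma> m) t x (Suc n) =
      bind_pmf (chain (relaxed_step \<gamma> m) t x n) (\<lambda>z. map_pmf (extend T (t + n) z) (\<kappa> (t + n) z))" for n
    by (simp add: \<kappa>_def relaxed_step_def[abs_def])
  interpret D: extension_chain t T "stopped_paths T" "chain (relaxed_step \<gamma> m) t x" \<kappa> "stop T"
    "extend T" "\<lambda>s X. X s"
    by unfold_locales (rule 1 2 extend_facts stop_stopped stop_stop stop_apply; assumption)+
  have P: "P = chain (relaxed_step \<gamma> m) t x (T - t)" by (simp add: P_def player_law_def)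
  show "set_pmf P \<subseteq> paths T"
    using D.law_support[of "T - t"] t by (auto simp: P stopped_paths_iff)
  show "map_pmf (stop T t) P = return_pmf x"
    using D.law_stopped[of 0 "T - t"] t by (simp add: P)
  show "measure_pmf.prob P {X. stop T s X = x' \<and> X (Suc s) = y}
        = measure_pmf.prob P {X. stop T s X = x'} * (\<integral>a. q s x' m a y \<partial>\<gamma> s x')"
    if s: "s \<in> {t..<T}" and x': "x' \<in> stopped_paths T s" for s x' y
  proof -
    have "measure_pmf.prob P {X. stop T s X = x' \<and> X (Suc s) = y}
        = measure_pmf.prob P {X. stop T s X = x'} * pmf (\<kappa> s x') y"
      unfolding P
      by (rule D.law_transition[OF s])
    also have "pmf (\<kappa> s x') y = (\<integral>a. q s x' m a y \<partial>\<gamma> s x')"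
      unfolding \<kappa>_def
      using \<gamma> s x' m meas by (intro pmf_relaxed_kernel) (auto simp: stopped_paths_iff)
    finally show ?thesis .
  qed
qed

text \<open>In the \<open>N\<close>-player game, \<open>X =\<^sub>s x\<close> and \<open>X\<^sub>s\<^sub>+\<^sub>1 = y\<close> are understood componentwise.\<close>

lemma game_law_characterization:
  assumes \<alpha>: "\<alpha> \<in> {1..N} \<rightarrow> path_controls t L" and t: "t \<le> T" and N: "N \<ge> 1"
    and xs: "xs \<in> {1..N} \<rightarrow>\<^sub>E stopped_paths T t"
  defines "P \<equiv> game_law N t xs \<alpha>"
  shows "set_pmf P \<subseteq> {1..N} \<rightarrow>\<^sub>E paths T"
    and "\<And>X i. X \<in> set_pmf P \<Longrightarrow> i \<in> {1..N} \<Longrightarrow> stop T t (X i) = xs i"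
    and "\<And>s xs' y. s \<in> {t..<T} \<Longrightarrow> xs' \<in> {1..N} \<rightarrow>\<^sub>E stopped_paths T s \<Longrightarrow>
      measure_pmf.prob P {X. (\<forall>i\<in>{1..N}. stop T s (X i) = xs' i) \<and> (\<forall>i\<in>{1..N}. X i (Suc s) = y i)}
        = measure_pmf.prob P {X. \<forall>i\<in>{1..N}. stop T s (X i) = xs' i} *
          (\<Prod>i = 1..N. q s (xs' i) (empirical N xs') (\<alpha> i s (xs' i) (empirical N xs')) (y i))"
proof -
  define \<kappa> where "\<kappa> s xs = Pi_pmf {1..N} undefined
       (\<lambda>i. embed_pmf (q s (xs i) (empirical N xs) (\<alpha> i s (xs i) (empirical N xs))))" for s xs
  define ext :: "nat \<Rightarrow> (nat \<Rightarrow> 's path) \<Rightarrow> (nat \<Rightarrow> 's) \<Rightarrow> nat \<Rightarrow> 's path"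
    where "ext s xs ys = (\<lambda>i\<in>{1..N}. extend T s (xs i) (ys i))" for s xs ys
  define stp :: "nat \<Rightarrow> (nat \<Rightarrow> 's path) \<Rightarrow> nat \<Rightarrow> 's path"
    where "stp s xs = (\<lambda>i\<in>{1..N}. stop T s (xs i))" for s xs
  define cur :: "nat \<Rightarrow> (nat \<Rightarrow> 's path) \<Rightarrow> nat \<Rightarrow> 's"
    where "cur s xs = (\<lambda>i\<in>{1..N}. xs i s)" for s xs
  define Z :: "nat \<Rightarrow> (nat \<Rightarrow> 's path) set"
    where "Z s = ({1..N} \<rightarrow>\<^sub>E stopped_paths T s)" for s
  let ?M = "chain (game_step N \<alpha>) t xs"
  have 1: "set_pmf (?M 0) \<subseteq> Z t" using xs by (simp add: Z_def)
  have 2: "?M (Suc n) = bind_pmf (?M n) (\<lambda>z. map_pmf (ext (t + n) z) (\<kappa> (t + n) z))" for n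
    by (simp add: game_step_def[abs_def] ext_def[abs_def] \<kappa>_def)
  have 3: "ext s z y \<in> Z (Suc s)" if "s < T" "z \<in> Z s" for s z y
    using that by (auto simp: ext_def Z_def PiE_iff intro!: extend_facts(1))
  have 4: "stp s (ext s z y) = z" if "s < T" "z \<in> Z s" for s z y
  proof
    fix i
    show "stp s (ext s z y) i = z i"
      using that extend_facts(2)[OF that(1), of "z i" "y i"]
      by (cases "i \<in> {1..N}") (auto simp: ext_def Z_def stp_def PiE_iff extensional_def)
  qed
  have 5: "cur (Suc s) (ext s z y) = y" if "s < T" "z \<in> Z s" "y \<in> set_pmf (\<kappa> s z)" for s z y
  proof
    fix i
    have "y \<in> PiE_dflt {1..N} undefined (\<lambda>_. UNIV)"
      using that(3) set_Pi_pmf_subset'[of "{1..N}" undefined] unfolding \<kappa>_def PiE_dflt_def by fastforce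
    then show "cur (Suc s) (ext s z y) i = y i"
      using that extend_facts(3)[OF that(1), of "z i" "y i"]
      by (cases "i \<in> {1..N}") (auto simp: ext_def Z_def cur_def PiE_iff PiE_dflt_def)
  qed
  have 6: "stp s z = z" if "z \<in> Z s" for s z
    using that by (auto simp: Z_def stp_def PiE_iff stopped_paths_iff extensional_def fun_eq_iff)
  have 7: "stp s (stp r z) = stp s z" if "s \<le> r" for s r z
    using that by (auto simp: stp_def stop_stop fun_eq_iff restrict_def)
  have 8: "cur s (stp s z) = cur s z" if "s \<le> T" for s z
    using that by (auto simp: stp_def cur_def stop_apply fun_eq_iff restrict_def)
  interpret D: extension_chain t T Z ?M \<kappa> stp ext cur
    by unfold_locales (rule 1 2 3 4 5 6 7 8; assumption)+
  have P: "P = ?M (T - t)" by (simp add: P_def game_law_def)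
  show supp: "set_pmf P \<subseteq> {1..N} \<rightarrow>\<^sub>E paths T"
    using D.law_support[of "T - t"] t by (auto simp: P Z_def PiE_iff stopped_paths_iff subset_iff)
  show "stop T t (X i) = xs i" if "X \<in> set_pmf P" "i \<in> {1..N}" for X i
  proof -
    have "map_pmf (stp t) P = return_pmf xs"
      using D.law_stopped[of 0 "T - t"] t by (simp add: P)
    then have "stp t ` set_pmf P = {xs}"
      by (metis set_map_pmf set_return_pmf)
    then have "stp t X = xs" using that(1) by blast
    then show ?thesis using that(2) by (auto simp: stp_def)
  qed
  show "measure_pmf.prob P {X. (\<forall>i\<in>{1..N}. stop T s (X i) = xs' i) \<and> (\<forall>i\<in>{1..N}. X i (Suc s) = y i)}
        = measure_pmf.prob P {X. \<forall>i\<in>{1..N}. stop T s (X i) = xs' i} *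
          (\<Prod>i = 1..N. q s (xs' i) (empirical N xs') (\<alpha> i s (xs' i) (empirical N xs')) (y i))"
    if s: "s \<in> {t..<T}" and xs': "xs' \<in> {1..N} \<rightarrow>\<^sub>E stopped_paths T s" for s xs' y
  proof -
    define y' where "y' = restrict y {1..N}"
    have stp_iff: "(\<forall>i\<in>{1..N}. stop T s (X i) = xs' i) \<longleftrightarrow> stp s X = xs'" for X
      using xs' by (auto simp: stp_def PiE_iff extensional_def fun_eq_iff)
    have cur_iff: "(\<forall>i\<in>{1..N}. X i (Suc s) = y i) \<longleftrightarrow> cur (Suc s) X = y'" for X
      by (auto simp: cur_def y'_def fun_eq_iff restrict_def)
    have em: "empirical N xs' \<in> laws_on (paths T)"
      using xs' N by (auto simp: empirical_def laws_on_def PiE_iff stopped_paths_iff)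
    have "pmf (\<kappa> s xs') y' = (\<Prod>i = 1..N. pmf (embed_pmf
        (q s (xs' i) (empirical N xs') (\<alpha> i s (xs' i) (empirical N xs')))) (y' i))"
      unfolding \<kappa>_def by (subst pmf_Pi) (auto simp: y'_def)
    also have "\<dots> = (\<Prod>i = 1..N. q s (xs' i) (empirical N xs') (\<alpha> i s (xs' i) (empirical N xs')) (y i))"
    proof (rule prod.cong[OF refl])
      fix i assume i: "i \<in> {1..N}"
      have x: "xs' i \<in> paths T" using xs' i by (auto simp: PiE_iff stopped_paths_iff)
      have a: "\<alpha> i s (xs' i) (empirical N xs') \<in> A" (is "?a \<in> A")
        using \<alpha> i s x em unfolding path_controls_def by blast
      have "pmf (embed_pmf (q s (xs' i) (empirical N xs') ?a)) (y' i)
          = q s (xs' i) (empirical N xs') ?a (y' i)"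
        using q_range[OF _ x em a] q_sum[OF _ x em a] s
        by (intro pmf_embed_pmf)
          (auto simp: nn_integral_count_space_finite sum_ennreal less_imp_le)
      then show "pmf (embed_pmf (q s (xs' i) (empirical N xs') ?a)) (y' i)
          = q s (xs' i) (empirical N xs') ?a (y i)" using i by (simp add: y'_def)
    qed
    finally show ?thesis
      using D.law_transition[OF s, of xs' y'] unfolding stp_iff cur_iff P by simp
  qed
qed

end

text \<open>The limits of sequences of sets, in terms of the library notions.\<close>

lemma limsup_set: "limsup E = (\<Inter>n\<in>{1..}. \<Union>N\<in>{n..}. E N)" for E :: "nat \<Rightarrow> 'a set"
proof -
  have "(\<Union>N\<in>{1..}. E N) \<subseteq> (\<Union>N\<in>{0..}. E N)"
    by auto
  moreover have "(\<Inter>n. \<Union>N\<in>{n..}. E N) = (\<Union>N\<in>{0..}. E N) \<inter> (\<Inter>n\<in>{1..}. \<Union>N\<in>{n..}. E N)"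
    by (subst INT_insert [symmetric], rule arg_cong [of _ _ "\<lambda>I. \<Inter>n\<in>I. \<Union>N\<in>{n..}. E N"]) auto
  moreover have "(\<Inter>n\<in>{1..}. \<Union>N\<in>{n..}. E N) \<subseteq> (\<Union>N\<in>{1..}. E N)"
    by (rule INT_lower) simp
  ultimately show ?thesis
    unfolding limsup_INF_SUP by blast
qed

lemma liminf_set: "liminf E = (\<Union>n\<in>{1..}. \<Inter>N\<in>{n..}. E N)" for E :: "nat \<Rightarrow> 'a set"
proof -
  have "(\<Inter>N\<in>{0..}. E N) \<subseteq> (\<Inter>N\<in>{1..}. E N)"
    by auto
  moreover have "(\<Union>n. \<Inter>N\<in>{n..}. E N) = (\<Inter>N\<in>{0..}. E N) \<union> (\<Union>n\<in>{1..}. \<Inter>N\<in>{n..}. E N)"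
    by (subst UN_insert [symmetric], rule arg_cong [of _ _ "\<lambda>I. \<Union>n\<in>I. \<Inter>N\<in>{n..}. E N"]) auto
  moreover have "(\<Inter>N\<in>{1..}. E N) \<subseteq> (\<Union>n\<in>{1..}. \<Inter>N\<in>{n..}. E N)"
    by (rule UN_upper [of 1 "{1..}"]) simp
  ultimately show ?thesis
    unfolding liminf_SUP_INF by blast
qed

end

theory Submission
  imports Defs
begin

text \<open>
  Freeze the law \<open>m\<close> of the environment. The player then faces a finite-horizon control problem,
  in which pure controls do as well as relaxed ones. In the \<open>N\<close>-player game let \<open>m\<close> be (nearly) the
  average of the laws of the players, each moving in the environment \<open>m\<close>. By independence the
  empirical measure stays close to \<open>m\<close> even if one player deviates, uniformly over
  \<open>L\<close>-Lipschitz controls, so costs and values of the game are close to those in the environment \<open>m\<close>.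

  Given approximate equilibria of the games, the conditional law of the action of a uniformly chosen
  player given its path is a relaxed control with the same average law and cost. Its optimality gap
  is small on average over the initial paths, hence at each of them, as \<open>\<mu>\<close> has full support.
  Conversely, a relaxed approximate equilibrium is matched in average law and cost by open-loop pure
  controls of the \<open>N\<close> players, up to \<open>O(1 / sqrt N)\<close>.
\<close>

text \<open>The obstacle is a circle: the environment is generated by controls that themselves react
  to it. Adaptedness opens it, since at time s only the law stopped at s matters; an environment and
  a control that fit together are built one time step at a time. In a frozen environment the law is
  a constant, so a good pure control need not look at it. Such a control has Lipschitz constant 0
  and is available to every player whatever L is. Merging many pure controls into one relaxed
  control, or splitting a relaxed control into many pure ones, preserves laws and costs only on
  average over the players. This is enough because the equilibrium condition is itself an average
  and the gap of a control in a frozen environment is never negative. All estimates must be uniform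
  in the environment: in the passage from the games to the limit it changes with N.\<close>

abbreviation pmf_mean :: "'a pmf \<Rightarrow> ('a \<Rightarrow> real) \<Rightarrow> real" (\<open>\<E>\<close>) where
  "\<E> p f \<equiv> measure_pmf.expectation p f"

subsection \<open>Expectations under finitely supported laws\<close>

lemma E_bind:
  fixes h :: "'b \<Rightarrow> real"
  assumes "finite (set_pmf p)" "\<And>x. x \<in> set_pmf p \<Longrightarrow> finite (set_pmf (f x))"
  shows "\<E> (bind_pmf p f) h = \<E> p (\<lambda>x. \<E> (f x) h)"
  using assms by (subst pmf_expectation_bind[of "set_pmf p"])
    (auto simp: integral_measure_pmf[of "set_pmf p"])

lemma E_cong:
  fixes f :: "'a \<Rightarrow> real"
  assumes "\<And>x. x \<in> set_pmf p \<Longrightarrow> f x = g x"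
  shows "\<E> p f = \<E> p g"
  using assms by (intro integral_cong_AE) (auto simp: AE_measure_pmf_iff)

lemma E_mono:
  fixes f :: "'a \<Rightarrow> real"
  assumes "finite (set_pmf p)" "\<And>x. x \<in> set_pmf p \<Longrightarrow> f x \<le> g x"
  shows "\<E> p f \<le> \<E> p g"
  using assms by (intro integral_mono_AE) (auto simp: AE_measure_pmf_iff integrable_measure_pmf_finite)

lemma E_add:
  fixes f :: "'a \<Rightarrow> real"
  assumes "finite (set_pmf p)"
  shows "\<E> p (\<lambda>x. f x + g x) = \<E> p f + \<E> p g"
  using assms by (simp add: integrable_measure_pmf_finite)

lemma E_diff:
  fixes f :: "'a \<Rightarrow> real"
  assumes "finite (set_pmf p)"
  shows "\<E> p (\<lambda>x. f x - g x) = \<E> p f - \<E> p g"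
  using assms by (simp add: integrable_measure_pmf_finite)

lemma E_sum:
  fixes f :: "'i \<Rightarrow> 'a \<Rightarrow> real"
  assumes "finite (set_pmf p)"
  shows "\<E> p (\<lambda>x. \<Sum>i\<in>I. f i x) = (\<Sum>i\<in>I. \<E> p (f i))"
  using assms by (intro Bochner_Integration.integral_sum) (simp add: integrable_measure_pmf_finite)

lemma E_abs_le:
  fixes f :: "'a \<Rightarrow> real"
  shows "\<bar>\<E> p f\<bar> \<le> \<E> p (\<lambda>x. \<bar>f x\<bar>)"
  by (rule integral_abs_bound)

lemma E_bounded:
  fixes f :: "'a \<Rightarrow> real"
  assumes "finite (set_pmf p)" "\<And>x. x \<in> set_pmf p \<Longrightarrow> \<bar>f x\<bar> \<le> b"
  shows "\<bar>\<E> p f\<bar> \<le> b"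
proof -
  have "\<bar>\<E> p f\<bar> \<le> \<E> p (\<lambda>x. \<bar>f x\<bar>)" by (rule E_abs_le)
  also have "\<dots> \<le> \<E> p (\<lambda>_. b)" using assms by (intro E_mono) auto
  finally show ?thesis by simp
qed

lemma E_finite_set:
  fixes f :: "'a \<Rightarrow> real"
  assumes "finite B" "set_pmf p \<subseteq> B"
  shows "\<E> p f = (\<Sum>x\<in>B. pmf p x * f x)"
  using assms by (subst integral_measure_pmf[of B]) auto

lemma E_indicator: "\<E> p (indicator {x}) = pmf p x"
  by (simp add: measure_pmf_single)

lemma E_pmf_of_set:
  fixes f :: "'a \<Rightarrow> real"
  assumes "finite I" "I \<noteq> {}"
  shows "\<E> (pmf_of_set I) f = (\<Sum>i\<in>I. f i) / real (card I)"
  using assms by (simp add: integral_pmf_of_set)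

section \<open>Averages of independent centred variables\<close>

text \<open>Splitting off the new coordinate leaves a cross term that contains the mean of the
  remaining sum as a factor. It vanishes, which is why the zero mean is carried along in the
  induction.\<close>

lemma Pi_pmf_mean_square:
  fixes f :: "'i \<Rightarrow> 'a \<Rightarrow> real"
  assumes "finite I" "\<And>i. i \<in> I \<Longrightarrow> finite (set_pmf (p i))"
    and "\<And>i. i \<in> I \<Longrightarrow> \<E> (p i) (f i) = 0"
    and "\<And>i y. i \<in> I \<Longrightarrow> y \<in> set_pmf (p i) \<Longrightarrow> \<bar>f i y\<bar> \<le> b"
  shows "\<E> (Pi_pmf I d p) (\<lambda>y. (\<Sum>i\<in>I. f i (y i))\<^sup>2) \<le> real (card I) * b\<^sup>2
    \<and> \<E> (Pi_pmf I d p) (\<lambda>y. \<Sum>i\<in>I. f i (y i)) = 0"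
  using assms
proof (induction I rule: finite_induct)
  case empty
  then show ?case by simp
next
  case (insert j I)
  let ?P = "Pi_pmf I d p"
  have finP: "finite (set_pmf ?P)"
    using insert by (auto simp: set_Pi_pmf intro!: finite_PiE_dflt)
  have finj: "finite (set_pmf (p j))" using insert by auto
  have IH: "\<E> ?P (\<lambda>y. (\<Sum>i\<in>I. f i (y i))\<^sup>2) \<le> real (card I) * b\<^sup>2"
    "\<E> ?P (\<lambda>y. \<Sum>i\<in>I. f i (y i)) = 0"
    using insert by auto
  have sum_upd: "(\<Sum>i\<in>insert j I. f i ((y(j := u)) i)) = f j u + (\<Sum>i\<in>I. f i (y i))" for y u
  proof -
    have "(\<Sum>i\<in>I. f i ((y(j := u)) i)) = (\<Sum>i\<in>I. f i (y i))"
      using insert.hyps by (intro sum.cong) auto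
    then show ?thesis using insert.hyps by simp
  qed
  have split: "\<E> (Pi_pmf (insert j I) d p) h = \<E> (p j) (\<lambda>u. \<E> ?P (\<lambda>y. h (y(j := u))))"
    for h :: "('i \<Rightarrow> 'a) \<Rightarrow> real"
    using insert.hyps finP finj
    by (simp add: Pi_pmf_insert' E_bind flip: map_pmf_def)
  have "\<E> (Pi_pmf (insert j I) d p) (\<lambda>y. \<Sum>i\<in>insert j I. f i (y i)) = \<E> (p j) (f j)"
    unfolding split sum_upd using IH(2) finP by (simp add: E_add)
  moreover have "\<E> (Pi_pmf (insert j I) d p) (\<lambda>y. (\<Sum>i\<in>insert j I. f i (y i))\<^sup>2)
      = \<E> (p j) (\<lambda>u. (f j u)\<^sup>2 + \<E> ?P (\<lambda>y. (\<Sum>i\<in>I. f i (y i))\<^sup>2))"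
    unfolding split sum_upd using IH(2) finP
    by (simp add: power2_sum E_add mult.assoc)
  moreover have "\<dots> \<le> \<E> (p j) (\<lambda>u. b\<^sup>2 + real (card I) * b\<^sup>2)"
  proof (rule E_mono[OF finj])
    fix u assume "u \<in> set_pmf (p j)"
    then have "\<bar>f j u\<bar> \<le> b" using insert.prems(3)[of j u] by auto
    then have "(f j u)\<^sup>2 \<le> b\<^sup>2"
      by (metis abs_ge_zero power2_abs power_mono)
    then show "(f j u)\<^sup>2 + \<E> ?P (\<lambda>y. (\<Sum>i\<in>I. f i (y i))\<^sup>2) \<le> b\<^sup>2 + real (card I) * b\<^sup>2"
      using IH(1) by simp
  qed
  ultimately show ?case
    using insert.hyps insert.prems(2)[of j] by (simp add: algebra_simps)
qed

text \<open>Cauchy-Schwarz in linearised form: the pointwise bound |z| <= k/2 z^2 + 1/(2k) is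
  integrated, so that only the second moment enters.\<close>

lemma Pi_pmf_mean_abs:
  fixes f :: "'i \<Rightarrow> 'a \<Rightarrow> real"
  assumes "finite I" "\<And>i. i \<in> I \<Longrightarrow> finite (set_pmf (p i))"
    and "\<And>i. i \<in> I \<Longrightarrow> \<E> (p i) (f i) = 0"
    and "\<And>i y. i \<in> I \<Longrightarrow> y \<in> set_pmf (p i) \<Longrightarrow> \<bar>f i y\<bar> \<le> b" and "b > 0" and "I \<noteq> {}"
  shows "\<E> (Pi_pmf I d p) (\<lambda>y. \<bar>1 / real (card I) * (\<Sum>i\<in>I. f i (y i))\<bar>) \<le> b / sqrt (card I)"
proof -
  let ?P = "Pi_pmf I d p" and ?S = "\<lambda>y. \<Sum>i\<in>I. f i (y i)"
  define n where "n = real (card I)"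
  have n: "n > 0" using assms by (simp add: n_def card_gt_0_iff)
  have finP: "finite (set_pmf ?P)"
    using assms by (auto simp: set_Pi_pmf intro!: finite_PiE_dflt)
  \<comment> \<open>The second moment of the average is at most b^2/n; this choice makes both terms
    of the bound equal to b / (2 sqrt n).\<close>
  define k where "k = sqrt n / b"
  have k: "k > 0" using n assms by (simp add: k_def)
  have amgm: "\<bar>z\<bar> \<le> k / 2 * z\<^sup>2 + 1 / (2 * k)" for z :: real
  proof -
    have "0 \<le> (k * \<bar>z\<bar> - 1)\<^sup>2" by simp
    then have "2 * k * \<bar>z\<bar> \<le> k\<^sup>2 * z\<^sup>2 + 1"
      by (simp add: power2_diff power_mult_distrib)
    then show ?thesis using k by (simp add: field_simps power2_eq_square)
  qed
  have "\<E> ?P (\<lambda>y. \<bar>1 / n * ?S y\<bar>) \<le> \<E> ?P (\<lambda>y. k / 2 * (1 / n * ?S y)\<^sup>2 + 1 / (2 * k))"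
    by (rule E_mono[OF finP]) (rule amgm)
  also have "\<dots> = k / 2 * (1 / n\<^sup>2) * \<E> ?P (\<lambda>y. (?S y)\<^sup>2) + 1 / (2 * k)"
    using finP by (simp add: E_add power_divide)
  also have "\<dots> \<le> k / 2 * (1 / n\<^sup>2) * (n * b\<^sup>2) + 1 / (2 * k)"
    using Pi_pmf_mean_square[OF assms(1-4)] k n
    by (intro add_right_mono mult_left_mono) (auto simp: n_def)
  also have "\<dots> = b / sqrt n"
  proof -
    define r where "r = sqrt n"
    have r: "r > 0" "n = r\<^sup>2" using n by (auto simp: r_def)
    show ?thesis using assms(5) r(1) unfolding k_def r_def[symmetric] r(2) 
      by (simp add: field_simps power2_eq_square)
  qed
  finally show ?thesis by (simp add: n_def)
qed

subsection \<open>The distance \<open>W1\<close>\<close>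

lemma W1_nonneg: "0 \<le> W1 B \<mu> \<nu>"
  by (simp add: W1_def sum_nonneg)

lemma W1_triangle: "W1 B \<mu> \<sigma> \<le> W1 B \<mu> \<nu> + W1 B \<nu> \<sigma>"
  unfolding W1_def by (subst sum.distrib[symmetric], rule sum_mono) linarith

lemma W1_self: "W1 B \<mu> \<mu> = 0"
  by (simp add: W1_def)

text \<open>Each row of the kernel has total mass 1 on \<open>D\<close>, so the kernel cannot
  enlarge the distance of two laws. This serves both for stopping maps and for carrying a mismatch
  of initial laws to time \<open>T\<close>.\<close>

lemma W1_bind_le:
  assumes "finite B" "finite D" "set_pmf \<mu> \<subseteq> B" "set_pmf \<nu> \<subseteq> B"
    and "\<And>x. x \<in> B \<Longrightarrow> set_pmf (K x) \<subseteq> D"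
  shows "W1 D (bind_pmf \<mu> K) (bind_pmf \<nu> K) \<le> W1 B \<mu> \<nu>"
proof -
  have b: "pmf (bind_pmf \<kappa> K) y = (\<Sum>x\<in>B. pmf \<kappa> x * pmf (K x) y)" if "set_pmf \<kappa> \<subseteq> B" for \<kappa> y
    unfolding pmf_bind using assms that by (subst E_finite_set[of B]) auto
  have "W1 D (bind_pmf \<mu> K) (bind_pmf \<nu> K)
      = (\<Sum>y\<in>D. \<bar>\<Sum>x\<in>B. (pmf \<mu> x - pmf \<nu> x) * pmf (K x) y\<bar>)"
    unfolding W1_def b[OF assms(3)] b[OF assms(4)]
    by (simp add: sum_subtractf left_diff_distrib)
  also have "\<dots> \<le> (\<Sum>y\<in>D. \<Sum>x\<in>B. \<bar>pmf \<mu> x - pmf \<nu> x\<bar> * pmf (K x) y)"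
    by (intro sum_mono order.trans[OF sum_abs]) (simp add: abs_mult)
  also have "\<dots> = (\<Sum>x\<in>B. \<bar>pmf \<mu> x - pmf \<nu> x\<bar> * (\<Sum>y\<in>D. pmf (K x) y))"
    by (subst sum.swap) (simp add: sum_distrib_left)
  also have "\<dots> = W1 B \<mu> \<nu>"
    unfolding W1_def using assms by (intro sum.cong) (auto simp: sum_pmf_eq_1)
  finally show ?thesis .
qed

lemma W1_map_le:
  assumes "finite B" "set_pmf \<mu> \<subseteq> B" "set_pmf \<nu> \<subseteq> B" "f ` B \<subseteq> B"
  shows "W1 B (map_pmf f \<mu>) (map_pmf f \<nu>) \<le> W1 B \<mu> \<nu>"
  unfolding map_pmf_def using assms by (intro W1_bind_le) auto

subsection \<open>Paths\<close>

lemma finite_paths: "finite (paths T :: 's::finite path set)"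
  unfolding paths_def by (intro finite_PiE) auto

lemma stopped_paths_subset: "stopped_paths T s \<subseteq> paths T"
  by (auto simp: stopped_paths_iff)

lemma stopped_in_paths: "x \<in> stopped_paths T s \<Longrightarrow> x \<in> paths T"
  by (simp add: stopped_paths_iff)

lemma finite_stopped_paths: "finite (stopped_paths T s :: 's::finite path set)"
  by (rule finite_subset[OF stopped_paths_subset finite_paths])

lemma stopped_paths_nonempty: "stopped_paths T s \<noteq> {}"
  unfolding stopped_paths_def paths_def by (simp add: PiE_eq_empty_iff)

lemma stop_in_stopped: "x \<in> paths T \<Longrightarrow> stop T s x \<in> stopped_paths T s"
  by (simp add: stopped_paths_def)

lemma stop_extend:
  assumes "r \<le> s" "s < T" "x \<in> stopped_paths T s"
  shows "stop T r (extend T s x y) = stop T r x"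
  using extend_facts(2)[OF assms(2,3)] stop_stop[OF assms(1)] by metis

lemma extend_in_paths: "extend T s x y \<in> paths T"
  by (auto simp: extend_def paths_def)

lemma map_stop_in_laws: "m \<in> laws_on (paths T) \<Longrightarrow> map_pmf (stop T s) m \<in> laws_on (paths T)"
  using stop_in_paths by (auto simp: laws_on_def)

subsection \<open>Costs in a frozen environment\<close>

text \<open>Kernels are compared only on sets \<open>Z s\<close> that the chain does not leave,
  typically the paths stopped at the current time. With equal kernels the second conclusion is a
  statement on supports.\<close>

lemma chain_cong:
  assumes "\<And>s z. s \<in> {t..<t + n} \<Longrightarrow> z \<in> Z s \<Longrightarrow> K s z = K' s z"
    and "\<And>s z. s \<in> {t..<t + n} \<Longrightarrow> z \<in> Z s \<Longrightarrow> set_pmf (K s z) \<subseteq> Z (Suc s)" and "z \<in> Z t"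
  shows "chain K t z n = chain K' t z n \<and> set_pmf (chain K t z n) \<subseteq> Z (t + n)"
  using assms
proof (induction n)
  case (Suc n)
  have IH: "chain K t z n = chain K' t z n" "set_pmf (chain K t z n) \<subseteq> Z (t + n)"
    using Suc.IH Suc.prems by auto
  have "bind_pmf (chain K t z n) (K (t + n)) = bind_pmf (chain K t z n) (K' (t + n))"
    using IH(2) Suc.prems(1)[of "t + n"] by (intro bind_pmf_cong) auto
  moreover have "set_pmf (bind_pmf (chain K t z n) (K (t + n))) \<subseteq> Z (t + Suc n)"
    using IH(2) Suc.prems(2)[of "t + n"] by fastforce
  ultimately show ?case using IH(1) by simp
qed simp

text \<open>\<open>t\<close> is fixed once and for all, so that later notions such as
  \<open>cost\<close> carry no starting time. A nonnegative \<open>L_q\<close> keeps the constants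
  built from it nonnegative.\<close>

locale continuous_mean_field_game = mean_field_game T A q F G
  for T :: nat
    and A :: "(real ^ 'k) set"
    and q :: "nat \<Rightarrow> 's::finite path \<Rightarrow> 's path pmf \<Rightarrow> real ^ 'k \<Rightarrow> 's \<Rightarrow> real"
    and F :: "nat \<Rightarrow> 's path \<Rightarrow> 's path pmf \<Rightarrow> real ^ 'k \<Rightarrow> real"
    and G :: "'s path \<Rightarrow> 's path pmf \<Rightarrow> real" +
  fixes t :: nat and L_q C_0 :: real and \<rho> :: "real \<Rightarrow> real"
  assumes t: "t \<le> T" and L_q: "0 \<le> L_q"
    and q_Lipschitz:
      "\<And>s x m m' a a' y. s \<le> T \<Longrightarrow> x \<in> paths T
        \<Longrightarrow> m \<in> laws_on (paths T) \<Longrightarrow> m' \<in> laws_on (paths T) \<Longrightarrow> a \<in> A \<Longrightarrow> a' \<in> A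
        \<Longrightarrow> \<bar>q s x m a y - q s x m' a' y\<bar> \<le> L_q * (W1 (paths T) m m' + norm (a - a'))"
    and F_bounded:
      "\<And>s x m a. s \<le> T \<Longrightarrow> x \<in> paths T \<Longrightarrow> m \<in> laws_on (paths T) \<Longrightarrow> a \<in> A
        \<Longrightarrow> \<bar>F s x m a\<bar> \<le> C_0"
    and G_bounded:
      "\<And>x m. x \<in> paths T \<Longrightarrow> m \<in> laws_on (paths T) \<Longrightarrow> \<bar>G x m\<bar> \<le> C_0"
    and \<rho>: "modulus_of_continuity \<rho>"
    and F_uniformly_continuous:
      "\<And>s x m m' a a'. s \<le> T \<Longrightarrow> x \<in> paths T
        \<Longrightarrow> m \<in> laws_on (paths T) \<Longrightarrow> m' \<in> laws_on (paths T) \<Longrightarrow> a \<in> A \<Longrightarrow> a' \<in> A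
        \<Longrightarrow> \<bar>F s x m a - F s x m' a'\<bar> \<le> \<rho> (W1 (paths T) m m' + norm (a - a'))"
    and G_uniformly_continuous:
      "\<And>x m m'. x \<in> paths T \<Longrightarrow> m \<in> laws_on (paths T) \<Longrightarrow> m' \<in> laws_on (paths T)
        \<Longrightarrow> \<bar>G x m - G x m'\<bar> \<le> \<rho> (W1 (paths T) m m')"
begin

section \<open>Regularity of the data and integration against relaxed controls\<close>

lemma C_0_nonneg: "0 \<le> C_0"
proof -
  obtain x :: "'s path" where "x \<in> stopped_paths T t" using stopped_paths_nonempty by blast
  then have "x \<in> paths T" by (rule stopped_in_paths)
  then show ?thesis
    using G_bounded[of x "return_pmf x"] by (auto simp: laws_on_def)
qed

lemma \<rho>_small:
  assumes "\<delta> > 0"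
  obtains \<eta> where "\<eta> > 0" "\<And>u. 0 \<le> u \<Longrightarrow> u < \<eta> \<Longrightarrow> \<rho> u \<le> \<delta>"
proof -
  have "(\<rho> \<longlongrightarrow> 0) (at_right 0)" "\<rho> 0 = 0"
    using \<rho> by (auto simp: modulus_of_continuity_def)
  from order_tendstoD(2)[OF this(1) assms] obtain \<eta> where
    "\<eta> > 0" "\<And>u. 0 < u \<Longrightarrow> u < \<eta> \<Longrightarrow> \<rho> u < \<delta>"
    by (auto simp: eventually_at_right_field)
  then show ?thesis using that[of \<eta>] \<open>\<rho> 0 = 0\<close> assms
    by (metis less_eq_real_def)
qed

text \<open>For bounded functions, uniform continuity yields an affine bound,
  which can be integrated.\<close>

lemma affine_bound:
  assumes "\<delta> > 0"
  obtains B where "B \<ge> 0"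
    "\<And>s (x :: 's path) m m' a a'. s \<le> T \<Longrightarrow> x \<in> paths T \<Longrightarrow> m \<in> laws_on (paths T) \<Longrightarrow> m' \<in> laws_on (paths T)
      \<Longrightarrow> a \<in> A \<Longrightarrow> a' \<in> A \<Longrightarrow> \<bar>F s x m a - F s x m' a'\<bar> \<le> \<delta> + B * (W1 (paths T) m m' + norm (a - a'))"
    "\<And>(x :: 's path) m m'. x \<in> paths T \<Longrightarrow> m \<in> laws_on (paths T) \<Longrightarrow> m' \<in> laws_on (paths T)
      \<Longrightarrow> \<bar>G x m - G x m'\<bar> \<le> \<delta> + B * W1 (paths T) m m'"
proof -
  obtain \<eta> where \<eta>: "\<eta> > 0" "\<And>u. 0 \<le> u \<Longrightarrow> u < \<eta> \<Longrightarrow> \<rho> u \<le> \<delta>"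
    using \<rho>_small[OF assms] by blast
  \<comment> \<open>Beyond \<eta> the modulus gives no useful bound, but differences never exceed 2
    \<open>C_0\<close>, and with this slope \<open>B * u\<close> is at least that large
    there.\<close>
  define B where "B = 2 * C_0 / \<eta>"
  have B: "B \<ge> 0" using C_0_nonneg \<eta> by (simp add: B_def)
  have *: "d \<le> \<delta> + B * u" if "d \<le> \<rho> u" "d \<le> 2 * C_0" "0 \<le> u" for d u
  proof (cases "u < \<eta>")
    case True
    then have "d \<le> \<delta>" using that \<eta>(2)[of u] by simp
    then show ?thesis using B that(3) by (smt (verit) mult_nonneg_nonneg)
  next
    case False
    then have "2 * C_0 \<le> B * u"
      using \<eta>(1) C_0_nonneg by (simp add: B_def field_simps mult_left_mono)
    then show ?thesis using that assms by simp
  qed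
  show thesis
  proof (rule that[OF B])
    fix s a a' and x :: "'s path" and m m' :: "'s path pmf"
    assume "s \<le> T" "x \<in> paths T" "m \<in> laws_on (paths T)" "m' \<in> laws_on (paths T)" "a \<in> A" "a' \<in> A"
    then show "\<bar>F s x m a - F s x m' a'\<bar> \<le> \<delta> + B * (W1 (paths T) m m' + norm (a - a'))"
      using F_bounded[of s x m a] F_bounded[of s x m' a'] F_uniformly_continuous[of s x m m' a a']
      by (intro *) (auto simp: W1_nonneg)
  next
    fix x :: "'s path" and m m' :: "'s path pmf"
    assume "x \<in> paths T" "m \<in> laws_on (paths T)" "m' \<in> laws_on (paths T)"
    then show "\<bar>G x m - G x m'\<bar> \<le> \<delta> + B * W1 (paths T) m m'"
      using G_bounded[of x m] G_bounded[of x m'] G_uniformly_continuous[of x m m']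
      by (intro *) (auto simp: W1_nonneg)
  qed
qed

text \<open>Measurability in the action is derived rather than assumed: at fixed \<open>m\<close>
  the Lipschitz bound gives continuity on \<open>A\<close>.\<close>

lemma measurable_q:
  assumes "s \<le> T" "x \<in> paths T" "m \<in> laws_on (paths T)"
  shows "(\<lambda>a. q s x m a y) \<in> borel_measurable (restrict_space borel A)"
proof -
  have "L_q-lipschitz_on A (\<lambda>a. q s x m a y)"
    using q_Lipschitz[OF assms assms(3), of _ _ y] L_q
    by (intro lipschitz_onI) (auto simp: dist_norm W1_self)
  then show ?thesis
    by (intro borel_measurable_continuous_on_restrict lipschitz_on_continuous_on)
qed

lemma measurable_F:
  assumes "s \<le> T" "x \<in> paths T" "m \<in> laws_on (paths T)"
  shows "(\<lambda>a. F s x m a) \<in> borel_measurable (restrict_space borel A)"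
proof -
  have "continuous_on A (\<lambda>a. F s x m a)"
    unfolding continuous_on_iff
  proof (intro ballI allI impI)
    fix a e assume a: "a \<in> A" and e: "(e::real) > 0"
    obtain \<eta> where \<eta>: "\<eta> > 0" "\<And>u. 0 \<le> u \<Longrightarrow> u < \<eta> \<Longrightarrow> \<rho> u \<le> e / 2"
      using \<rho>_small[of "e / 2"] e by auto
    have "dist (F s x m a') (F s x m a) < e" if "a' \<in> A" "dist a' a < \<eta>" for a'
      using F_uniformly_continuous[OF assms assms(3) that(1) a] \<eta>(2)[of "norm (a' - a)"] that(2) e
      by (simp add: dist_norm W1_self)
    then show "\<exists>d>0. \<forall>x'\<in>A. dist x' a < d \<longrightarrow> dist (F s x m x') (F s x m a) < e"
      using \<eta>(1) by blast
  qed
  then show ?thesis by (rule borel_measurable_continuous_on_restrict)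
qed

lemma relaxed_control_space:
  assumes "\<gamma> \<in> relaxed_controls" "s \<le> T" "x \<in> paths T"
  shows "prob_space (\<gamma> s x)" "sets (\<gamma> s x) = sets (restrict_space borel A)" "space (\<gamma> s x) = A"
proof -
  show 1: "sets (\<gamma> s x) = sets (restrict_space borel A)" and "prob_space (\<gamma> s x)"
    using assms unfolding relaxed_controls_def space_prob_algebra by blast+
  show "space (\<gamma> s x) = A"
    using sets_eq_imp_space_eq[OF 1] by (simp add: space_restrict_space)
qed

lemma relaxed_control_integrable:
  fixes f :: "real ^ 'k \<Rightarrow> real"
  assumes "\<gamma> \<in> relaxed_controls" "s \<le> T" "x \<in> paths T"
    and "f \<in> borel_measurable (restrict_space borel A)" "\<And>a. a \<in> A \<Longrightarrow> \<bar>f a\<bar> \<le> b"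
  shows "integrable (\<gamma> s x) f"
proof -
  interpret prob_space "\<gamma> s x" by (rule relaxed_control_space[OF assms(1-3)])
  show ?thesis
    using assms(4,5) relaxed_control_space[OF assms(1-3)]
    by (intro integrable_const_bound[where B = b] AE_I2)
      (auto cong: measurable_cong_sets[OF relaxed_control_space(2)[OF assms(1-3)] refl])
qed

lemma integral_relaxed_bounded:
  fixes f :: "real ^ 'k \<Rightarrow> real"
  assumes "\<gamma> \<in> relaxed_controls" "s \<le> T" "x \<in> paths T"
    and "f \<in> borel_measurable (restrict_space borel A)" "\<And>a. a \<in> A \<Longrightarrow> \<bar>f a\<bar> \<le> b"
  shows "\<bar>\<integral>a. f a \<partial>\<gamma> s x\<bar> \<le> b"
proof -
  interpret prob_space "\<gamma> s x" by (rule relaxed_control_space[OF assms(1-3)])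
  note I = relaxed_control_integrable[OF assms]
  have sp: "space (\<gamma> s x) = A" by (rule relaxed_control_space[OF assms(1-3)])
  have "\<bar>\<integral>a. f a \<partial>\<gamma> s x\<bar> \<le> (\<integral>a. \<bar>f a\<bar> \<partial>\<gamma> s x)" by (rule integral_abs_bound)
  also have "\<dots> \<le> (\<integral>a. b \<partial>\<gamma> s x)"
    using I assms(5) sp by (intro integral_mono) auto
  finally show ?thesis by (simp add: prob_space)
qed

text \<open>If every action lay strictly above the mean, so would the mean itself. The benchmark is
  the mean and not the infimum because \<open>f\<close> may have no minimiser on
  \<open>A\<close>.\<close>

lemma pure_action_below_mean:
  fixes f :: "real ^ 'k \<Rightarrow> real"
  assumes "\<gamma> \<in> relaxed_controls" "s \<le> T" "x \<in> paths T" and "integrable (\<gamma> s x) f"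
  shows "\<exists>a\<in>A. f a \<le> (\<integral>a. f a \<partial>\<gamma> s x)"
proof (rule ccontr)
  interpret prob_space "\<gamma> s x" by (rule relaxed_control_space[OF assms(1-3)])
  assume "\<not> ?thesis"
  then have "AE a in \<gamma> s x. (\<integral>a. f a \<partial>\<gamma> s x) < f a"
    using relaxed_control_space(3)[OF assms(1-3)] by (intro AE_I2) auto
  then have "(\<integral>a'. (\<integral>a. f a \<partial>\<gamma> s x) \<partial>\<gamma> s x) < (\<integral>a. f a \<partial>\<gamma> s x)"
    using assms(4) by (intro integral_less_AE_space) (auto simp: emeasure_space_1)
  then show False by (simp add: prob_space)
qed

section \<open>Pure controls and dynamic programming\<close>

text \<open>Controls for a frozen environment: the law is fixed and therefore no argument. The
  conditions include time \<open>T\<close>, at which nobody acts, to match the domain of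
  \<open>relaxed_controls\<close>.\<close>

definition pure_controls :: "(nat \<Rightarrow> 's path \<Rightarrow> real ^ 'k) set" where
  "pure_controls = {b. \<forall>s\<le>T. \<forall>x\<in>paths T. b s x \<in> A \<and> b s (stop T s x) = b s x}"

lemma pure_controls_in_A: "b \<in> pure_controls \<Longrightarrow> s \<le> T \<Longrightarrow> x \<in> paths T \<Longrightarrow> b s x \<in> A"
  by (simp add: pure_controls_def)

definition dirac :: "(nat \<Rightarrow> 's path \<Rightarrow> real ^ 'k) \<Rightarrow> nat \<Rightarrow> 's path \<Rightarrow> (real ^ 'k) measure" where
  "dirac b s x = return (restrict_space borel A) (b s x)"

lemma dirac_relaxed: "b \<in> pure_controls \<Longrightarrow> dirac b \<in> relaxed_controls"
  by (simp add: pure_controls_def relaxed_controls_def dirac_def space_prob_algebra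
      space_restrict_space prob_space_return)

lemma integral_dirac:
  fixes f :: "real ^ 'k \<Rightarrow> real"
  assumes "b \<in> pure_controls" "s \<le> T" "x \<in> paths T" "f \<in> borel_measurable (restrict_space borel A)"
  shows "(\<integral>a. f a \<partial>dirac b s x) = f (b s x)"
proof -
  show ?thesis
    unfolding dirac_def using assms(4) pure_controls_in_A[OF assms(1-3)] by (subst integral_return) (auto simp: space_restrict_space)
qed

lemma set_relaxed_step:
  assumes "s < T" "x \<in> stopped_paths T s"
  shows "set_pmf (relaxed_step \<gamma> m s x) \<subseteq> stopped_paths T (Suc s)"
  using extend_facts(1)[OF assms] by (auto simp: relaxed_step_def)

lemma set_relaxed_chain:
  assumes "x \<in> stopped_paths T t" "t + n \<le> T"
  shows "set_pmf (chain (relaxed_step \<gamma> m) t x n) \<subseteq> stopped_paths T (t + n)"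
  using assms set_relaxed_step
    chain_cong[of t n "stopped_paths T" "relaxed_step \<gamma> m" "relaxed_step \<gamma> m" x]
  by auto

lemma finite_relaxed_chain:
  assumes "x \<in> stopped_paths T t" "t + n \<le> T"
  shows "finite (set_pmf (chain (relaxed_step \<gamma> m) t x n))"
  using set_relaxed_chain[OF assms] finite_stopped_paths by (rule finite_subset)

lemma expectation_relaxed_step:
  fixes h :: "'s path \<Rightarrow> real"
  assumes "\<gamma> \<in> relaxed_controls" "s \<le> T" "x \<in> paths T" "m \<in> laws_on (paths T)"
  shows "\<E> (relaxed_step \<gamma> m s x) h = (\<integral>a. (\<Sum>y\<in>UNIV. q s x m a y * h (extend T s x y)) \<partial>\<gamma> s x)"
proof -
  have int: "integrable (\<gamma> s x) (\<lambda>a. q s x m a y)" for y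
  proof (rule relaxed_control_integrable[OF assms(1-3) measurable_q[OF assms(2-4)]])
    show "\<bar>q s x m a y\<bar> \<le> 1" if "a \<in> A" for a
      using q_range[OF assms(2-4) that, of y] by simp
  qed
  have "\<E> (relaxed_step \<gamma> m s x) h = (\<Sum>y\<in>UNIV. (\<integral>a. q s x m a y \<partial>\<gamma> s x) * h (extend T s x y))"
    unfolding relaxed_step_def integral_map_pmf
    using assms measurable_q by (subst E_finite_set[of UNIV]) (auto simp: pmf_relaxed_kernel)
  also have "\<dots> = (\<integral>a. (\<Sum>y\<in>UNIV. q s x m a y * h (extend T s x y)) \<partial>\<gamma> s x)"
    using int by (subst Bochner_Integration.integral_sum) auto
  finally show ?thesis .
qed

lemma q_sum_bounded:
  fixes h :: "'s \<Rightarrow> real"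
  assumes "s \<le> T" "x \<in> paths T" "m \<in> laws_on (paths T)" "a \<in> A" "\<And>y. \<bar>h y\<bar> \<le> b"
  shows "\<bar>\<Sum>y\<in>UNIV. q s x m a y * h y\<bar> \<le> b"
proof -
  have "\<bar>\<Sum>y\<in>UNIV. q s x m a y * h y\<bar> \<le> (\<Sum>y\<in>UNIV. q s x m a y * b)"
    using q_range[OF assms(1-4)] assms(5)
    by (intro order.trans[OF sum_abs] sum_mono) (simp add: abs_mult abs_of_pos mult_left_mono less_imp_le)
  also have "\<dots> = b" using q_sum[OF assms(1-4)] by (simp flip: sum_distrib_right)
  finally show ?thesis .
qed

definition running :: "(nat \<Rightarrow> 's path \<Rightarrow> (real ^ 'k) measure) \<Rightarrow> 's path pmf \<Rightarrow> nat \<Rightarrow> 's path \<Rightarrow> real" where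
  "running \<gamma> m r x = (\<integral>a. F r x m a \<partial>\<gamma> r x)"

text \<open>Terminal cost \<open>h\<close> and weight \<open>c\<close> are free and of either sign,
  so that one recursion serves several ends: c = 1 gives costs, c = 0 with an indicator gives
  probabilities of paths, and other choices give linear functionals of law and cost
  together.\<close>

definition cost :: "(nat \<Rightarrow> 's path \<Rightarrow> (real ^ 'k) measure) \<Rightarrow> 's path pmf \<Rightarrow> ('s path \<Rightarrow> real)
    \<Rightarrow> real \<Rightarrow> 's path \<Rightarrow> nat \<Rightarrow> real" where
  "cost \<gamma> m h c x n = \<E> (chain (relaxed_step \<gamma> m) t x n)
     (\<lambda>X. h X + c * (\<Sum>r = t..<t + n. running \<gamma> m r X))"

lemma q_stop:
  assumes "s \<le> T" "x \<in> paths T" "m \<in> laws_on (paths T)" "a \<in> A"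
  shows "q s x (map_pmf (stop T s) m) a y = q s x m a y" "q s (stop T s x) m a y = q s x m a y"
  using q_adapted[OF assms] q_adapted[OF assms(1,2) map_stop_in_laws[OF assms(3)] assms(4)]
    q_adapted[OF assms(1) stop_in_paths[OF assms(2)] assms(3,4)]
  by (simp_all add: map_pmf_comp stop_stop)

lemma F_stop:
  assumes "s \<le> T" "x \<in> paths T" "m \<in> laws_on (paths T)" "a \<in> A"
  shows "F s x (map_pmf (stop T s) m) a = F s x m a" "F s (stop T s x) m a = F s x m a"
  using F_adapted[OF assms] F_adapted[OF assms(1,2) map_stop_in_laws[OF assms(3)] assms(4)]
    F_adapted[OF assms(1) stop_in_paths[OF assms(2)] assms(3,4)]
  by (simp_all add: map_pmf_comp stop_stop)

lemma relaxed_control_stop: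
  "\<gamma> \<in> relaxed_controls \<Longrightarrow> s \<le> T \<Longrightarrow> x \<in> paths T \<Longrightarrow> \<gamma> s (stop T s x) = \<gamma> s x"
  by (simp add: relaxed_controls_def)

lemma running_stop:
  assumes "\<gamma> \<in> relaxed_controls" "r \<le> T" "x \<in> paths T" "m \<in> laws_on (paths T)"
  shows "running \<gamma> m r (stop T r x) = running \<gamma> m r x"
  unfolding running_def relaxed_control_stop[OF assms(1-3)]
  using F_stop(2)[OF assms(2-4)] relaxed_control_space(3)[OF assms(1-3)]
  by (intro Bochner_Integration.integral_cong) auto

lemma running_extend:
  assumes "\<gamma> \<in> relaxed_controls" "r \<le> s" "s < T" "x \<in> stopped_paths T s" "m \<in> laws_on (paths T)"
  shows "running \<gamma> m r (extend T s x y) = running \<gamma> m r x"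
  using running_stop[OF assms(1) _ extend_in_paths[of T s x y] assms(5), of r]
    running_stop[OF assms(1) _ stopped_in_paths[OF assms(4)] assms(5), of r]
    stop_extend[OF assms(2-4), of y] assms(2,3) by simp

lemma running_bounded:
  assumes "\<gamma> \<in> relaxed_controls" "r \<le> T" "x \<in> paths T" "m \<in> laws_on (paths T)"
  shows "\<bar>running \<gamma> m r x\<bar> \<le> C_0"
  unfolding running_def using assms F_bounded measurable_F
  by (intro integral_relaxed_bounded) auto

text \<open>The last stage of the cost is absorbed into the terminal cost, so that inductions on the horizon
  can change the terminal cost.\<close>

definition stage :: "'s path pmf \<Rightarrow> ('s path \<Rightarrow> real) \<Rightarrow> real \<Rightarrow> nat \<Rightarrow> 's path \<Rightarrow> real ^ 'k \<Rightarrow> real" where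
  "stage m h c s x a = (\<Sum>y\<in>UNIV. q s x m a y * h (extend T s x y)) + c * F s x m a"

lemma measurable_stage:
  assumes "s \<le> T" "x \<in> paths T" "m \<in> laws_on (paths T)"
  shows "stage m h c s x \<in> borel_measurable (restrict_space borel A)"
  unfolding stage_def[abs_def] using measurable_q[OF assms] measurable_F[OF assms]
  by measurable

lemma paths_bounded:
  fixes h :: "'s path \<Rightarrow> real"
  obtains b where "b \<ge> 0" "\<And>x. x \<in> paths T \<Longrightarrow> \<bar>h x\<bar> \<le> b"
proof
  show "0 \<le> (\<Sum>x\<in>paths T. \<bar>h x\<bar>)" by (rule sum_nonneg) simp
  show "\<bar>h x\<bar> \<le> (\<Sum>x\<in>paths T. \<bar>h x\<bar>)" if "x \<in> paths T" for x
    using that finite_paths by (intro member_le_sum[where f = "\<lambda>x. \<bar>h x\<bar>"]) auto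
qed

lemma integrable_stage:
  assumes "\<gamma> \<in> relaxed_controls" "s \<le> T" "x \<in> paths T" "m \<in> laws_on (paths T)"
  shows "integrable (\<gamma> s x) (stage m h c s x)"
proof -
  obtain b where b: "b \<ge> 0" "\<And>x. x \<in> paths T \<Longrightarrow> \<bar>h x\<bar> \<le> b" using paths_bounded by blast
  show ?thesis
  proof (rule relaxed_control_integrable[OF assms(1-3) measurable_stage[OF assms(2-4)]])
    fix a assume a: "a \<in> A"
    have "\<bar>c * F s x m a\<bar> \<le> \<bar>c\<bar> * C_0"
      using F_bounded[OF assms(2-4) a] by (simp add: abs_mult mult_left_mono)
    moreover have "\<bar>\<Sum>y\<in>UNIV. q s x m a y * h (extend T s x y)\<bar> \<le> b"
      by (intro q_sum_bounded[OF assms(2-4) a] b extend_in_paths)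
    ultimately show "\<bar>stage m h c s x a\<bar> \<le> b + \<bar>c\<bar> * C_0"
      unfolding stage_def by linarith
  qed
qed

text \<open>Dynamic programming at the last step: running costs of earlier times do not change when
  the path is extended, so they leave the inner expectation, and what remains is the mean of
  \<open>stage\<close>.\<close>

lemma cost_Suc:
  assumes "\<gamma> \<in> relaxed_controls" "m \<in> laws_on (paths T)" "x \<in> stopped_paths T t" "t + n < T"
  shows "cost \<gamma> m h c x (Suc n) = cost \<gamma> m (\<lambda>X. \<integral>a. stage m h c (t + n) X a \<partial>\<gamma> (t + n) X) c x n"
proof -
  let ?K = "relaxed_step \<gamma> m" and ?s = "t + n"
  have "cost \<gamma> m h c x (Suc n) = \<E> (chain ?K t x n) (\<lambda>X. \<E> (?K ?s X)
     (\<lambda>X. h X + c * (\<Sum>r = t..<t + Suc n. running \<gamma> m r X)))"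
    unfolding cost_def chain.simps
    using finite_relaxed_chain[OF assms(3), of n] assms(4) by (intro E_bind) (auto simp: relaxed_step_def)
  also have "\<dots> = cost \<gamma> m (\<lambda>X. \<integral>a. stage m h c ?s X a \<partial>\<gamma> ?s X) c x n"
    unfolding cost_def
  proof (rule E_cong)
    fix X assume "X \<in> set_pmf (chain ?K t x n)"
    then have X: "X \<in> stopped_paths T ?s"
      using set_relaxed_chain[OF assms(3), of n \<gamma> m] assms(4) by auto
    note XP = stopped_in_paths[OF X]
    interpret prob_space "\<gamma> ?s X" using relaxed_control_space[OF assms(1) _ XP] assms(4) by simp
    have "\<E> (?K ?s X) (\<lambda>X. h X + c * (\<Sum>r = t..<t + Suc n. running \<gamma> m r X))
        = \<E> (?K ?s X) (\<lambda>X'. h X' + c * (\<Sum>r = t..<t + Suc n. running \<gamma> m r X))"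
      using running_extend[OF assms(1) _ assms(4) X assms(2)]
      by (intro E_cong) (auto simp: relaxed_step_def)
    also have "\<dots> = \<E> (?K ?s X) h + c * running \<gamma> m ?s X + c * (\<Sum>r = t..<?s. running \<gamma> m r X)"
      by (subst E_add) (auto simp: relaxed_step_def algebra_simps)
    also have "\<E> (?K ?s X) h + c * running \<gamma> m ?s X = (\<integral>a. stage m h c ?s X a \<partial>\<gamma> ?s X)"
    proof -
      have s: "?s \<le> T" using assms(4) by simp
      have iF: "integrable (\<gamma> ?s X) (F ?s X m)"
        using measurable_F[OF s XP assms(2)] F_bounded[OF s XP assms(2)]
        by (intro relaxed_control_integrable[OF assms(1) s XP]) auto
      \<comment> \<open>Weight 0 removes the running cost from \<open>stage\<close>.\<close>
      have i1: "integrable (\<gamma> ?s X) (\<lambda>a. \<Sum>y\<in>UNIV. q ?s X m a y * h (extend T ?s X y))"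
        using integrable_stage[OF assms(1) s XP assms(2), of h 0] by (simp add: stage_def[abs_def])
      show ?thesis
        unfolding expectation_relaxed_step[OF assms(1) s XP assms(2)] running_def stage_def
        using iF i1 by simp
    qed
    finally show "\<E> (?K ?s X) (\<lambda>X. h X + c * (\<Sum>r = t..<t + Suc n. running \<gamma> m r X))
        = (\<integral>a. stage m h c ?s X a \<partial>\<gamma> ?s X) + c * (\<Sum>r = t..<?s. running \<gamma> m r X)" .
  qed
  finally show ?thesis .
qed

lemma cost_mono:
  assumes "x \<in> stopped_paths T t" "t + n \<le> T" "\<And>X. X \<in> stopped_paths T (t + n) \<Longrightarrow> h X \<le> h' X"
  shows "cost \<gamma> m h c x n \<le> cost \<gamma> m h' c x n"
  unfolding cost_def using assms finite_relaxed_chain set_relaxed_chain by (intro E_mono) force+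

lemma cost_cong:
  assumes "x \<in> stopped_paths T t" "t + n \<le> T" "\<And>X. X \<in> stopped_paths T (t + n) \<Longrightarrow> h X = h' X"
    and "\<And>r X. r \<in> {t..<t + n} \<Longrightarrow> X \<in> paths T \<Longrightarrow> \<gamma> r X = \<gamma>' r X"
  shows "cost \<gamma> m h c x n = cost \<gamma>' m h' c x n"
proof -
  have eq: "chain (relaxed_step \<gamma> m) t x n = chain (relaxed_step \<gamma>' m) t x n"
  proof (rule conjunct1[OF chain_cong[where Z = "stopped_paths T"]])
    fix s and z :: "'s path" assume s: "s \<in> {t..<t + n}" and z: "z \<in> stopped_paths T s"
    show "relaxed_step \<gamma> m s z = relaxed_step \<gamma>' m s z"
      using assms(4)[OF s stopped_in_paths[OF z]] by (simp add: relaxed_step_def)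
    show "set_pmf (relaxed_step \<gamma> m s z) \<subseteq> stopped_paths T (Suc s)"
      using s z assms(2) by (intro set_relaxed_step) auto
  qed (rule assms)
  show ?thesis
    unfolding cost_def eq
  proof (rule E_cong)
    fix X assume "X \<in> set_pmf (chain (relaxed_step \<gamma>' m) t x n)"
    then have X: "X \<in> stopped_paths T (t + n)" using set_relaxed_chain[OF assms(1,2)] by blast
    have "running \<gamma> m r X = running \<gamma>' m r X" if "r \<in> {t..<t + n}" for r
      unfolding running_def using assms(4)[OF that stopped_in_paths[OF X]] by simp
    then show "h X + c * (\<Sum>r = t..<t + n. running \<gamma> m r X) = h' X + c * (\<Sum>r = t..<t + n. running \<gamma>' m r X)"
      using assms(3)[OF X] by simp
  qed
qed

lemma cost_dirac_Suc:
  assumes "b \<in> pure_controls" "m \<in> laws_on (paths T)" "x \<in> stopped_paths T t" "t + n < T"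
  shows "cost (dirac b) m h c x (Suc n) = cost (dirac b) m (\<lambda>X. stage m h c (t + n) X (b (t + n) X)) c x n"
  unfolding cost_Suc[OF dirac_relaxed[OF assms(1)] assms(2-4)]
proof (intro cost_cong)
  fix X :: "'s path" assume "X \<in> stopped_paths T (t + n)"
  then have "X \<in> paths T" by (rule stopped_in_paths)
  then show "integral\<^sup>L (dirac b (t + n) X) (stage m h c (t + n) X) = stage m h c (t + n) X (b (t + n) X)"
    using assms measurable_stage by (intro integral_dirac) auto
qed (use assms in auto)

text \<open>Backward induction. At the last time each path gets an action whose \<open>stage\<close>
  value is at most the mean under \<gamma>; the value so obtained is the terminal cost of a problem
  one step shorter. Actions are chosen path by path, so one \<open>b\<close> works for all initial
  paths at once.\<close>

lemma pure_improvement: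
  assumes \<gamma>: "\<gamma> \<in> relaxed_controls" and m: "m \<in> laws_on (paths T)" and "t + n \<le> T"
  shows "\<exists>b\<in>pure_controls. \<forall>x\<in>stopped_paths T t. cost (dirac b) m h c x n \<le> cost \<gamma> m h c x n"
  using assms(3)
proof (induction n arbitrary: h)
  case 0
  obtain a where "a \<in> A" using A_nonempty by blast
  then have "(\<lambda>_ _. a) \<in> pure_controls" by (simp add: pure_controls_def)
  then show ?case by (intro bexI[of _ "\<lambda>_ _. a"]) (auto simp: cost_def)
next
  case (Suc n)
  let ?s = "t + n"
  have s: "?s < T" "?s \<le> T" using Suc.prems by auto
  have "\<forall>x\<in>paths T. \<exists>a\<in>A. stage m h c ?s x a \<le> (\<integral>a. stage m h c ?s x a \<partial>\<gamma> ?s x)"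
    using pure_action_below_mean[OF \<gamma> s(2) _ integrable_stage[OF \<gamma> s(2) _ m]] by blast
  then obtain a where a: "\<And>x. x \<in> paths T \<Longrightarrow> a x \<in> A \<and>
      stage m h c ?s x (a x) \<le> (\<integral>a. stage m h c ?s x a \<partial>\<gamma> ?s x)"
    by metis
  define h' where "h' x = stage m h c ?s x (a x)" for x
  obtain b0 where b0: "b0 \<in> pure_controls"
    "\<And>x. x \<in> stopped_paths T t \<Longrightarrow> cost (dirac b0) m h' c x n \<le> cost \<gamma> m h' c x n"
    using Suc by force
  \<comment> \<open>Stopping the argument makes the new action adapted; on paths already stopped at
    \<open>?s\<close> it changes nothing.\<close>
  define b where "b r x = (if r = ?s then a (stop T ?s x) else b0 r x)" for r x
  have b: "b \<in> pure_controls"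
    using b0(1) a[OF stop_in_paths] by (simp add: pure_controls_def b_def stop_stop)
  have "cost (dirac b) m h c x (Suc n) \<le> cost \<gamma> m h c x (Suc n)" if x: "x \<in> stopped_paths T t" for x
  proof -
    have "cost (dirac b) m h c x (Suc n) = cost (dirac b) m (\<lambda>X. stage m h c ?s X (b ?s X)) c x n"
      by (rule cost_dirac_Suc[OF b m x s(1)])
    also have "\<dots> = cost (dirac b0) m h' c x n"
      using x s by (intro cost_cong) (auto simp: b_def h'_def dirac_def stop_stopped)
    also have "\<dots> \<le> cost \<gamma> m h' c x n" by (rule b0(2)[OF x])
    also have "\<dots> \<le> cost \<gamma> m (\<lambda>X. \<integral>a. stage m h c ?s X a \<partial>\<gamma> ?s X) c x n"
      using x s a stopped_in_paths by (intro cost_mono) (auto simp: h'_def)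
    also have "\<dots> = cost \<gamma> m h c x (Suc n)"
      by (rule cost_Suc[OF \<gamma> m x s(1), symmetric])
    finally show ?thesis .
  qed
  then show ?case using b by blast
qed

definition J_frozen :: "(nat \<Rightarrow> 's path \<Rightarrow> (real ^ 'k) measure) \<Rightarrow> 's path pmf \<Rightarrow> 's path \<Rightarrow> real" where
  "J_frozen \<gamma> m x = cost \<gamma> m (\<lambda>X. G X m) 1 x (T - t)"

definition v_frozen :: "'s path pmf \<Rightarrow> 's path \<Rightarrow> real" where
  "v_frozen m x = (INF \<gamma>\<in>relaxed_controls. J_frozen \<gamma> m x)"

text \<open>A deviation in the mean field game leaves the law of the population unchanged. An
  equilibrium is thus a control that is optimal in the environment it generates.\<close>

lemma J_relax_frozen: "J_relax t \<mu> \<gamma> x \<gamma>' = J_frozen \<gamma>' (mf_law t \<mu> \<gamma>) x"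
  using t by (simp add: J_relax_def J_frozen_def cost_def player_law_def running_def)

lemma v_relax_frozen: "v_relax t \<mu> \<gamma> x = v_frozen (mf_law t \<mu> \<gamma>) x"
  by (simp add: v_relax_def v_frozen_def J_relax_frozen)

lemma J_frozen_bounded:
  assumes "\<gamma> \<in> relaxed_controls" "m \<in> laws_on (paths T)" "x \<in> stopped_paths T t"
  shows "\<bar>J_frozen \<gamma> m x\<bar> \<le> C_0 + real (T - t) * C_0"
  unfolding J_frozen_def cost_def
proof (rule E_bounded)
  show "finite (set_pmf (chain (relaxed_step \<gamma> m) t x (T - t)))"
    using finite_relaxed_chain[OF assms(3)] t by simp
  fix X assume "X \<in> set_pmf (chain (relaxed_step \<gamma> m) t x (T - t))"
  then have X: "X \<in> paths T" using set_relaxed_chain[OF assms(3), of "T - t" \<gamma> m] t stopped_in_paths by auto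
  have "\<bar>\<Sum>r = t..<T. running \<gamma> m r X\<bar> \<le> real (card {t..<T}) * C_0"
    using running_bounded[OF assms(1) _ X assms(2)]
    by (intro order.trans[OF sum_abs] sum_bounded_above) auto
  then show "\<bar>G X m + 1 * (\<Sum>r = t..<t + (T - t). running \<gamma> m r X)\<bar> \<le> C_0 + real (T - t) * C_0"
    using G_bounded[OF X assms(2)] t by simp
qed

lemma v_frozen_le:
  assumes "\<gamma> \<in> relaxed_controls" "m \<in> laws_on (paths T)" "x \<in> stopped_paths T t"
  shows "v_frozen m x \<le> J_frozen \<gamma> m x"
  unfolding v_frozen_def
  using assms J_frozen_bounded[OF _ assms(2,3)]
  by (intro cINF_lower bdd_belowI2[where m = "- (C_0 + real (T - t) * C_0)"])
    (auto simp: abs_le_iff minus_le_iff)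

lemma pure_controls_nonempty: "pure_controls \<noteq> {}"
proof -
  obtain a where "a \<in> A" using A_nonempty by blast
  then have "(\<lambda>_ _. a) \<in> pure_controls" by (simp add: pure_controls_def)
  then show ?thesis by blast
qed

text \<open>A near-optimal relaxed control is improved to a pure one. This is what later lets
  players with Lipschitz controls, even with constant 0, reach the relaxed value.\<close>

lemma v_frozen_pure:
  assumes "m \<in> laws_on (paths T)" "x \<in> stopped_paths T t" "\<delta> > 0"
  obtains b where "b \<in> pure_controls" "J_frozen (dirac b) m x < v_frozen m x + \<delta>"
proof -
  have "relaxed_controls \<noteq> {}" using pure_controls_nonempty dirac_relaxed by auto
  then obtain \<gamma> where \<gamma>: "\<gamma> \<in> relaxed_controls" "J_frozen \<gamma> m x < v_frozen m x + \<delta>"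
    using cInf_lessD[of "(\<lambda>\<gamma>. J_frozen \<gamma> m x) ` relaxed_controls" "v_frozen m x + \<delta>"] assms(3)
    unfolding v_frozen_def by auto
  obtain b where "b \<in> pure_controls" "J_frozen (dirac b) m x \<le> J_frozen \<gamma> m x"
    using pure_improvement[OF \<gamma>(1) assms(1), of "T - t"] t assms(2) unfolding J_frozen_def by force
  then show ?thesis using that \<gamma>(2) by force
qed

end

subsection \<open>Propagation of chaos\<close>

lemma stop_last: "x \<in> paths T \<Longrightarrow> stop T T x = x"
  by (auto simp: stop_def paths_def fun_eq_iff restrict_def min_def)

lemma pmf_empirical:
  assumes "N \<ge> 1"
  shows "pmf (empirical N X) p = (\<Sum>j = 1..N. indicator {p} (X j)) / real N"
proof -
  have "pmf (empirical N X) p = \<E> (empirical N X) (indicator {p})"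
    by (rule E_indicator[symmetric])
  also have "\<dots> = \<E> (pmf_of_set {1..N}) (\<lambda>j. indicator {p} (X j))"
    unfolding empirical_def by (rule integral_map_pmf)
  finally have "pmf (empirical N X) p = \<E> (pmf_of_set {1..N}) (\<lambda>j. indicator {p} (X j))" .
  then show ?thesis using assms by (simp add: E_pmf_of_set)
qed

lemma pmf_mixture:
  assumes "N \<ge> 1"
  shows "pmf (bind_pmf (pmf_of_set {1..N}) K) p = (\<Sum>j = 1..N. pmf (K j) p) / real N"
  using assms by (simp add: pmf_bind E_pmf_of_set)

context continuous_mean_field_game
begin

lemma stop_relaxed_chain:
  assumes "x \<in> stopped_paths T t" "n \<le> k" "t + k \<le> T"
  shows "map_pmf (stop T (t + n)) (chain (relaxed_step \<gamma> m) t x k) = chain (relaxed_step \<gamma> m) t x n"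
proof -
  define \<kappa> where "\<kappa> s x = embed_pmf (\<lambda>y. \<integral>a. q s x m a y \<partial>\<gamma> s x)" for s x
  have 1: "set_pmf (chain (relaxed_step \<gamma> m) t x 0) \<subseteq> stopped_paths T t"
    using assms(1) by simp
  have 2: "chain (relaxed_step \<gamma> m) t x (Suc n) =
      bind_pmf (chain (relaxed_step \<gamma> m) t x n) (\<lambda>z. map_pmf (extend T (t + n) z) (\<kappa> (t + n) z))" for n
    by (simp add: \<kappa>_def relaxed_step_def[abs_def])
  interpret D: extension_chain t T "stopped_paths T" "chain (relaxed_step \<gamma> m) t x" \<kappa> "stop T"
    "extend T" "\<lambda>s X. X s"
    by unfold_locales (rule 1 2 extend_facts stop_stopped stop_stop stop_apply; assumption)+
  show ?thesis using D.law_stopped assms(2,3) by simp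
qed

text \<open>Outside \<open>{t..<T}\<close> the control \<open>\<beta>\<close> is unconstrained and
  may leave \<open>A\<close>. An arbitrary action of \<open>A\<close> is put there, so that the
  result belongs to \<open>pure_controls\<close>.\<close>

definition frozen :: "(nat \<Rightarrow> 's path \<Rightarrow> 's path pmf \<Rightarrow> real ^ 'k) \<Rightarrow> 's path pmf
    \<Rightarrow> nat \<Rightarrow> 's path \<Rightarrow> real ^ 'k" where
  "frozen \<beta> m s x = (if s \<in> {t..<T} then \<beta> s x m else (SOME a. a \<in> A))"

lemma path_controls_in_A:
  "\<beta> \<in> path_controls t L \<Longrightarrow> s \<in> {t..<T} \<Longrightarrow> x \<in> paths T \<Longrightarrow> m \<in> laws_on (paths T) \<Longrightarrow> \<beta> s x m \<in> A"
  unfolding path_controls_def by blast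

lemma path_controls_stop:
  assumes "\<beta> \<in> path_controls t L" "s \<in> {t..<T}" "x \<in> paths T" "m \<in> laws_on (paths T)"
  shows "\<beta> s x (map_pmf (stop T s) m) = \<beta> s x m" "\<beta> s (stop T s x) m = \<beta> s x m"
proof -
  have *: "\<beta> s x m = \<beta> s (stop T s x) (map_pmf (stop T s) m)"
    if "x \<in> paths T" "m \<in> laws_on (paths T)" for x m
    using assms(1,2) that unfolding path_controls_def by blast
  show "\<beta> s x (map_pmf (stop T s) m) = \<beta> s x m" "\<beta> s (stop T s x) m = \<beta> s x m"
    using *[OF assms(3,4)] *[OF assms(3) map_stop_in_laws[OF assms(4)]] *[OF stop_in_paths[OF assms(3)] assms(4)]
    by (simp_all add: map_pmf_comp stop_stop)
qed

lemma path_controls_Lipschitz: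
  assumes "\<beta> \<in> path_controls t L" "s \<in> {t..<T}" "x \<in> paths T" "m \<in> laws_on (paths T)" "\<nu> \<in> laws_on (paths T)"
  shows "norm (\<beta> s x m - \<beta> s x \<nu>) \<le> L * W1 (paths T) m \<nu>"
  using assms unfolding path_controls_def by blast

lemma frozen_pure:
  assumes "\<beta> \<in> path_controls t L" "m \<in> laws_on (paths T)"
  shows "frozen \<beta> m \<in> pure_controls"
  using path_controls_in_A[OF assms(1) _ _ assms(2)] path_controls_stop(2)[OF assms(1) _ _ assms(2)]
    A_nonempty
  by (auto simp: pure_controls_def frozen_def some_in_eq)

lemma stage_bounded:
  assumes "s \<le> T" "x \<in> paths T" "m \<in> laws_on (paths T)" "a \<in> A" "\<And>y. y \<in> paths T \<Longrightarrow> \<bar>h y\<bar> \<le> b"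
  shows "\<bar>stage m h 0 s x a\<bar> \<le> b"
  using q_sum_bounded[OF assms(1-4) assms(5)[OF extend_in_paths]] by (simp add: stage_def)

text \<open>If the law moves by w, the action moves by at most L w and each transition probability
  by at most \<open>L_q\<close> (1 + L) w; the first factor counts the next states.\<close>

definition response_constant :: "real \<Rightarrow> real" where
  "response_constant L = real CARD('s) * L_q * (1 + L)"

lemma response_constant_nonneg: "0 \<le> L \<Longrightarrow> 0 \<le> response_constant L"
  using L_q by (simp add: response_constant_def)

text \<open>By adaptedness \<open>m\<close> may be replaced by its stopped version. That is the
  right object to compare with: an empirical measure at time \<open>s\<close> charges paths stopped
  at \<open>s\<close> and is in general far from \<open>m\<close> itself.\<close>

lemma response_Lipschitz:
  assumes \<beta>: "\<beta> \<in> path_controls t L" and L: "0 \<le> L" and s: "s \<in> {t..<T}" and x: "x \<in> paths T"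
    and m: "m \<in> laws_on (paths T)" and \<nu>: "\<nu> \<in> laws_on (paths T)"
    and h: "\<And>y. y \<in> paths T \<Longrightarrow> \<bar>h y\<bar> \<le> 1"
  shows "\<bar>stage \<nu> h 0 s x (\<beta> s x \<nu>) - stage m h 0 s x (\<beta> s x m)\<bar>
    \<le> response_constant L * W1 (paths T) \<nu> (map_pmf (stop T s) m)"
proof -
  define m' where "m' = map_pmf (stop T s) m"
  have m': "m' \<in> laws_on (paths T)" using m by (simp add: m'_def map_stop_in_laws)
  have s': "s \<le> T" using s by simp
  let ?W = "W1 (paths T) \<nu> m'"
  have a: "\<beta> s x \<nu> \<in> A" "\<beta> s x m' \<in> A"
    using path_controls_in_A[OF \<beta> s x] \<nu> m' by auto
  have eq: "stage m h 0 s x (\<beta> s x m) = stage m' h 0 s x (\<beta> s x m')"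
    using path_controls_stop(1)[OF \<beta> s x m] q_stop(1)[OF s' x m] a(2)
    by (simp add: m'_def stage_def)
  have "\<bar>stage \<nu> h 0 s x (\<beta> s x \<nu>) - stage m' h 0 s x (\<beta> s x m')\<bar>
      = \<bar>\<Sum>y\<in>UNIV. (q s x \<nu> (\<beta> s x \<nu>) y - q s x m' (\<beta> s x m') y) * h (extend T s x y)\<bar>"
    by (simp add: stage_def sum_subtractf left_diff_distrib)
  also have "\<dots> \<le> (\<Sum>y\<in>(UNIV :: 's set). L_q * ((1 + L) * ?W))"
  proof (intro order.trans[OF sum_abs] sum_mono)
    fix y :: 's
    have "\<bar>q s x \<nu> (\<beta> s x \<nu>) y - q s x m' (\<beta> s x m') y\<bar> \<le> L_q * (?W + norm (\<beta> s x \<nu> - \<beta> s x m'))"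
      by (rule q_Lipschitz[OF s' x \<nu> m' a])
    also have "\<dots> \<le> L_q * ((1 + L) * ?W)"
      using path_controls_Lipschitz[OF \<beta> s x \<nu> m'] L_q by (intro mult_left_mono) (auto simp: algebra_simps)
    finally have "\<bar>q s x \<nu> (\<beta> s x \<nu>) y - q s x m' (\<beta> s x m') y\<bar> * \<bar>h (extend T s x y)\<bar>
        \<le> L_q * ((1 + L) * ?W) * 1"
      using h[OF extend_in_paths[of T s x y]] by (intro mult_mono) auto
    then show "\<bar>(q s x \<nu> (\<beta> s x \<nu>) y - q s x m' (\<beta> s x m') y) * h (extend T s x y)\<bar> \<le> L_q * ((1 + L) * ?W)"
      by (simp add: abs_mult)
  qed
  also have "\<dots> = response_constant L * ?W" by (simp add: response_constant_def)
  finally show ?thesis by (simp add: eq m'_def)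
qed

lemma empirical_in_laws:
  assumes "N \<ge> 1" "X \<in> {1..N} \<rightarrow> paths T"
  shows "empirical N X \<in> laws_on (paths T)"
  using assms by (auto simp: empirical_def laws_on_def)

context
  fixes N :: nat and L :: real and xs :: "nat \<Rightarrow> 's path"
    and \<alpha> :: "nat \<Rightarrow> nat \<Rightarrow> 's path \<Rightarrow> 's path pmf \<Rightarrow> real ^ 'k"
  assumes N: "N \<ge> 1" and L: "0 \<le> L" and xs: "xs \<in> {1..N} \<rightarrow>\<^sub>E stopped_paths T t"
    and \<alpha>: "\<alpha> \<in> {1..N} \<rightarrow> path_controls t L"
begin

lemma pmf_move:
  assumes "s \<in> {t..<T}" "X \<in> {1..N} \<rightarrow> stopped_paths T s" "j \<in> {1..N}"
  shows "pmf (embed_pmf (q s (X j) (empirical N X) (\<alpha> j s (X j) (empirical N X)))) y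
    = q s (X j) (empirical N X) (\<alpha> j s (X j) (empirical N X)) y"
proof -
  have X: "X j \<in> paths T" "X \<in> {1..N} \<rightarrow> paths T"
    using assms stopped_in_paths by blast+
  note e = empirical_in_laws[OF N X(2)]
  have "\<alpha> j \<in> path_controls t L" using \<alpha> assms(3) by blast
  note a = path_controls_in_A[OF this assms(1) X(1) e]
  have s: "s \<le> T" using assms(1) by simp
  show ?thesis
    using q_range[OF s X(1) e a] q_sum[OF s X(1) e a]
    by (intro pmf_embed_pmf) (auto simp: nn_integral_count_space_finite sum_ennreal less_imp_le)
qed

lemma expectation_move:
  assumes "s \<in> {t..<T}" "X \<in> {1..N} \<rightarrow> stopped_paths T s" "j \<in> {1..N}"
  shows "\<E> (embed_pmf (q s (X j) (empirical N X) (\<alpha> j s (X j) (empirical N X)))) (\<lambda>y. h (extend T s (X j) y))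
    = stage (empirical N X) h 0 s (X j) (\<alpha> j s (X j) (empirical N X))"
  by (subst E_finite_set[of UNIV]) (auto simp: stage_def pmf_move[OF assms])

lemma expectation_game_step:
  assumes "s \<in> {t..<T}" "X \<in> {1..N} \<rightarrow> stopped_paths T s" "j \<in> {1..N}"
  shows "\<E> (game_step N \<alpha> s X) (\<lambda>X'. h (X' j))
    = stage (empirical N X) h 0 s (X j) (\<alpha> j s (X j) (empirical N X))"
proof -
  let ?p = "\<lambda>j. embed_pmf (q s (X j) (empirical N X) (\<alpha> j s (X j) (empirical N X)))"
  have "\<E> (game_step N \<alpha> s X) (\<lambda>X'. h (X' j)) = \<E> (map_pmf (\<lambda>ys. ys j) (Pi_pmf {1..N} undefined ?p)) (\<lambda>y. h (extend T s (X j) y))"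
    using assms(3) by (simp add: game_step_def)
  also have "map_pmf (\<lambda>ys. ys j) (Pi_pmf {1..N} undefined ?p) = ?p j"
    using assms(3) by (subst Pi_pmf_component) auto
  finally show ?thesis unfolding expectation_move[OF assms] .
qed

text \<open>Given the current state the players move independently. The summands are centred and
  bounded by 2, so they average out.\<close>

lemma game_step_noise:
  assumes "s \<in> {t..<T}" "X \<in> {1..N} \<rightarrow> stopped_paths T s"
    and h: "\<And>j y. j \<in> {1..N} \<Longrightarrow> y \<in> paths T \<Longrightarrow> \<bar>h j y\<bar> \<le> 1"
  shows "\<E> (game_step N \<alpha> s X) (\<lambda>X'. \<bar>1 / real N * (\<Sum>j = 1..N. h j (X' j)
      - stage (empirical N X) (h j) 0 s (X j) (\<alpha> j s (X j) (empirical N X)))\<bar>) \<le> 2 / sqrt (real N)"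
proof -
  define p where "p = (\<lambda>j. embed_pmf (q s (X j) (empirical N X) (\<alpha> j s (X j) (empirical N X))))"
  define S where "S j = stage (empirical N X) (h j) 0 s (X j) (\<alpha> j s (X j) (empirical N X))" for j
  define f where "f j y = h j (extend T s (X j) y) - S j" for j y
  have Xp: "X \<in> {1..N} \<rightarrow> paths T" using assms(2) stopped_in_paths by blast
  note e = empirical_in_laws[OF N Xp]
  have S: "\<bar>S j\<bar> \<le> 1" if j: "j \<in> {1..N}" for j
  proof -
    have "X j \<in> paths T" "\<alpha> j \<in> path_controls t L" using Xp \<alpha> j by auto
    then show ?thesis
      unfolding S_def using assms(1) h j e path_controls_in_A by (intro stage_bounded) auto
  qed
  have "\<E> (game_step N \<alpha> s X) (\<lambda>X'. \<bar>1 / real N * (\<Sum>j = 1..N. h j (X' j) - S j)\<bar>)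
      = \<E> (Pi_pmf {1..N} undefined p) (\<lambda>ys. \<bar>1 / real (card {1..N}) * (\<Sum>j = 1..N. f j (ys j))\<bar>)"
    by (simp add: game_step_def p_def f_def)
  also have "\<dots> \<le> 2 / sqrt (real (card {1..N}))"
  proof (rule Pi_pmf_mean_abs)
    fix j assume j: "j \<in> {1..N}"
    show "\<E> (p j) (f j) = 0"
      unfolding f_def using expectation_move[OF assms(1,2) j, of "h j"]
      by (subst E_diff) (auto simp: p_def S_def)
    show "\<bar>f j y\<bar> \<le> 2" for y
      using h[OF j extend_in_paths[of T s "X j" y]] S[OF j] unfolding f_def by linarith
  qed (use N in auto)
  finally show ?thesis by (simp add: S_def)
qed

lemma set_game_chain:
  assumes "t + n \<le> T"
  shows "set_pmf (chain (game_step N \<alpha>) t xs n) \<subseteq> {1..N} \<rightarrow>\<^sub>E stopped_paths T (t + n)"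
proof (rule conjunct2[OF chain_cong[where Z = "\<lambda>s. {1..N} \<rightarrow>\<^sub>E stopped_paths T s"]])
  fix s and X :: "nat \<Rightarrow> 's path"
  assume "s \<in> {t..<t + n}" "X \<in> {1..N} \<rightarrow>\<^sub>E stopped_paths T s"
  then show "set_pmf (game_step N \<alpha> s X) \<subseteq> {1..N} \<rightarrow>\<^sub>E stopped_paths T (Suc s)"
    using assms by (auto simp: game_step_def PiE_iff intro!: extend_facts(1))
qed (use xs in auto)

lemma finite_game_chain:
  assumes "t + n \<le> T"
  shows "finite (set_pmf (chain (game_step N \<alpha>) t xs n))"
  by (rule finite_subset[OF set_game_chain[OF assms]]) (auto intro!: finite_PiE finite_stopped_paths)

lemma finite_game_step: "finite (set_pmf (game_step N \<alpha> s X))"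
  by (auto simp: game_step_def set_Pi_pmf intro!: finite_imageI finite_PiE_dflt)

end

section \<open>Accumulation of the errors over time\<close>

text \<open>Read off from the induction step of \<open>fluctuation_bound\<close>. A step adds one
  unit of new error, keeps the old fluctuation, and adds \<open>response_constant\<close> times the
  distance of the empirical measure from \<open>m\<close>. That distance has the factor
  \<open>law_constant\<close>: one fluctuation for the indicator of each path, and 1 for the
  inaccuracy of \<open>m\<close>.\<close>

primrec chaos_constant :: "real \<Rightarrow> nat \<Rightarrow> real" where
  "chaos_constant L 0 = 0"
| "chaos_constant L (Suc n) = 1 + response_constant L
    + (1 + response_constant L * card (paths T :: 's path set)) * chaos_constant L n"

lemma chaos_constant_nonneg: "0 \<le> L \<Longrightarrow> 0 \<le> chaos_constant L n"
  by (induction n) (auto simp: response_constant_nonneg)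

definition law_constant :: "real \<Rightarrow> nat \<Rightarrow> real" where
  "law_constant L n = card (paths T :: 's path set) * chaos_constant L n + 1"

text \<open>All players but one use \<open>\<alpha>\<close>, and \<open>m\<close> is nearly the average law of their frozen chains.
  The test functions may depend on the player: the heterogeneous drifts are not functions of the
  empirical measure, so it cannot be controlled on its own.\<close>

context
  fixes N :: nat and L :: real and xs :: "nat \<Rightarrow> 's path"
    and \<alpha> :: "nat \<Rightarrow> nat \<Rightarrow> 's path \<Rightarrow> 's path pmf \<Rightarrow> real ^ 'k"
    and i :: nat and \<beta> :: "nat \<Rightarrow> 's path \<Rightarrow> 's path pmf \<Rightarrow> real ^ 'k"
    and m :: "'s path pmf" and \<eta> :: real
  assumes N: "N \<ge> 1" and L: "0 \<le> L" and xs: "xs \<in> {1..N} \<rightarrow>\<^sub>E stopped_paths T t"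
    and \<alpha>: "\<alpha> \<in> {1..N} \<rightarrow> path_controls t L"
    and i: "i \<in> {1..N}" and \<beta>: "\<beta> \<in> path_controls t L" and m: "m \<in> laws_on (paths T)"
    and near: "W1 (paths T) (bind_pmf (pmf_of_set {1..N})
      (\<lambda>j. chain (relaxed_step (dirac (frozen (\<alpha> j) m)) m) t (xs j) (T - t))) m \<le> \<eta>"
begin

abbreviation "indiv j n \<equiv> chain (relaxed_step (dirac (frozen (\<alpha> j) m)) m) t (xs j) n"
abbreviation "game_chain n \<equiv> chain (game_step N (\<alpha>(i := \<beta>))) t xs n"
abbreviation "fluct n h X \<equiv> 1 / real N * (\<Sum>j = 1..N. h j (X j) - \<E> (indiv j n) (h j))"
text \<open>Three sources of error: the sampling noise of one step, the deviating player, who has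
  weight 1/N, and the mismatch between \<open>m\<close> and the average law.\<close>

abbreviation "err \<equiv> 2 / sqrt (real N) + 2 / real N + \<eta>"

lemma deviation_controls: "\<alpha>(i := \<beta>) \<in> {1..N} \<rightarrow> path_controls t L"
  using \<alpha> \<beta> by auto

lemma eta_nonneg: "0 \<le> \<eta>"
  using near W1_nonneg order_trans by blast

lemma start_stopped: "j \<in> {1..N} \<Longrightarrow> xs j \<in> stopped_paths T t"
  using xs by auto

lemma indiv_pure: "j \<in> {1..N} \<Longrightarrow> frozen (\<alpha> j) m \<in> pure_controls"
  using \<alpha> m by (intro frozen_pure) auto

lemma empirical_deviation:
  assumes n: "t + n \<le> T"
  shows "W1 (paths T) (empirical N X) (map_pmf (stop T (t + n)) m)
    \<le> (\<Sum>p\<in>paths T. \<bar>fluct n (\<lambda>_. indicator {p}) X\<bar>) + \<eta>"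
proof -
  let ?avg = "\<lambda>n. bind_pmf (pmf_of_set {1..N}) (\<lambda>j. indiv j n)"
  have "map_pmf (stop T (t + n)) (?avg (T - t)) = ?avg n"
    unfolding map_bind_pmf using n t N start_stopped
    by (intro bind_pmf_cong stop_relaxed_chain) auto
  moreover have "set_pmf (?avg (T - t)) \<subseteq> paths T"
    using set_relaxed_chain[OF start_stopped, of _ "T - t"] t stopped_in_paths N by fastforce
  moreover have "stop T (t + n) ` paths T \<subseteq> (paths T :: 's path set)"
    using stop_in_paths by blast
  ultimately have "W1 (paths T) (?avg n) (map_pmf (stop T (t + n)) m) \<le> \<eta>"
    using W1_map_le[OF finite_paths, of "?avg (T - t)" T m "stop T (t + n)"] near m
    by (simp add: laws_on_def)
  moreover have "W1 (paths T) (empirical N X) (?avg n) = (\<Sum>p\<in>paths T. \<bar>fluct n (\<lambda>_. indicator {p}) X\<bar>)"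
    unfolding W1_def pmf_empirical[OF N] pmf_mixture[OF N] E_indicator
    by (simp add: sum_subtractf diff_divide_distrib)
  ultimately show ?thesis
    using W1_triangle[of "paths T" "empirical N X" "map_pmf (stop T (t + n)) m" "?avg n"] by linarith
qed

text \<open>The fluctuation splits into the noise around the conditional mean \<open>S\<close> in
  the true environment, the drift error \<open>S - M\<close> with \<open>M\<close> the conditional
  mean in the environment \<open>m\<close>, and the fluctuation of \<open>M\<close> one step
  earlier. The functions \<open>M\<close> differ between players even if \<open>h\<close> does
  not.\<close>

lemma one_step_fluctuation:
  assumes s: "t + n < T" and X: "X \<in> {1..N} \<rightarrow>\<^sub>E stopped_paths T (t + n)"
    and h: "\<And>j y. j \<in> {1..N} \<Longrightarrow> y \<in> paths T \<Longrightarrow> \<bar>h j y\<bar> \<le> 1"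
  shows "\<E> (game_step N (\<alpha>(i := \<beta>)) (t + n) X) (\<lambda>X'. \<bar>fluct (Suc n) h X'\<bar>)
    \<le> 2 / sqrt N + (2 / N + response_constant L * W1 (paths T) (empirical N X) (map_pmf (stop T (t + n)) m))
      + \<bar>fluct n (\<lambda>j x. stage m (h j) 0 (t + n) x (frozen (\<alpha> j) m (t + n) x)) X\<bar>"
proof -
  let ?s = "t + n" and ?\<alpha> = "\<alpha>(i := \<beta>)"
  define \<nu> where "\<nu> = empirical N X"
  define W where "W = W1 (paths T) \<nu> (map_pmf (stop T ?s) m)"
  define S where "S j = stage \<nu> (h j) 0 ?s (X j) (?\<alpha> j ?s (X j) \<nu>)" for j
  define M where "M = (\<lambda>j x. stage m (h j) 0 ?s x (frozen (\<alpha> j) m ?s x))"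
  have s': "?s \<in> {t..<T}" "?s \<le> T" using s by auto
  have Xj: "X j \<in> paths T" if "j \<in> {1..N}" for j using X that stopped_in_paths by blast
  have X1: "X \<in> {1..N} \<rightarrow> stopped_paths T ?s" using X by auto
  have \<nu>: "\<nu> \<in> laws_on (paths T)" unfolding \<nu>_def using Xj by (intro empirical_in_laws[OF N]) auto
  have rc: "0 \<le> response_constant L * W"
    using response_constant_nonneg[OF L] by (simp add: W_def W1_nonneg)
  have indiv_Suc: "\<E> (indiv j (Suc n)) (h j) = \<E> (indiv j n) (M j)" if j: "j \<in> {1..N}" for j
    using cost_dirac_Suc[OF indiv_pure[OF j] m start_stopped[OF j] s, of "h j" 0] by (simp add: cost_def M_def)
  \<comment> \<open>The deviator is charged the trivial bound 2, which counts only with weight 1/N.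
    For all others the same control is used on both sides and only the law changes.\<close>
  have drift: "\<bar>S j - M j (X j)\<bar> \<le> (if j = i then 2 else 0) + response_constant L * W" if j: "j \<in> {1..N}" for j
  proof (cases "j = i")
    case True
    have "\<bar>S j\<bar> \<le> 1" unfolding S_def
      using h[OF j] deviation_controls j
      by (intro stage_bounded[OF s'(2) Xj[OF j] \<nu>] path_controls_in_A[OF _ s'(1) Xj[OF j] \<nu>, of "?\<alpha> j" L])
        blast+
    moreover have "\<bar>M j (X j)\<bar> \<le> 1" unfolding M_def
      using pure_controls_in_A[OF indiv_pure[OF j] s'(2) Xj[OF j]] h[OF j]
      by (intro stage_bounded[OF s'(2) Xj[OF j] m]) auto
    ultimately show ?thesis using True rc by auto
  next
    case False
    then have "M j (X j) = stage m (h j) 0 ?s (X j) (\<alpha> j ?s (X j) m)" "?\<alpha> j = \<alpha> j"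
      using s'(1) by (auto simp: M_def frozen_def)
    moreover have "\<alpha> j \<in> path_controls t L" using \<alpha> j by blast
    ultimately show ?thesis
      using response_Lipschitz[OF _ L s'(1) Xj[OF j] m \<nu>, of "\<alpha> j" "h j", OF _ h[OF j]] False
      by (simp add: S_def W_def)
  qed
  have mean_drift: "\<bar>1 / N * (\<Sum>j = 1..N. S j - M j (X j))\<bar> \<le> 2 / N + response_constant L * W"
  proof -
    have "\<bar>\<Sum>j = 1..N. S j - M j (X j)\<bar> \<le> (\<Sum>j = 1..N. (if j = i then 2 else 0) + response_constant L * W)"
      by (intro order.trans[OF sum_abs] sum_mono drift)
    also have "\<dots> = 2 + N * (response_constant L * W)" using i by (simp add: sum.distrib)
    finally show ?thesis using N by (simp add: field_simps abs_mult)
  qed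
  have "\<E> (game_step N ?\<alpha> ?s X) (\<lambda>X'. \<bar>fluct (Suc n) h X'\<bar>)
      \<le> \<E> (game_step N ?\<alpha> ?s X) (\<lambda>X'. \<bar>1 / N * (\<Sum>j = 1..N. h j (X' j) - S j)\<bar>
        + (2 / N + response_constant L * W + \<bar>fluct n M X\<bar>))"
  proof (rule E_mono[OF finite_game_step[OF N L xs deviation_controls]])
    fix X'
    have "fluct (Suc n) h X' = 1 / N * (\<Sum>j = 1..N. h j (X' j) - S j)
      + 1 / N * (\<Sum>j = 1..N. S j - M j (X j)) + fluct n M X"
      unfolding distrib_left[symmetric] sum.distrib[symmetric]
      by (intro arg_cong2[where f = "(*)"] sum.cong refl) (simp add: indiv_Suc del: chain.simps)
    then show "\<bar>fluct (Suc n) h X'\<bar> \<le> \<bar>1 / N * (\<Sum>j = 1..N. h j (X' j) - S j)\<bar>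
        + (2 / N + response_constant L * W + \<bar>fluct n M X\<bar>)"
      using mean_drift by linarith
  qed
  also have "\<dots> = \<E> (game_step N ?\<alpha> ?s X) (\<lambda>X'. \<bar>1 / N * (\<Sum>j = 1..N. h j (X' j) - S j)\<bar>)
      + (2 / N + response_constant L * W + \<bar>fluct n M X\<bar>)"
    by (subst E_add) (auto simp: finite_game_step[OF N L xs deviation_controls])
  also have "\<dots> \<le> 2 / sqrt N + (2 / N + response_constant L * W + \<bar>fluct n M X\<bar>)"
    using game_step_noise[OF N L xs deviation_controls s'(1) X1 h] unfolding S_def \<nu>_def by simp
  finally show ?thesis unfolding W_def \<nu>_def M_def by simp
qed

text \<open>The fluctuation bound is an assumption here because this estimate is used inside the
  induction that proves it.\<close>

lemma empirical_deviation_mean: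
  assumes n: "t + n \<le> T"
    and "\<And>h. (\<And>j y. j \<in> {1..N} \<Longrightarrow> y \<in> paths T \<Longrightarrow> \<bar>h j y\<bar> \<le> 1) \<Longrightarrow>
      \<E> (game_chain n) (\<lambda>X. \<bar>fluct n h X\<bar>) \<le> chaos_constant L n * err"
  shows "\<E> (game_chain n) (\<lambda>X. W1 (paths T) (empirical N X) (map_pmf (stop T (t + n)) m)) \<le> law_constant L n * err"
proof -
  note fin = finite_game_chain[OF N L xs deviation_controls n]
  have "\<E> (game_chain n) (\<lambda>X. W1 (paths T) (empirical N X) (map_pmf (stop T (t + n)) m))
      \<le> \<E> (game_chain n) (\<lambda>X. (\<Sum>p\<in>paths T. \<bar>fluct n (\<lambda>_. indicator {p}) X\<bar>) + \<eta>)"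
    by (intro E_mono[OF fin] empirical_deviation[OF n])
  also have "\<dots> = (\<Sum>p\<in>paths T. \<E> (game_chain n) (\<lambda>X. \<bar>fluct n (\<lambda>_. indicator {p}) X\<bar>)) + \<eta>"
    by (simp only: E_add[OF fin] E_sum[OF fin]) simp
  also have "\<dots> \<le> (\<Sum>p\<in>(paths T :: 's path set). chaos_constant L n * err) + err"
    by (intro add_mono sum_mono assms(2)) (auto split: split_indicator)
  also have "\<dots> = law_constant L n * err"
    unfolding law_constant_def by (simp add: algebra_simps)
  finally show ?thesis .
qed

text \<open>A discrete Gronwall argument. One step back, new test functions and the distance of the
  empirical measure from \<open>m\<close> appear; the latter is controlled by fluctuations of
  indicators. So the induction has to run over all families \<open>h\<close> bounded by 1. At n = 0
  the state is deterministic and nothing fluctuates.\<close>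

lemma fluctuation_bound:
  assumes "t + n \<le> T" and "\<And>j y. j \<in> {1..N} \<Longrightarrow> y \<in> paths T \<Longrightarrow> \<bar>h j y\<bar> \<le> 1"
  shows "\<E> (game_chain n) (\<lambda>X. \<bar>fluct n h X\<bar>) \<le> chaos_constant L n * err"
  using assms
proof (induction n arbitrary: h)
  case 0
  then show ?case by simp
next
  case (Suc n)
  let ?M = "\<lambda>j x. stage m (h j) 0 (t + n) x (frozen (\<alpha> j) m (t + n) x)"
    and ?W = "\<lambda>X. W1 (paths T) (empirical N X) (map_pmf (stop T (t + n)) m)"
  have s: "t + n < T" "t + n \<le> T" using Suc.prems by auto
  note fin = finite_game_chain[OF N L xs deviation_controls s(2)]
  have M: "\<bar>?M j y\<bar> \<le> 1" if "j \<in> {1..N}" "y \<in> paths T" for j y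
    using that Suc.prems(2)[OF that(1)] s(2)
    by (intro stage_bounded[OF s(2) _ m] pure_controls_in_A[OF indiv_pure]) auto
  have "\<E> (game_chain (Suc n)) (\<lambda>X. \<bar>fluct (Suc n) h X\<bar>)
      = \<E> (game_chain n) (\<lambda>X. \<E> (game_step N (\<alpha>(i := \<beta>)) (t + n) X) (\<lambda>X'. \<bar>fluct (Suc n) h X'\<bar>))"
    unfolding chain.simps(2)[of "game_step N (\<alpha>(i := \<beta>))"]
    by (intro E_bind fin finite_game_step[OF N L xs deviation_controls])
  also have "\<dots> \<le> \<E> (game_chain n) (\<lambda>X. 2 / sqrt N + 2 / N + response_constant L * ?W X + \<bar>fluct n ?M X\<bar>)"
  proof (rule E_mono[OF fin])
    fix X assume "X \<in> set_pmf (game_chain n)"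
    then have "X \<in> {1..N} \<rightarrow>\<^sub>E stopped_paths T (t + n)"
      using set_game_chain[OF N L xs deviation_controls s(2)] by blast
    from one_step_fluctuation[OF s(1) this, of h, OF Suc.prems(2)]
    show "\<E> (game_step N (\<alpha>(i := \<beta>)) (t + n) X) (\<lambda>X'. \<bar>fluct (Suc n) h X'\<bar>)
        \<le> 2 / sqrt N + 2 / N + response_constant L * ?W X + \<bar>fluct n ?M X\<bar>"
      by linarith
  qed
  also have "\<dots> = 2 / sqrt N + 2 / N + response_constant L * \<E> (game_chain n) ?W + \<E> (game_chain n) (\<lambda>X. \<bar>fluct n ?M X\<bar>)"
    by (simp only: E_add[OF fin]) simp
  also have "\<dots> \<le> err + response_constant L * (law_constant L n * err) + chaos_constant L n * err"
  proof -
    have "response_constant L * \<E> (game_chain n) ?W \<le> response_constant L * (law_constant L n * err)"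
      by (intro mult_left_mono[OF _ response_constant_nonneg[OF L]] empirical_deviation_mean[OF s(2) Suc.IH[OF s(2)]])
    then show ?thesis using Suc.IH[OF s(2), of ?M, OF M] eta_nonneg by linarith
  qed
  also have "\<dots> = chaos_constant L (Suc n) * err"
    unfolding law_constant_def by (simp add: algebra_simps)
  finally show ?case .
qed

lemma law_bound:
  assumes "t + n \<le> T"
  shows "\<E> (game_chain n) (\<lambda>X. W1 (paths T) (empirical N X) (map_pmf (stop T (t + n)) m)) \<le> law_constant L n * err"
  using assms fluctuation_bound by (intro empirical_deviation_mean) auto

lemma player_bound:
  assumes "t + n \<le> T" and "\<And>y. y \<in> paths T \<Longrightarrow> \<bar>h y\<bar> \<le> 1"
  shows "\<bar>\<E> (game_chain n) (\<lambda>X. h (X i)) - \<E> (chain (relaxed_step (dirac (frozen \<beta> m)) m) t (xs i) n) h\<bar>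
    \<le> (\<Sum>k<n. response_constant L * law_constant L k) * err"
  using assms
proof (induction n arbitrary: h)
  case 0
  then show ?case by simp
next
  case (Suc n)
  let ?s = "t + n"
  let ?M = "\<lambda>x. stage m h 0 ?s x (frozen \<beta> m ?s x)"
    and ?W = "\<lambda>X. W1 (paths T) (empirical N X) (map_pmf (stop T ?s) m)"
  have s: "?s < T" "?s \<le> T" "?s \<in> {t..<T}" using Suc.prems by auto
  note fin = finite_game_chain[OF N L xs deviation_controls s(2)]
  have M: "\<bar>?M y\<bar> \<le> 1" if "y \<in> paths T" for y
    using that Suc.prems(2) s(2)
    by (intro stage_bounded[OF s(2) _ m] pure_controls_in_A[OF frozen_pure[OF \<beta> m]]) auto
  have 1: "\<E> (chain (relaxed_step (dirac (frozen \<beta> m)) m) t (xs i) (Suc n)) h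
      = \<E> (chain (relaxed_step (dirac (frozen \<beta> m)) m) t (xs i) n) ?M"
    using cost_dirac_Suc[OF frozen_pure[OF \<beta> m] m start_stopped[OF i] s(1), of h 0] by (simp add: cost_def)
  have 2: "\<E> (game_chain (Suc n)) (\<lambda>X. h (X i)) = \<E> (game_chain n) (\<lambda>X. \<E> (game_step N (\<alpha>(i := \<beta>)) ?s X) (\<lambda>X'. h (X' i)))"
    unfolding chain.simps(2)[of "game_step N (\<alpha>(i := \<beta>))"]
    by (intro E_bind fin finite_game_step[OF N L xs deviation_controls])
  have "\<bar>\<E> (game_chain (Suc n)) (\<lambda>X. h (X i)) - \<E> (game_chain n) (\<lambda>X. ?M (X i))\<bar>
      \<le> \<E> (game_chain n) (\<lambda>X. \<bar>\<E> (game_step N (\<alpha>(i := \<beta>)) ?s X) (\<lambda>X'. h (X' i)) - ?M (X i)\<bar>)"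
    unfolding 2 E_diff[OF fin, symmetric] by (rule E_abs_le)
  also have "\<dots> \<le> \<E> (game_chain n) (\<lambda>X. response_constant L * ?W X)"
  proof (rule E_mono[OF fin])
    fix X assume "X \<in> set_pmf (game_chain n)"
    then have X: "X \<in> {1..N} \<rightarrow> stopped_paths T ?s"
      using set_game_chain[OF N L xs deviation_controls s(2)] by auto
    then have Xp: "X i \<in> paths T" "X \<in> {1..N} \<rightarrow> paths T" using i stopped_in_paths by blast+
    show "\<bar>\<E> (game_step N (\<alpha>(i := \<beta>)) ?s X) (\<lambda>X'. h (X' i)) - ?M (X i)\<bar> \<le> response_constant L * ?W X"
      using expectation_game_step[OF N L xs deviation_controls s(3) X i, of h] s(3)
        response_Lipschitz[OF \<beta> L s(3) Xp(1) m empirical_in_laws[OF N Xp(2)] Suc.prems(2)]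
      by (simp add: frozen_def)
  qed
  also have "\<dots> \<le> response_constant L * (law_constant L n * err)"
    using mult_left_mono[OF law_bound[OF s(2)] response_constant_nonneg[OF L]] by simp
  finally have "\<bar>\<E> (game_chain (Suc n)) (\<lambda>X. h (X i)) - \<E> (game_chain n) (\<lambda>X. ?M (X i))\<bar> \<le> \<dots>" .
  moreover note Suc.IH[OF s(2), of ?M, OF M]
  moreover have "(\<Sum>k<Suc n. response_constant L * law_constant L k) * err
      = (\<Sum>k<n. response_constant L * law_constant L k) * err + response_constant L * (law_constant L n * err)"
    by (simp only: sum.lessThan_Suc distrib_right mult.assoc)
  ultimately show ?case unfolding 1 by linarith
qed

end


definition payoff :: "(nat \<Rightarrow> 's path \<Rightarrow> 's path pmf \<Rightarrow> real ^ 'k) \<Rightarrow> 's path \<Rightarrow> 's path pmf \<Rightarrow> real" where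
  "payoff \<beta> x \<nu> = G x \<nu> + (\<Sum>s = t..<T. F s x \<nu> (\<beta> s x \<nu>))"

lemma payoff_bounded:
  assumes "\<beta> \<in> path_controls t L" "x \<in> paths T" "\<nu> \<in> laws_on (paths T)"
  shows "\<bar>payoff \<beta> x \<nu>\<bar> \<le> C_0 + real (T - t) * C_0"
proof -
  have "\<bar>\<Sum>s = t..<T. F s x \<nu> (\<beta> s x \<nu>)\<bar> \<le> real (card {t..<T}) * C_0"
    using F_bounded[OF _ assms(2,3)] path_controls_in_A[OF assms(1) _ assms(2,3)]
    by (intro order.trans[OF sum_abs] sum_bounded_above) auto
  then show ?thesis using G_bounded[OF assms(2,3)] unfolding payoff_def by simp
qed

lemma J_game_payoff: "J_game N i t xs \<alpha> = \<E> (game_law N t xs \<alpha>) (\<lambda>X. payoff (\<alpha> i) (X i) (empirical N X))"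
  by (simp add: J_game_def payoff_def)

lemma J_frozen_payoff:
  assumes "\<beta> \<in> path_controls t L" "m \<in> laws_on (paths T)" "x \<in> stopped_paths T t"
  shows "J_frozen (dirac (frozen \<beta> m)) m x
    = \<E> (chain (relaxed_step (dirac (frozen \<beta> m)) m) t x (T - t)) (\<lambda>X. payoff \<beta> X m)"
  unfolding J_frozen_def cost_def
proof (rule E_cong)
  fix X assume "X \<in> set_pmf (chain (relaxed_step (dirac (frozen \<beta> m)) m) t x (T - t))"
  then have X: "X \<in> paths T"
    using set_relaxed_chain[OF assms(3), of "T - t" "dirac (frozen \<beta> m)" m] t stopped_in_paths by auto
  have "running (dirac (frozen \<beta> m)) m r X = F r X m (\<beta> r X m)" if "r \<in> {t..<T}" for r
    unfolding running_def using that integral_dirac[OF frozen_pure[OF assms(1,2)] _ X measurable_F[OF _ X assms(2)], of r r]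
    by (simp add: frozen_def)
  then show "G X m + 1 * (\<Sum>r = t..<t + (T - t). running (dirac (frozen \<beta> m)) m r X) = payoff \<beta> X m"
    using t by (simp add: payoff_def)
qed

lemma payoff_affine:
  assumes B: "B \<ge> 0"
    "\<And>s (x :: 's path) m m' a a'. s \<le> T \<Longrightarrow> x \<in> paths T \<Longrightarrow> m \<in> laws_on (paths T) \<Longrightarrow> m' \<in> laws_on (paths T)
      \<Longrightarrow> a \<in> A \<Longrightarrow> a' \<in> A \<Longrightarrow> \<bar>F s x m a - F s x m' a'\<bar> \<le> \<delta> + B * (W1 (paths T) m m' + norm (a - a'))"
    "\<And>(x :: 's path) m m'. x \<in> paths T \<Longrightarrow> m \<in> laws_on (paths T) \<Longrightarrow> m' \<in> laws_on (paths T)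
      \<Longrightarrow> \<bar>G x m - G x m'\<bar> \<le> \<delta> + B * W1 (paths T) m m'"
    and L: "0 \<le> L" and \<beta>: "\<beta> \<in> path_controls t L" and x: "x \<in> paths T"
    and \<nu>: "\<nu> \<in> laws_on (paths T)" and m: "m \<in> laws_on (paths T)"
  shows "\<bar>payoff \<beta> x \<nu> - payoff \<beta> x m\<bar> \<le> (1 + real (T - t)) * (\<delta> + B * (1 + L) * W1 (paths T) \<nu> m)"
proof -
  let ?W = "W1 (paths T) \<nu> m"
  have "\<bar>F s x \<nu> (\<beta> s x \<nu>) - F s x m (\<beta> s x m)\<bar> \<le> \<delta> + B * (1 + L) * ?W" if s: "s \<in> {t..<T}" for s
  proof -
    have "\<bar>F s x \<nu> (\<beta> s x \<nu>) - F s x m (\<beta> s x m)\<bar> \<le> \<delta> + B * (?W + norm (\<beta> s x \<nu> - \<beta> s x m))"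
      using s by (intro B(2) x \<nu> m path_controls_in_A[OF \<beta> s x]) auto
    also have "\<dots> \<le> \<delta> + B * ((1 + L) * ?W)"
      using path_controls_Lipschitz[OF \<beta> s x \<nu> m] B(1)
      by (intro add_left_mono mult_left_mono) (auto simp: algebra_simps)
    finally show ?thesis by (simp add: mult.assoc)
  qed
  then have "\<bar>\<Sum>s = t..<T. F s x \<nu> (\<beta> s x \<nu>) - F s x m (\<beta> s x m)\<bar>
      \<le> real (card {t..<T}) * (\<delta> + B * (1 + L) * ?W)"
    by (intro order.trans[OF sum_abs] sum_bounded_above) auto
  moreover have "\<bar>G x \<nu> - G x m\<bar> \<le> \<delta> + B * (1 + L) * ?W"
  proof -
    have "B * ?W \<le> B * ((1 + L) * ?W)"
      using B(1) L by (intro mult_left_mono) (auto simp: algebra_simps W1_nonneg)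
    then show ?thesis using B(3)[OF x \<nu> m] by (simp add: mult.assoc)
  qed
  ultimately show ?thesis
    unfolding payoff_def by (simp add: sum_subtractf algebra_simps)
qed

text \<open>The tolerance \<eta> has to be fixed before N, the controls and the environment are
  known; hence the uniformity, above all in \<open>m\<close>.\<close>

definition approximated :: "real \<Rightarrow> real \<Rightarrow> real \<Rightarrow> nat \<Rightarrow> bool" where
  "approximated L \<delta> \<eta> N \<longleftrightarrow> (\<forall>xs \<alpha> i \<beta> m. 1 \<le> N \<longrightarrow> xs \<in> {1..N} \<rightarrow>\<^sub>E stopped_paths T t
    \<longrightarrow> \<alpha> \<in> {1..N} \<rightarrow> path_controls t L \<longrightarrow> i \<in> {1..N} \<longrightarrow> \<beta> \<in> path_controls t L
    \<longrightarrow> m \<in> laws_on (paths T)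
    \<longrightarrow> W1 (paths T) (bind_pmf (pmf_of_set {1..N})
          (\<lambda>j. chain (relaxed_step (dirac (frozen (\<alpha> j) m)) m) t (xs j) (T - t))) m \<le> \<eta>
    \<longrightarrow> \<bar>J_game N i t xs (\<alpha>(i := \<beta>)) - J_frozen (dirac (frozen \<beta> m)) m (xs i)\<bar> \<le> \<delta>)"

lemma approximatedD:
  assumes "approximated L \<delta> \<eta> N" "1 \<le> N" "xs \<in> {1..N} \<rightarrow>\<^sub>E stopped_paths T t"
    "\<alpha> \<in> {1..N} \<rightarrow> path_controls t L" "i \<in> {1..N}" "\<beta> \<in> path_controls t L" "m \<in> laws_on (paths T)"
    "W1 (paths T) (bind_pmf (pmf_of_set {1..N})
      (\<lambda>j. chain (relaxed_step (dirac (frozen (\<alpha> j) m)) m) t (xs j) (T - t))) m \<le> \<eta>"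
  shows "\<bar>J_game N i t xs (\<alpha>(i := \<beta>)) - J_frozen (dirac (frozen \<beta> m)) m (xs i)\<bar> \<le> \<delta>"
  using assms unfolding approximated_def by blast

lemma game_approximation:
  assumes L: "0 \<le> L" and \<delta>: "0 < \<delta>"
  obtains \<eta> N0 where "\<eta> > 0" "\<And>N. N0 \<le> N \<Longrightarrow> approximated L \<delta> \<eta> N"
proof -
  define n where "n = T - t"
  have n: "t + n \<le> T" "t + n = T" using t by (auto simp: n_def)
  \<comment> \<open>Number of cost terms: \<open>G\<close>, and one \<open>F\<close> for each of the
    \<open>n\<close> steps.\<close>
  define k where "k = 1 + real n"
  have k: "k > 0" by (simp add: k_def)
  \<comment> \<open>Divided by \<open>C\<close>, payoffs become test functions bounded by 1. The
    last summand keeps \<open>C\<close> positive when \<open>C_0 = 0\<close>.\<close>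
  define C where "C = C_0 + real n * C_0 + 1"
  have C: "C > 0" using C_0_nonneg by (simp add: C_def add_nonneg_pos)
  obtain B where B: "B \<ge> 0"
    "\<And>s (x :: 's path) m m' a a'. s \<le> T \<Longrightarrow> x \<in> paths T \<Longrightarrow> m \<in> laws_on (paths T) \<Longrightarrow> m' \<in> laws_on (paths T)
      \<Longrightarrow> a \<in> A \<Longrightarrow> a' \<in> A \<Longrightarrow> \<bar>F s x m a - F s x m' a'\<bar> \<le> \<delta> / (2 * k) + B * (W1 (paths T) m m' + norm (a - a'))"
    "\<And>(x :: 's path) m m'. x \<in> paths T \<Longrightarrow> m \<in> laws_on (paths T) \<Longrightarrow> m' \<in> laws_on (paths T)
      \<Longrightarrow> \<bar>G x m - G x m'\<bar> \<le> \<delta> / (2 * k) + B * W1 (paths T) m m'"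
    using affine_bound[of "\<delta> / (2 * k)"] \<delta> k by auto
  define R where "R = (\<Sum>j<n. response_constant L * law_constant L j)"
  \<comment> \<open>Coefficient of the total error: the first summand comes from changing the law
    inside the payoff, the second from changing the law of the path of player
    \<open>i\<close>.\<close>
  define K where "K = k * B * (1 + L) * law_constant L n + C * R"
  have lc: "0 \<le> law_constant L j" for j
    using chaos_constant_nonneg[OF L] by (simp add: law_constant_def)
  have K: "K \<ge> 0"
    unfolding K_def R_def using k B(1) L lc C response_constant_nonneg[OF L]
    by (intro add_nonneg_nonneg mult_nonneg_nonneg sum_nonneg) auto
  \<comment> \<open>For large N the total error is at most 2 \<eta> and so costs at most \<delta> /
    2; the continuity of \<open>F\<close> and \<open>G\<close> uses the other half. The 1 avoids a
    division by 0.\<close>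
  define \<eta> where "\<eta> = \<delta> / (4 * (K + 1))"
  have \<eta>: "\<eta> > 0" using \<delta> K by (simp add: \<eta>_def)
  have "(\<lambda>N. 2 / sqrt (real N) + 2 / real N) \<longlonglongrightarrow> 0 + 0"
    by (intro tendsto_add tendsto_divide_0[OF tendsto_const] filterlim_at_top_imp_at_infinity
        filterlim_compose[OF sqrt_at_top] filterlim_real_sequentially)
  then have "\<forall>\<^sub>F N in sequentially. 2 / sqrt (real N) + 2 / real N < \<eta>"
    using \<eta> by (intro order_tendstoD(2)) auto
  then obtain N0 where N0: "\<And>N. N0 \<le> N \<Longrightarrow> 2 / sqrt (real N) + 2 / real N < \<eta>"
    by (auto simp: eventually_sequentially)
  show thesis
  proof (rule that[OF \<eta>, of N0], unfold approximated_def, intro allI impI)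
    fix N i and xs :: "nat \<Rightarrow> 's path" and \<alpha> \<beta> m
    assume "N0 \<le> N" and N: "1 \<le> N" and xs: "xs \<in> {1..N} \<rightarrow>\<^sub>E stopped_paths T t"
      and \<alpha>: "\<alpha> \<in> {1..N} \<rightarrow> path_controls t L" and i: "i \<in> {1..N}" and \<beta>: "\<beta> \<in> path_controls t L"
      and m: "m \<in> laws_on (paths T)"
      and near: "W1 (paths T) (bind_pmf (pmf_of_set {1..N})
            (\<lambda>j. chain (relaxed_step (dirac (frozen (\<alpha> j) m)) m) t (xs j) (T - t))) m \<le> \<eta>"
    have deviation_controls: "\<alpha>(i := \<beta>) \<in> {1..N} \<rightarrow> path_controls t L" using \<alpha> \<beta> by auto
    define e where "e = 2 / sqrt (real N) + 2 / real N + \<eta>"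
    have e: "e \<le> 2 * \<eta>" using N0[OF \<open>N0 \<le> N\<close>] by (simp add: e_def)
    let ?\<Gamma> = "chain (game_step N (\<alpha>(i := \<beta>))) t xs n"
      and ?P = "chain (relaxed_step (dirac (frozen \<beta> m)) m) t (xs i) n"
      and ?W = "\<lambda>X. W1 (paths T) (empirical N X) m"
    note fin = finite_game_chain[OF N L xs deviation_controls n(1)]
    have "map_pmf (stop T T) m = map_pmf id m"
      using m stop_last by (intro map_pmf_cong) (auto simp: laws_on_def)
    then have W: "\<E> ?\<Gamma> ?W \<le> law_constant L n * e"
      using law_bound[OF N L xs \<alpha> i \<beta> m near n(1)] unfolding n(2) e_def by simp
    have P: "\<bar>\<E> ?\<Gamma> (\<lambda>X. payoff \<beta> (X i) m) - \<E> ?P (\<lambda>X. payoff \<beta> X m)\<bar> \<le> C * (R * e)"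
    proof -
      have "\<bar>payoff \<beta> y m / C\<bar> \<le> 1" if "y \<in> paths T" for y
        using payoff_bounded[OF \<beta> that m] C by (simp add: abs_divide C_def n_def)
      from player_bound[OF N L xs \<alpha> i \<beta> m near n(1), of "\<lambda>y. payoff \<beta> y m / C", OF this]
      have "\<bar>\<E> ?\<Gamma> (\<lambda>X. payoff \<beta> (X i) m / C) - \<E> ?P (\<lambda>X. payoff \<beta> X m / C)\<bar> \<le> R * e"
        by (simp only: R_def e_def)
      then show ?thesis using C by (simp add: abs_divide field_simps flip: diff_divide_distrib)
    qed
    have "\<bar>\<E> ?\<Gamma> (\<lambda>X. payoff \<beta> (X i) (empirical N X)) - \<E> ?\<Gamma> (\<lambda>X. payoff \<beta> (X i) m)\<bar>
        \<le> \<E> ?\<Gamma> (\<lambda>X. \<bar>payoff \<beta> (X i) (empirical N X) - payoff \<beta> (X i) m\<bar>)"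
      unfolding E_diff[OF fin, symmetric] by (rule E_abs_le)
    also have "\<dots> \<le> \<E> ?\<Gamma> (\<lambda>X. k * (\<delta> / (2 * k)) + k * B * (1 + L) * ?W X)"
    proof (rule E_mono[OF fin])
      fix X assume "X \<in> set_pmf ?\<Gamma>"
      then have "X \<in> {1..N} \<rightarrow> stopped_paths T (t + n)"
        using set_game_chain[OF N L xs deviation_controls n(1)] by auto
      then have X: "X i \<in> paths T" "X \<in> {1..N} \<rightarrow> paths T" using i stopped_in_paths by blast+
      have "\<bar>payoff \<beta> (X i) (empirical N X) - payoff \<beta> (X i) m\<bar>
          \<le> k * (\<delta> / (2 * k) + B * (1 + L) * ?W X)"
        using payoff_affine[OF B L \<beta> X(1) empirical_in_laws[OF N X(2)] m] by (simp only: k_def n_def)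
      then
      show "\<bar>payoff \<beta> (X i) (empirical N X) - payoff \<beta> (X i) m\<bar>
          \<le> k * (\<delta> / (2 * k)) + k * B * (1 + L) * ?W X"
        by (simp only: distrib_left[of k] mult.assoc)
    qed
    also have "\<dots> = \<delta> / 2 + k * B * (1 + L) * \<E> ?\<Gamma> ?W"
      using k by (simp add: E_add[OF fin])
    also have "\<dots> \<le> \<delta> / 2 + k * B * (1 + L) * (law_constant L n * e)"
      using W k B(1) L by (intro add_left_mono mult_left_mono) auto
    finally have "\<bar>\<E> ?\<Gamma> (\<lambda>X. payoff \<beta> (X i) (empirical N X)) - \<E> ?P (\<lambda>X. payoff \<beta> X m)\<bar>
        \<le> \<delta> / 2 + k * B * (1 + L) * (law_constant L n * e) + C * (R * e)"
      using P by linarith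
    also have "\<dots> = \<delta> / 2 + K * e" by (simp add: K_def algebra_simps)
    also have "\<dots> \<le> \<delta> / 2 + K * (2 * \<eta>)"
      using mult_left_mono[OF e K] by simp
    also have "\<dots> \<le> \<delta>"
    proof -
      have "K * (2 * \<eta>) = \<delta> / 2 * (K / (K + 1))" using K by (simp add: \<eta>_def field_simps)
      also have "\<dots> \<le> \<delta> / 2 * 1" using K \<delta> by (intro mult_left_mono) auto
      finally show ?thesis by simp
    qed
    finally show "\<bar>J_game N i t xs (\<alpha>(i := \<beta>)) - J_frozen (dirac (frozen \<beta> m)) m (xs i)\<bar> \<le> \<delta>"
      using xs i unfolding J_game_payoff game_law_def n_def
      by (subst J_frozen_payoff[OF \<beta> m]) auto
  qed
qed

definition open_loop :: "(nat \<Rightarrow> 's path \<Rightarrow> real ^ 'k) \<Rightarrow> nat \<Rightarrow> 's path \<Rightarrow> 's path pmf \<Rightarrow> real ^ 'k" where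
  "open_loop b s x \<nu> = b s x"

lemma open_loop_control: "b \<in> pure_controls \<Longrightarrow> 0 \<le> L \<Longrightarrow> open_loop b \<in> path_controls t L"
  by (auto simp: open_loop_def pure_controls_def path_controls_def intro!: mult_nonneg_nonneg W1_nonneg)

lemma chain_open_loop:
  assumes "x \<in> stopped_paths T t" "t + n \<le> T"
  shows "chain (relaxed_step (dirac (frozen (open_loop b) m)) m') t x n = chain (relaxed_step (dirac b) m') t x n"
proof (rule conjunct1[OF chain_cong[where Z = "stopped_paths T"]])
  fix s and z :: "'s path" assume s: "s \<in> {t..<t + n}" and z: "z \<in> stopped_paths T s"
  show "relaxed_step (dirac (frozen (open_loop b) m)) m' s z = relaxed_step (dirac b) m' s z"
    using s assms by (simp add: relaxed_step_def dirac_def frozen_def open_loop_def)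
  show "set_pmf (relaxed_step (dirac (frozen (open_loop b) m)) m' s z) \<subseteq> stopped_paths T (Suc s)"
    using s z assms by (intro set_relaxed_step) auto
qed (rule assms)

lemma J_frozen_open_loop:
  assumes "x \<in> stopped_paths T t"
  shows "J_frozen (dirac (frozen (open_loop b) m)) m' x = J_frozen (dirac b) m' x"
  unfolding J_frozen_def using assms t
  by (intro cost_cong) (auto simp: dirac_def frozen_def open_loop_def)

lemma v_game_approximation:
  assumes L: "0 \<le> L" and m: "m \<in> laws_on (paths T)" and x: "x \<in> stopped_paths T t"
    and J: "\<And>\<beta>. \<beta> \<in> path_controls t L \<Longrightarrow>
      \<bar>J_game N i t xs (\<alpha>(i := \<beta>)) - J_frozen (dirac (frozen \<beta> m)) m x\<bar> \<le> \<delta>"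
  shows "\<bar>v_game N L i t xs \<alpha> - v_frozen m x\<bar> \<le> \<delta>"
proof -
  have ge: "v_frozen m x - \<delta> \<le> J_game N i t xs (\<alpha>(i := \<beta>))" if "\<beta> \<in> path_controls t L" for \<beta>
    using J[OF that] v_frozen_le[OF dirac_relaxed[OF frozen_pure[OF that m]] m x] by linarith
  obtain b where "b \<in> pure_controls" using pure_controls_nonempty by blast
  then have "path_controls t L \<noteq> {}" using open_loop_control L by blast
  then have "v_frozen m x - \<delta> \<le> v_game N L i t xs \<alpha>"
    unfolding v_game_def using ge by (intro cINF_greatest) auto
  moreover have "v_game N L i t xs \<alpha> \<le> v_frozen m x + \<delta>"
  proof (rule field_le_epsilon)
    fix e :: real assume "0 < e"
    from v_frozen_pure[OF m x this] obtain b where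
      b: "b \<in> pure_controls" "J_frozen (dirac b) m x < v_frozen m x + e" .
    note ob = open_loop_control[OF b(1) L]
    have "v_game N L i t xs \<alpha> \<le> J_game N i t xs (\<alpha>(i := open_loop b))"
      unfolding v_game_def using ob ge
      by (intro cINF_lower bdd_belowI2[where m = "v_frozen m x - \<delta>"]) auto
    then show "v_game N L i t xs \<alpha> \<le> v_frozen m x + \<delta> + e"
      using J[OF ob] b(2) unfolding J_frozen_open_loop[OF x] by linarith
  qed
  ultimately show ?thesis by linarith
qed


subsection \<open>The mean field flow\<close>

lemma mf_flow_stop:
  assumes \<mu>: "\<mu> \<in> laws_on (stopped_paths T t)" and "n \<le> k" "t + k \<le> T"
  shows "map_pmf (stop T (t + n)) (mf_flow t \<mu> \<gamma> k) = mf_flow t \<mu> \<gamma> n"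
    "set_pmf (mf_flow t \<mu> \<gamma> k) \<subseteq> stopped_paths T (t + k)"
proof -
  define \<kappa> where "\<kappa> s x = embed_pmf (\<lambda>y. \<integral>a. q s x (mf_flow t \<mu> \<gamma> (s - t)) a y \<partial>\<gamma> s x)" for s x
  have 1: "set_pmf (mf_flow t \<mu> \<gamma> 0) \<subseteq> stopped_paths T t"
    using \<mu> by (simp add: laws_on_def)
  have 2: "mf_flow t \<mu> \<gamma> (Suc n) =
      bind_pmf (mf_flow t \<mu> \<gamma> n) (\<lambda>z. map_pmf (extend T (t + n) z) (\<kappa> (t + n) z))" for n
    by (simp add: \<kappa>_def relaxed_step_def[abs_def])
  interpret D: extension_chain t T "stopped_paths T" "mf_flow t \<mu> \<gamma>" \<kappa> "stop T" "extend T" "\<lambda>s X. X s"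
    by unfold_locales (rule 1 2 extend_facts stop_stopped stop_stop stop_apply; assumption)+
  show "map_pmf (stop T (t + n)) (mf_flow t \<mu> \<gamma> k) = mf_flow t \<mu> \<gamma> n"
    "set_pmf (mf_flow t \<mu> \<gamma> k) \<subseteq> stopped_paths T (t + k)"
    using D.law_stopped D.law_support assms by auto
qed

lemma mf_law_stop:
  assumes "\<mu> \<in> laws_on (stopped_paths T t)" "t + n \<le> T"
  shows "map_pmf (stop T (t + n)) (mf_law t \<mu> \<gamma>) = mf_flow t \<mu> \<gamma> n"
  unfolding mf_law_def using assms by (intro mf_flow_stop) auto

lemma mf_law_in_laws:
  assumes "\<mu> \<in> laws_on (stopped_paths T t)"
  shows "mf_law t \<mu> \<gamma> \<in> laws_on (paths T)"
  using mf_flow_stop(2)[OF assms, of 0 "T - t" \<gamma>] t stopped_in_paths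
  by (auto simp: mf_law_def laws_on_def)

lemma mf_flow_cong:
  assumes \<mu>: "\<mu> \<in> laws_on (stopped_paths T t)" and "t + n \<le> T"
    and "\<And>r x. r \<in> {t..<t + n} \<Longrightarrow> x \<in> paths T \<Longrightarrow> \<gamma> r x = \<gamma>' r x"
  shows "mf_flow t \<mu> \<gamma> n = mf_flow t \<mu> \<gamma>' n"
  using assms(2,3)
proof (induction n)
  case (Suc n)
  then have IH: "mf_flow t \<mu> \<gamma> n = mf_flow t \<mu> \<gamma>' n" by auto
  have "relaxed_step \<gamma> m (t + n) x = relaxed_step \<gamma>' m (t + n) x"
    if "x \<in> set_pmf (mf_flow t \<mu> \<gamma>' n)" for m x
  proof -
    have "x \<in> paths T"
      using mf_flow_stop(2)[OF \<mu>, of 0 n \<gamma>'] Suc.prems(1) that stopped_in_paths by auto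
    then show ?thesis using Suc.prems(2)[of "t + n" x] by (simp add: relaxed_step_def)
  qed
  then show ?case unfolding mf_flow.simps IH by (intro bind_pmf_cong) auto
qed simp

lemma relaxed_step_law_cong:
  assumes "\<gamma> \<in> relaxed_controls" "s \<le> T" "x \<in> paths T" "m \<in> laws_on (paths T)" "m' \<in> laws_on (paths T)"
    and "map_pmf (stop T s) m = map_pmf (stop T s) m'"
  shows "relaxed_step \<gamma> m s x = relaxed_step \<gamma> m' s x"
proof -
  have "(\<integral>a. q s x m a y \<partial>\<gamma> s x) = (\<integral>a. q s x m' a y \<partial>\<gamma> s x)" for y
  proof (rule Bochner_Integration.integral_cong[OF refl])
    fix a assume "a \<in> space (\<gamma> s x)"
    then have "a \<in> A" using relaxed_control_space(3)[OF assms(1-3)] by simp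
    then show "q s x m a y = q s x m' a y"
      using q_stop(1)[OF assms(2,3,4)] q_stop(1)[OF assms(2,3,5)] unfolding assms(6) by metis
  qed
  then show ?thesis by (simp add: relaxed_step_def)
qed

text \<open>The kernel at time t + n sees the final law only through its part stopped at t + n,
  which is the current flow. The nonlinear recursion thus becomes linear once its own solution is
  inserted as environment.\<close>

lemma mf_flow_mixture:
  assumes \<mu>: "\<mu> \<in> laws_on (stopped_paths T t)" and \<gamma>: "\<gamma> \<in> relaxed_controls" and "t + n \<le> T"
  shows "mf_flow t \<mu> \<gamma> n = bind_pmf \<mu> (\<lambda>z. chain (relaxed_step \<gamma> (mf_law t \<mu> \<gamma>)) t z n)"
  using assms(3)
proof (induction n)
  case 0
  then show ?case by (simp add: bind_return_pmf')
next
  case (Suc n)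
  let ?m = "mf_law t \<mu> \<gamma>" and ?f = "mf_flow t \<mu> \<gamma> n"
  have n: "t + n \<le> T" using Suc.prems by simp
  note supp = mf_flow_stop(2)[OF \<mu>, of 0 n \<gamma>, OF le0 n]
  have f: "?f \<in> laws_on (paths T)" using supp stopped_in_paths by (auto simp: laws_on_def)
  have "bind_pmf ?f (relaxed_step \<gamma> ?f (t + n)) = bind_pmf ?f (relaxed_step \<gamma> ?m (t + n))"
  proof (intro bind_pmf_cong refl relaxed_step_law_cong[OF \<gamma> n _ f mf_law_in_laws[OF \<mu>]])
    fix x assume "x \<in> set_pmf ?f"
    then show "x \<in> paths T" using supp stopped_in_paths by blast
    show "map_pmf (stop T (t + n)) ?f = map_pmf (stop T (t + n)) ?m"
      using mf_flow_stop(1)[OF \<mu> order_refl n] mf_law_stop[OF \<mu> n] by simp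
  qed
  then show ?case using Suc.IH[OF n] by (simp add: bind_assoc_pmf)
qed

subsection \<open>Heterogeneous pure controls as one relaxed control\<close>

text \<open>Normalised weights form a law on the indices, and \<open>\<nu>\<close> is its image
  under \<open>a\<close>. The identity is stated without division, so that it also covers total
  weight 0, where any \<open>\<nu>\<close> will do.\<close>

lemma weighted_mean_measure:
  fixes w :: "nat \<Rightarrow> real" and a :: "nat \<Rightarrow> real ^ 'k"
  assumes "finite I" "\<And>j. j \<in> I \<Longrightarrow> 0 \<le> w j" "\<And>j. j \<in> I \<Longrightarrow> a j \<in> A"
  shows "\<exists>\<nu>\<in>space (prob_algebra (restrict_space borel A)).
    \<forall>f\<in>borel_measurable (restrict_space borel A). (\<Sum>j\<in>I. w j * f (a j)) = (\<Sum>j\<in>I. w j) * (\<integral>a. f a \<partial>\<nu>)"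
proof -
  obtain a0 where a0: "a0 \<in> A" using A_nonempty by blast
  let ?R = "restrict_space borel A"
  have spR: "space ?R = A" by (simp add: space_restrict_space)
  define W where "W = (\<Sum>j\<in>I. w j)"
  show ?thesis
  proof (cases "W = 0")
    case True
    then have "\<And>j. j \<in> I \<Longrightarrow> w j = 0" using sum_nonneg_eq_0_iff[OF assms(1,2)] by (simp add: W_def)
    moreover have "return ?R a0 \<in> space (prob_algebra ?R)"
      using a0 spR by (simp add: space_prob_algebra prob_space_return)
    ultimately show ?thesis by (intro bexI[of _ "return ?R a0"]) auto
  next
    case False
    then have W: "W > 0" using sum_nonneg[of I w] assms(2) by (simp add: W_def order.strict_iff_order)
    define p where "p = embed_pmf (\<lambda>j. if j \<in> I then w j / W else 0)"
    have p: "pmf p j = (if j \<in> I then w j / W else 0)" for j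
      unfolding p_def
    proof (rule pmf_embed_pmf)
      have "(\<integral>\<^sup>+ x. ennreal (if x \<in> I then w x / W else 0) \<partial>count_space UNIV)
          = (\<integral>\<^sup>+ x. ennreal (w x / W) * indicator I x \<partial>count_space UNIV)"
        by (intro nn_integral_cong) (auto split: split_indicator)
      also have "\<dots> = (\<Sum>j\<in>I. ennreal (w j / W))"
        using assms(1) by (simp add: nn_integral_count_space_indicator[symmetric] nn_integral_count_space_finite)
      also have "\<dots> = ennreal (\<Sum>j\<in>I. w j / W)"
        using assms(2) W by (intro sum_ennreal) auto
      also have "\<dots> = 1" using W by (simp add: W_def flip: sum_divide_distrib)
      finally show "(\<integral>\<^sup>+ x. ennreal (if x \<in> I then w x / W else 0) \<partial>count_space UNIV) = 1" .
    qed (use assms(2) W in auto)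
    have supp: "set_pmf p \<subseteq> I" using p by (auto simp: set_pmf_iff split: if_splits)
    \<comment> \<open>The value \<open>a0\<close> off \<open>I\<close> sends all indices into
      \<open>A\<close>, as measurability into the restricted space demands.\<close>
    define g where "g j = (if j \<in> I then a j else a0)" for j
    have gm: "g \<in> measurable (measure_pmf p) ?R"
      using assms(3) a0 by (auto simp: g_def spR)
    define \<nu> where "\<nu> = distr (measure_pmf p) ?R g"
    have "\<nu> \<in> space (prob_algebra ?R)"
      unfolding \<nu>_def using gm by (auto simp: space_prob_algebra intro!: measure_pmf.prob_space_distr)
    moreover have "(\<Sum>j\<in>I. w j * f (a j)) = (\<Sum>j\<in>I. w j) * (\<integral>a. f a \<partial>\<nu>)"
      if f: "f \<in> borel_measurable ?R" for f :: "real ^ 'k \<Rightarrow> real"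
    proof -
      have "(\<integral>a. f a \<partial>\<nu>) = \<E> p (\<lambda>j. f (g j))"
        unfolding \<nu>_def by (rule integral_distr[OF gm f])
      also have "\<dots> = (\<Sum>j\<in>I. w j / W * f (a j))"
        using supp assms(1) by (subst E_finite_set[of I]) (auto simp: p g_def)
      finally show ?thesis using W by (simp add: sum_distrib_left flip: W_def)
    qed
    ultimately show ?thesis by blast
  qed
qed

context
  fixes N :: nat and L :: real and xs :: "nat \<Rightarrow> 's path"
    and \<alpha> :: "nat \<Rightarrow> nat \<Rightarrow> 's path \<Rightarrow> 's path pmf \<Rightarrow> real ^ 'k"
  assumes xs: "xs \<in> {1..N} \<rightarrow>\<^sub>E stopped_paths T t"
    and \<alpha>: "\<alpha> \<in> {1..N} \<rightarrow> path_controls t L"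
begin

abbreviation "player m j n \<equiv> chain (relaxed_step (dirac (frozen (\<alpha> j) m)) m) t (xs j) n"

text \<open>At time \<open>t + n\<close>, \<open>\<gamma>\<close> is the conditional law of the action of a uniformly chosen player
  given the path of that player.\<close>

definition blends :: "'s path pmf \<Rightarrow> (nat \<Rightarrow> 's path \<Rightarrow> (real ^ 'k) measure) \<Rightarrow> nat \<Rightarrow> bool" where
  "blends m \<gamma> n \<longleftrightarrow> (\<forall>x\<in>stopped_paths T (t + n). \<forall>f\<in>borel_measurable (restrict_space borel A).
     (\<Sum>j = 1..N. pmf (player m j n) x * f (\<alpha> j (t + n) x m))
       = (\<Sum>j = 1..N. pmf (player m j n) x) * (\<integral>a. f a \<partial>\<gamma> (t + n) x))"

lemma player_law_cong:
  assumes m: "m \<in> laws_on (paths T)" "m' \<in> laws_on (paths T)" and n: "t + n \<le> T"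
    and eq: "map_pmf (stop T (t + n)) m = map_pmf (stop T (t + n)) m'" and j: "j \<in> {1..N}"
  shows "player m j n = player m' j n"
proof (rule conjunct1[OF chain_cong[where Z = "stopped_paths T"]])
  have \<alpha>j: "\<alpha> j \<in> path_controls t L" using \<alpha> j by blast
  fix s and z :: "'s path" assume s: "s \<in> {t..<t + n}" and z: "z \<in> stopped_paths T s"
  have s': "s \<in> {t..<T}" "s \<le> T" "s \<le> t + n" using s n by auto
  note zP = stopped_in_paths[OF z]
  have eqs: "map_pmf (stop T s) m = map_pmf (stop T s) m'"
    using arg_cong[OF eq, of "map_pmf (stop T s)"] s'(3) by (simp add: map_pmf_comp stop_stop)
  have "\<alpha> j s z m = \<alpha> j s z m'"
    using path_controls_stop(1)[OF \<alpha>j s'(1) zP] m eqs by metis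
  then have "frozen (\<alpha> j) m s z = frozen (\<alpha> j) m' s z" by (simp add: frozen_def)
  then have "relaxed_step (dirac (frozen (\<alpha> j) m)) m s z = relaxed_step (dirac (frozen (\<alpha> j) m')) m s z"
    by (simp add: relaxed_step_def dirac_def)
  also have "\<dots> = relaxed_step (dirac (frozen (\<alpha> j) m')) m' s z"
    by (intro relaxed_step_law_cong dirac_relaxed frozen_pure[OF \<alpha>j] m s' zP eqs)
  finally show "relaxed_step (dirac (frozen (\<alpha> j) m)) m s z = relaxed_step (dirac (frozen (\<alpha> j) m')) m' s z" .
  show "set_pmf (relaxed_step (dirac (frozen (\<alpha> j) m)) m s z) \<subseteq> stopped_paths T (Suc s)"
    using s n z by (intro set_relaxed_step) auto
qed (use xs j in auto)

text \<open>At time t + n the condition involves the environment only through its part stopped at t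
  + n, and the control only at that time. It therefore survives later changes of the
  control.\<close>

lemma blends_cong:
  assumes m: "m \<in> laws_on (paths T)" "m' \<in> laws_on (paths T)" and n: "t + n < T"
    and eq: "map_pmf (stop T (t + n)) m = map_pmf (stop T (t + n)) m'"
    and \<gamma>: "\<And>x. x \<in> stopped_paths T (t + n) \<Longrightarrow> \<gamma> (t + n) x = \<gamma>' (t + n) x"
    and "blends m \<gamma> n"
  shows "blends m' \<gamma>' n"
proof -
  have "\<alpha> j (t + n) x m = \<alpha> j (t + n) x m'" if "j \<in> {1..N}" "x \<in> stopped_paths T (t + n)" for j x
  proof -
    have "\<alpha> j \<in> path_controls t L" "t + n \<in> {t..<T}" using \<alpha> that(1) n by auto
    note * = path_controls_stop(1)[OF this stopped_in_paths[OF that(2)]]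
    show ?thesis using *[OF m(1)] *[OF m(2)] unfolding eq by simp
  qed
  moreover have "player m j n = player m' j n" if "j \<in> {1..N}" for j
    using player_law_cong[OF m _ eq that] n by simp
  ultimately have sums:
    "(\<Sum>j = 1..N. pmf (player m j n) x * f (\<alpha> j (t + n) x m))
      = (\<Sum>j = 1..N. pmf (player m' j n) x * f (\<alpha> j (t + n) x m'))"
    "(\<Sum>j = 1..N. pmf (player m j n) x) = (\<Sum>j = 1..N. pmf (player m' j n) x)"
    if "x \<in> stopped_paths T (t + n)" for x and f :: "real ^ 'k \<Rightarrow> real"
    using that by (auto intro!: sum.cong)
  show ?thesis
    unfolding blends_def
  proof (intro ballI)
    fix x :: "'s path" and f :: "real ^ 'k \<Rightarrow> real"
    assume x: "x \<in> stopped_paths T (t + n)" and "f \<in> borel_measurable (restrict_space borel A)"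
    then have "(\<Sum>j = 1..N. pmf (player m j n) x * f (\<alpha> j (t + n) x m))
       = (\<Sum>j = 1..N. pmf (player m j n) x) * (\<integral>a. f a \<partial>\<gamma> (t + n) x)"
      using \<open>blends m \<gamma> n\<close> unfolding blends_def by blast
    then show "(\<Sum>j = 1..N. pmf (player m' j n) x * f (\<alpha> j (t + n) x m'))
       = (\<Sum>j = 1..N. pmf (player m' j n) x) * (\<integral>a. f a \<partial>\<gamma>' (t + n) x)"
      unfolding sums[OF x] \<gamma>[OF x] .
  qed
qed

text \<open>The control has to be a conditional law in the very environment it generates. Its part
  before t + n fixes the law up to t + n, which fixes the conditional law of the actions at t + n;
  installing the latter disturbs nothing earlier. The flow starts from \<open>\<mu>\<close> although
  the players start from \<open>xs\<close>; \<open>relaxed_mixture_near\<close> accounts for the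
  mismatch.\<close>

lemma blending_control:
  assumes \<mu>: "\<mu> \<in> laws_on (stopped_paths T t)" and "t + n \<le> T"
  shows "\<exists>\<gamma>\<in>relaxed_controls. \<forall>k<n. blends (mf_law t \<mu> \<gamma>) \<gamma> k"
  using assms(2)
proof (induction n)
  case 0
  then show ?case using pure_controls_nonempty dirac_relaxed by blast
next
  case (Suc n)
  then obtain \<gamma> where \<gamma>: "\<gamma> \<in> relaxed_controls" "\<And>k. k < n \<Longrightarrow> blends (mf_law t \<mu> \<gamma>) \<gamma> k"
    by auto
  let ?m = "mf_law t \<mu> \<gamma>" and ?s = "t + n"
  have s: "?s < T" "?s \<in> {t..<T}" "?s \<le> T" using Suc.prems by auto
  note m = mf_law_in_laws[OF \<mu>]
  define Q where "Q x \<nu> \<longleftrightarrow> \<nu> \<in> space (prob_algebra (restrict_space borel A)) \<and>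
    (\<forall>f\<in>borel_measurable (restrict_space borel A). (\<Sum>j = 1..N. pmf (player ?m j n) x * f (\<alpha> j ?s x ?m))
       = (\<Sum>j = 1..N. pmf (player ?m j n) x) * (\<integral>a. f a \<partial>\<nu>))" for x \<nu>
  have "\<exists>\<nu>. Q x \<nu>" if x: "x \<in> stopped_paths T ?s" for x
  proof -
    have "\<alpha> j ?s x ?m \<in> A" if "j \<in> {1..N}" for j
      using \<alpha> that by (intro path_controls_in_A[OF _ s(2) stopped_in_paths[OF x] m, of _ L]) auto
    then show ?thesis
      unfolding Q_def Bex_def[symmetric] by (intro weighted_mean_measure) auto
  qed
  then have "\<forall>x\<in>stopped_paths T ?s. \<exists>\<nu>. Q x \<nu>" by blast
  from bchoice[OF this] obtain \<nu> where \<nu>: "\<And>x. x \<in> stopped_paths T ?s \<Longrightarrow> Q x (\<nu> x)" by blast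
  define \<gamma>' where "\<gamma>' r x = (if r = ?s then \<nu> (stop T ?s x) else \<gamma> r x)" for r x
  have \<gamma>': "\<gamma>' \<in> relaxed_controls"
  proof -
    have "\<gamma>' r x \<in> space (prob_algebra (restrict_space borel A)) \<and> \<gamma>' r x = \<gamma>' r (stop T r x)"
      if "r \<le> T" "x \<in> paths T" for r x
    proof (cases "r = ?s")
      case True
      then show ?thesis using \<nu>[OF stop_in_stopped[OF that(2)]] by (simp add: Q_def \<gamma>'_def stop_stop)
    next
      case False
      moreover have "\<gamma> r x \<in> space (prob_algebra (restrict_space borel A))"
        using \<gamma>(1) that unfolding relaxed_controls_def by blast
      ultimately show ?thesis using relaxed_control_stop[OF \<gamma>(1) that] by (simp add: \<gamma>'_def)
    qed
    then show ?thesis unfolding relaxed_controls_def by blast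
  qed
  have flow: "mf_flow t \<mu> \<gamma> k = mf_flow t \<mu> \<gamma>' k" if "k \<le> n" for k
    using that s by (intro mf_flow_cong[OF \<mu>]) (auto simp: \<gamma>'_def)
  have eq: "map_pmf (stop T (t + k)) ?m = map_pmf (stop T (t + k)) (mf_law t \<mu> \<gamma>')" if "k \<le> n" for k
    using mf_law_stop[OF \<mu>, of k] flow[OF that] that s by simp
  have "blends ?m \<gamma>' n"
    unfolding blends_def using \<nu> by (simp add: Q_def \<gamma>'_def stop_stopped)
  then have "blends (mf_law t \<mu> \<gamma>') \<gamma>' n"
    by (intro blends_cong[OF m m s(1) eq[OF order_refl]]) auto
  moreover have "blends (mf_law t \<mu> \<gamma>') \<gamma>' k" if "k < n" for k
    using that s by (intro blends_cong[OF m m _ eq[of k] _ \<gamma>(2)[OF that]]) (auto simp: \<gamma>'_def)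
  ultimately show ?case using \<gamma>' less_Suc_eq by auto
qed

lemma cost_split:
  assumes "x \<in> stopped_paths T t" "t + n \<le> T"
  shows "cost \<gamma> m h c x n = (\<Sum>X\<in>stopped_paths T (t + n). pmf (chain (relaxed_step \<gamma> m) t x n) X * h X)
    + \<E> (chain (relaxed_step \<gamma> m) t x n) (\<lambda>X. c * (\<Sum>r = t..<t + n. running \<gamma> m r X))"
  unfolding cost_def E_add[OF finite_relaxed_chain[OF assms]]
    E_finite_set[OF finite_stopped_paths set_relaxed_chain[OF assms], where f = h] ..

text \<open>At the last stage the sum over players is reordered by paths, and on each path
  \<open>blends\<close>, tested with \<open>stage\<close>, replaces the individual actions by
  \<gamma>. The resulting terminal cost is common to all players, so the shorter problem has the
  same form. Single players may well have different costs under the two controls.\<close>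

lemma blended_cost:
  assumes \<gamma>: "\<gamma> \<in> relaxed_controls" and m: "m \<in> laws_on (paths T)"
    and "t + n \<le> T" and "\<And>k. k < n \<Longrightarrow> blends m \<gamma> k"
  shows "(\<Sum>j = 1..N. cost (dirac (frozen (\<alpha> j) m)) m h c (xs j) n) = (\<Sum>j = 1..N. cost \<gamma> m h c (xs j) n)"
  using assms(3,4)
proof (induction n arbitrary: h)
  case 0
  then show ?case by (simp add: cost_def)
next
  case (Suc n)
  let ?s = "t + n"
  have s: "?s < T" "?s \<le> T" "?s \<in> {t..<T}" using Suc.prems by auto
  have x: "xs j \<in> stopped_paths T t" if "j \<in> {1..N}" for j using xs that by blast
  define H where "H X = (\<integral>a. stage m h c ?s X a \<partial>\<gamma> ?s X)" for X
  let ?d = "\<lambda>j. dirac (frozen (\<alpha> j) m)"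
  let ?r = "\<lambda>j. \<E> (player m j n) (\<lambda>X. c * (\<Sum>r = t..<t + n. running (?d j) m r X))"
  have "(\<Sum>j = 1..N. cost (?d j) m h c (xs j) (Suc n))
      = (\<Sum>j = 1..N. cost (?d j) m (\<lambda>X. stage m h c ?s X (frozen (\<alpha> j) m ?s X)) c (xs j) n)"
    using \<alpha> by (intro sum.cong refl cost_dirac_Suc frozen_pure[of _ L] m x s) auto
  also have "\<dots> = (\<Sum>j = 1..N. (\<Sum>X\<in>stopped_paths T ?s. pmf (player m j n) X * stage m h c ?s X (\<alpha> j ?s X m)) + ?r j)"
    using s by (intro sum.cong refl) (simp add: cost_split[OF x s(2)] frozen_def)
  also have "\<dots> = (\<Sum>X\<in>stopped_paths T ?s. \<Sum>j = 1..N. pmf (player m j n) X * stage m h c ?s X (\<alpha> j ?s X m)) + (\<Sum>j = 1..N. ?r j)"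
    unfolding sum.distrib by (subst sum.swap) (rule refl)
  also have "\<dots> = (\<Sum>X\<in>stopped_paths T ?s. \<Sum>j = 1..N. pmf (player m j n) X * H X) + (\<Sum>j = 1..N. ?r j)"
  proof -
    have "(\<Sum>j = 1..N. pmf (player m j n) X * stage m h c ?s X (\<alpha> j ?s X m)) = (\<Sum>j = 1..N. pmf (player m j n) X * H X)"
      if X: "X \<in> stopped_paths T ?s" for X
      using Suc.prems(2)[of n] X measurable_stage[OF s(2) stopped_in_paths[OF X] m]
      by (simp add: blends_def H_def sum_distrib_right)
    then show ?thesis by simp
  qed
  also have "\<dots> = (\<Sum>j = 1..N. (\<Sum>X\<in>stopped_paths T ?s. pmf (player m j n) X * H X) + ?r j)"
    unfolding sum.distrib by (subst sum.swap) (rule refl)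
  also have "\<dots> = (\<Sum>j = 1..N. cost (?d j) m H c (xs j) n)"
    by (intro sum.cong refl) (simp add: cost_split[OF x s(2)])
  also have "\<dots> = (\<Sum>j = 1..N. cost \<gamma> m H c (xs j) n)"
    using Suc.IH[OF s(2), of H] Suc.prems(2) by simp
  also have "\<dots> = (\<Sum>j = 1..N. cost \<gamma> m h c (xs j) (Suc n))"
    unfolding H_def by (intro sum.cong refl cost_Suc[symmetric] \<gamma> m x s)
  finally show ?case .
qed

end

subsection \<open>Purification of a relaxed control\<close>

text \<open>The pure controls of the players are chosen one after the other.
  Seen from the accumulated deviation from \<open>\<gamma>\<close> in law and cost, the next one is chosen in a
  direction of nonpositive inner product (a best response to linear terminal costs), so that
  the squared deviation grows only linearly.\<close>

lemma purification:
  fixes xs :: "nat \<Rightarrow> 's path"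
  assumes \<gamma>: "\<gamma> \<in> relaxed_controls" and m: "m \<in> laws_on (paths T)"
    and "\<And>i. i \<in> {1..N} \<Longrightarrow> xs i \<in> stopped_paths T t"
  shows "\<exists>b. (\<forall>i. b i \<in> pure_controls) \<and>
    (\<Sum>p\<in>paths T. (\<Sum>i = 1..N. pmf (player_law m t (xs i) (dirac (b i))) p - pmf (player_law m t (xs i) \<gamma>) p)\<^sup>2)
      + (\<Sum>i = 1..N. J_frozen (dirac (b i)) m (xs i) - J_frozen \<gamma> m (xs i))\<^sup>2
    \<le> real N * (card (paths T :: 's path set) + (2 * (C_0 + real (T - t) * C_0))\<^sup>2)"
  using assms(3)
proof (induction N)
  case 0
  then show ?case using pure_controls_nonempty by auto
next
  case (Suc N)
  let ?P = "\<lambda>x b p. pmf (player_law m t x (dirac b)) p - pmf (player_law m t x \<gamma>) p"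
    and ?J = "\<lambda>x b. J_frozen (dirac b) m x - J_frozen \<gamma> m x"
  define C where "C = C_0 + real (T - t) * C_0"
  obtain b where b: "\<And>i. b i \<in> pure_controls"
    and le: "(\<Sum>p\<in>paths T. (\<Sum>i = 1..N. ?P (xs i) (b i) p)\<^sup>2) + (\<Sum>i = 1..N. ?J (xs i) (b i))\<^sup>2
      \<le> real N * (card (paths T :: 's path set) + (2 * C)\<^sup>2)"
    using Suc by (force simp: C_def)
  define S where "S p = (\<Sum>i = 1..N. ?P (xs i) (b i) p)" for p
  define R where "R = (\<Sum>i = 1..N. ?J (xs i) (b i))"
  let ?x = "xs (Suc N)"
  have x: "?x \<in> stopped_paths T t" using Suc.prems by simp
  have T: "t + (T - t) \<le> T" "t + (T - t) = T" using t by auto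
  have supp: "set_pmf (chain (relaxed_step \<gamma> m) t ?x (T - t)) \<subseteq> paths T" for \<gamma>
    using set_relaxed_chain[OF x T(1), of \<gamma> m] stopped_in_paths by blast
  \<comment> \<open>The inner product with the accumulated deviation (\<open>S\<close>,
    \<open>R\<close>) is itself a cost, with terminal part \<open>S + R * G\<close> and running
    weight \<open>R\<close>. So \<open>pure_improvement\<close> applies to it, whatever the sign of
    \<open>R\<close>.\<close>
  have lin: "cost \<gamma> m (\<lambda>X. S X + R * G X m) R ?x (T - t)
      = (\<Sum>p\<in>paths T. pmf (player_law m t ?x \<gamma>) p * S p) + R * J_frozen \<gamma> m ?x" for \<gamma>
  proof -
    let ?c = "chain (relaxed_step \<gamma> m) t ?x (T - t)"
    have "cost \<gamma> m (\<lambda>X. S X + R * G X m) R ?x (T - t)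
        = \<E> ?c (\<lambda>X. S X + R * (G X m + 1 * (\<Sum>r = t..<t + (T - t). running \<gamma> m r X)))"
      unfolding cost_def by (simp add: algebra_simps)
    also have "\<dots> = \<E> ?c S + R * J_frozen \<gamma> m ?x"
      unfolding J_frozen_def cost_def
      by (subst E_add[OF finite_relaxed_chain[OF x T(1)]]) (simp only: integral_mult_right_zero)
    finally show ?thesis
      using E_finite_set[OF finite_paths supp, of \<gamma> S] by (simp add: player_law_def)
  qed
  obtain b' where b': "b' \<in> pure_controls"
    "cost (dirac b') m (\<lambda>X. S X + R * G X m) R ?x (T - t) \<le> cost \<gamma> m (\<lambda>X. S X + R * G X m) R ?x (T - t)"
    using pure_improvement[OF \<gamma> m T(1)] x by blast
  then have inner: "(\<Sum>p\<in>paths T. S p * ?P ?x b' p) + R * ?J ?x b' \<le> 0"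
    unfolding lin by (simp add: algebra_simps sum_subtractf)
  define c where "c = b(Suc N := b')"
  have "(\<Sum>i = 1..Suc N. ?P (xs i) (c i) p) = S p + ?P ?x b' p" for p
    by (simp add: c_def S_def)
  moreover have "(\<Sum>i = 1..Suc N. ?J (xs i) (c i)) = R + ?J ?x b'"
    by (simp add: c_def R_def)
  moreover have "(\<Sum>p\<in>paths T. (S p + ?P ?x b' p)\<^sup>2) + (R + ?J ?x b')\<^sup>2
      \<le> real (Suc N) * (card (paths T :: 's path set) + (2 * C)\<^sup>2)"
  proof -
    \<comment> \<open>The cross term is nonpositive by \<open>inner\<close>; the square of the new
      deviation adds at most 1 for each path and (2C)^2 for the cost.\<close>
    have "(\<Sum>p\<in>paths T. (S p + ?P ?x b' p)\<^sup>2) + (R + ?J ?x b')\<^sup>2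
        = ((\<Sum>p\<in>paths T. (S p)\<^sup>2) + R\<^sup>2) + 2 * ((\<Sum>p\<in>paths T. S p * ?P ?x b' p) + R * ?J ?x b')
          + ((\<Sum>p\<in>paths T. (?P ?x b' p)\<^sup>2) + (?J ?x b')\<^sup>2)"
      unfolding power2_sum by (simp add: sum.distrib sum_distrib_left mult.assoc)
    moreover have "(\<Sum>p\<in>paths T. (?P ?x b' p)\<^sup>2) \<le> (\<Sum>p\<in>(paths T :: 's path set). 1)"
    proof (rule sum_mono)
      fix p
      have "\<bar>?P ?x b' p\<bar> \<le> 1"
        using pmf_nonneg[of _ p] pmf_le_1[of _ p] by (smt (verit))
      then show "(?P ?x b' p)\<^sup>2 \<le> 1" by (simp add: abs_square_le_1)
    qed
    moreover have "(?J ?x b')\<^sup>2 \<le> (2 * C)\<^sup>2"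
    proof -
      have "\<bar>?J ?x b'\<bar> \<le> 2 * C"
        using J_frozen_bounded[OF dirac_relaxed[OF b'(1)] m x] J_frozen_bounded[OF \<gamma> m x]
        by (simp add: C_def)
      then show ?thesis by (metis abs_ge_zero power2_abs power_mono)
    qed
    ultimately show ?thesis
      using le inner unfolding S_def[symmetric] R_def[symmetric] by (simp add: algebra_simps)
  qed
  ultimately show ?case
    using b b'(1) by (intro exI[of _ c]) (auto simp: c_def C_def)
qed


subsection \<open>Comparison of the two games\<close>

text \<open>Both laws come from one kernel, the chain of \<gamma> in its own environment, applied to
  the empirical and to the limiting initial law; kernels contract \<open>W1\<close>.\<close>

lemma relaxed_mixture_near:
  assumes \<mu>: "\<mu> \<in> laws_on (stopped_paths T t)" and \<gamma>: "\<gamma> \<in> relaxed_controls"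
    and N: "1 \<le> N" and xs: "xs \<in> {1..N} \<rightarrow>\<^sub>E stopped_paths T t"
  shows "W1 (paths T) (bind_pmf (pmf_of_set {1..N}) (\<lambda>j. player_law (mf_law t \<mu> \<gamma>) t (xs j) \<gamma>)) (mf_law t \<mu> \<gamma>)
    \<le> W1 (stopped_paths T t) (empirical N xs) \<mu>"
proof -
  let ?m = "mf_law t \<mu> \<gamma>" and ?K = "\<lambda>z. player_law (mf_law t \<mu> \<gamma>) t z \<gamma>"
  have T: "t + (T - t) \<le> T" using t by simp
  have 1: "bind_pmf (pmf_of_set {1..N}) (\<lambda>j. ?K (xs j)) = bind_pmf (empirical N xs) ?K"
    by (simp add: empirical_def bind_map_pmf)
  have 2: "?m = bind_pmf \<mu> ?K"
    using mf_flow_mixture[OF \<mu> \<gamma> T] by (simp add: mf_law_def player_law_def)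
  have "W1 (paths T) (bind_pmf (empirical N xs) ?K) (bind_pmf \<mu> ?K) \<le> W1 (stopped_paths T t) (empirical N xs) \<mu>"
  proof (rule W1_bind_le[OF finite_stopped_paths finite_paths])
    show "set_pmf (empirical N xs) \<subseteq> stopped_paths T t" using xs N by (auto simp: empirical_def)
    show "set_pmf \<mu> \<subseteq> stopped_paths T t" using \<mu> by (simp add: laws_on_def)
    show "set_pmf (?K x) \<subseteq> paths T" if "x \<in> stopped_paths T t" for x
      using set_relaxed_chain[OF that T, of \<gamma> ?m] stopped_in_paths unfolding player_law_def by blast
  qed
  then show ?thesis unfolding 1 using 2 by simp
qed

lemma full_starts_hit:
  assumes "xs \<in> full_starts N t" "1 \<le> N" "x \<in> stopped_paths T t"
  shows "\<exists>i\<in>{1..N}. xs i = x"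
proof -
  have "xs ` {1..N} = stopped_paths T t"
    using assms(1,2) by (simp add: full_starts_def empirical_def)
  then show ?thesis using assms(3) by (metis imageE)
qed

text \<open>A single large N suffices, which is all that limsup grants. The accuracy
  \<open>e\<close> is chosen before \<open>L\<close> and N, but may depend on the smallest mass of
  \<open>\<mu>\<close>.\<close>

lemma relax_if_hetero:
  assumes \<mu>: "\<mu> \<in> full_laws_on (stopped_paths T t)" and \<epsilon>: "0 < \<epsilon>"
    and xs: "\<forall>\<^sub>F N in sequentially. xs N \<in> full_starts N t"
    and conv: "(\<lambda>N. W1 (stopped_paths T t) (empirical N (xs N)) \<mu>) \<longlonglongrightarrow> 0"
    and \<phi>: "\<phi> \<in> (\<Inter>\<epsilon>\<in>{0<..}. \<Union>L\<in>{0..}. limsup (\<lambda>N. V_hetero N \<epsilon> L t (xs N)))"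
  shows "\<phi> \<in> V_relax_eps \<epsilon> t \<mu>"
proof -
  let ?S = "stopped_paths T t :: 's path set"
  have S: "finite ?S" "?S \<noteq> {}" by (rule finite_stopped_paths, rule stopped_paths_nonempty)
  have \<mu>L: "\<mu> \<in> laws_on ?S" using \<mu> by (simp add: full_laws_on_def laws_on_def)
  define c where "c = Min (pmf \<mu> ` ?S)"
  have c_le: "c \<le> pmf \<mu> x" if "x \<in> ?S" for x
    using that S by (simp add: c_def)
  have c: "c > 0"
    unfolding c_def using S \<mu>
    by (subst Min_gr_iff) (auto simp: full_laws_on_def intro!: pmf_positive)
  define e where "e = \<epsilon> / (2 + 6 / c)"
  have e: "e > 0" using \<epsilon> c by (simp add: e_def add_pos_pos)
  have e_\<epsilon>: "2 * e + 6 * e / c = \<epsilon>"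
  proof -
    have "2 * e + 6 * e / c = e * (2 + 6 / c)" by (simp add: algebra_simps)
    also have "2 + 6 / c > 0" using c by (simp add: add_pos_pos)
    then have "e * (2 + 6 / c) = \<epsilon>" by (simp add: e_def)
    finally show ?thesis .
  qed
  obtain L where L: "0 \<le> L" "\<phi> \<in> limsup (\<lambda>N. V_hetero N e L t (xs N))"
    using \<phi> e by auto
  obtain \<eta> N0 where \<eta>: "\<eta> > 0" and approx: "\<And>N. N0 \<le> N \<Longrightarrow> approximated L e \<eta> N"
    using game_approximation[OF L(1) e] by blast
  have "\<forall>\<^sub>F N in sequentially. xs N \<in> full_starts N t \<and>
      W1 ?S (empirical N (xs N)) \<mu> < min \<eta> (c / 2) \<and> max N0 1 \<le> N"
    using xs order_tendstoD(2)[OF conv, of "min \<eta> (c / 2)"] \<eta> c eventually_ge_at_top[of "max N0 1"]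
    by (auto simp: eventually_conj_iff)
  \<comment> \<open>Distance below c / 2 leaves every initial path an empirical mass of at least c /
    2; distance below \<eta> makes the blended law an environment to which
    \<open>approximated\<close> applies.\<close>
  then obtain n where n: "\<And>N. N \<ge> n \<Longrightarrow> xs N \<in> full_starts N t \<and>
      W1 ?S (empirical N (xs N)) \<mu> < min \<eta> (c / 2) \<and> max N0 1 \<le> N"
    by (auto simp: eventually_sequentially)
  have "\<phi> \<in> (\<Union>N\<in>{max n 1..}. V_hetero N e L t (xs N))"
    using L(2) unfolding limsup_set by (rule INT_D) simp
  then obtain N where "N \<ge> n" and V: "\<phi> \<in> V_hetero N e L t (xs N)" by auto
  define x where "x = xs N"
  have x: "x \<in> full_starts N t" and near: "W1 ?S (empirical N x) \<mu> < \<eta>" "W1 ?S (empirical N x) \<mu> < c / 2"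
    and N: "N0 \<le> N" "1 \<le> N"
    using n[OF \<open>N \<ge> n\<close>] by (auto simp: x_def)
  have xP: "x \<in> {1..N} \<rightarrow>\<^sub>E ?S" using x by (simp add: full_starts_def)
  have xi: "x i \<in> ?S" if "i \<in> {1..N}" for i using xP that by blast
  obtain \<alpha> where \<alpha>: "\<alpha> \<in> {1..N} \<rightarrow> path_controls t L"
    and eq: "1 / real N * (\<Sum>i = 1..N. J_game N i t x \<alpha> - v_game N L i t x \<alpha>) \<le> e"
    and val: "(MAX z\<in>?S. MIN i\<in>{i \<in> {1..N}. x i = z}. \<bar>\<phi> z - v_game N L i t x \<alpha>\<bar>) \<le> e"
    and \<phi>P: "\<phi> \<in> ?S \<rightarrow>\<^sub>E UNIV"
    using V unfolding V_hetero_def M_hetero_def x_def by blast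
  have T: "t + (T - t) \<le> T" using t by simp
  obtain \<gamma> where \<gamma>: "\<gamma> \<in> relaxed_controls"
    and bl: "\<And>k. k < T - t \<Longrightarrow> blends N x \<alpha> (mf_law t \<mu> \<gamma>) \<gamma> k"
    using blending_control[OF xP \<alpha> \<mu>L T] by blast
  define m where "m = mf_law t \<mu> \<gamma>"
  have m: "m \<in> laws_on (paths T)" using mf_law_in_laws[OF \<mu>L] by (simp add: m_def)
  let ?d = "\<lambda>j. dirac (frozen (\<alpha> j) m)"
  \<comment> \<open>Used twice: indicators with weight 0 show that the average laws agree, and
    \<open>G\<close> with weight 1 that the average costs agree.\<close>
  have blend: "(\<Sum>j = 1..N. cost (?d j) m h c (x j) (T - t)) = (\<Sum>j = 1..N. cost \<gamma> m h c (x j) (T - t))" for h c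
    using blended_cost[OF xP \<alpha> \<gamma> m T] bl by (simp add: m_def)
  have "bind_pmf (pmf_of_set {1..N}) (\<lambda>j. chain (relaxed_step (?d j) m) t (x j) (T - t))
      = bind_pmf (pmf_of_set {1..N}) (\<lambda>j. player_law m t (x j) \<gamma>)"
  proof (rule pmf_eqI)
    fix p
    have "(\<Sum>j = 1..N. pmf (chain (relaxed_step (?d j) m) t (x j) (T - t)) p)
        = (\<Sum>j = 1..N. pmf (player_law m t (x j) \<gamma>) p)"
      using blend[of "indicator {p}" 0] by (simp add: cost_def player_law_def measure_pmf_single)
    then show "pmf (bind_pmf (pmf_of_set {1..N}) (\<lambda>j. chain (relaxed_step (?d j) m) t (x j) (T - t))) p
        = pmf (bind_pmf (pmf_of_set {1..N}) (\<lambda>j. player_law m t (x j) \<gamma>)) p"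
      unfolding pmf_mixture[OF N(2)] by simp
  qed
  then have avg: "W1 (paths T) (bind_pmf (pmf_of_set {1..N})
      (\<lambda>j. chain (relaxed_step (?d j) m) t (x j) (T - t))) m \<le> \<eta>"
    using relaxed_mixture_near[OF \<mu>L \<gamma> N(2) xP] near(1) by (simp add: m_def)
  note J = approximatedD[OF approx[OF N(1)] N(2) xP \<alpha> _ _ m avg]
  have v: "\<bar>v_game N L i t x \<alpha> - v_frozen m (x i)\<bar> \<le> e" if "i \<in> {1..N}" for i
    by (intro v_game_approximation[OF L(1) m xi[OF that]] J that)
  have Ji: "\<bar>J_game N i t x \<alpha> - J_frozen (?d i) m (x i)\<bar> \<le> e" if "i \<in> {1..N}" for i
  proof -
    have "\<alpha> i \<in> path_controls t L" using \<alpha> that by blast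
    from J[OF that this] show ?thesis by (simp only: fun_upd_triv)
  qed
  define gap where "gap z = J_frozen \<gamma> m z - v_frozen m z" for z
  have gap: "0 \<le> gap z" if "z \<in> ?S" for z
    using v_frozen_le[OF \<gamma> m that] by (simp add: gap_def)
  \<comment> \<open>One e comes from the equilibrium condition, two from passing between game and
    frozen problem, once for the cost and once for the value.\<close>
  have total: "(\<Sum>i = 1..N. gap (x i)) \<le> 3 * e * N"
  proof -
    have "(\<Sum>i = 1..N. gap (x i)) = (\<Sum>i = 1..N. J_frozen (?d i) m (x i) - v_frozen m (x i))"
      using blend[of "\<lambda>X. G X m" 1] by (simp add: gap_def J_frozen_def sum_subtractf)
    also have "\<dots> \<le> (\<Sum>i = 1..N. (J_game N i t x \<alpha> - v_game N L i t x \<alpha>) + 2 * e)"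
    proof (rule sum_mono)
      fix i assume "i \<in> {1..N}"
      from v[OF this] Ji[OF this]
      show "J_frozen (?d i) m (x i) - v_frozen m (x i) \<le> J_game N i t x \<alpha> - v_game N L i t x \<alpha> + 2 * e"
        by linarith
    qed
    also have "\<dots> = (\<Sum>i = 1..N. J_game N i t x \<alpha> - v_game N L i t x \<alpha>) + 2 * e * N"
      by (simp add: sum.distrib)
    also have "\<dots> \<le> e * N + 2 * e * N"
      using eq N(2) by (simp add: field_simps)
    finally show ?thesis by simp
  qed
  \<comment> \<open>At least c N / 2 players start at \<open>z\<close> and share its gap, and the
    gaps of the others are nonnegative.\<close>
  have gap_le: "gap z \<le> 6 * e / c" if z: "z \<in> ?S" for z
  proof -
    have "\<bar>pmf (empirical N x) z - pmf \<mu> z\<bar> \<le> W1 ?S (empirical N x) \<mu>"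
      unfolding W1_def using z S
      by (intro member_le_sum[where f = "\<lambda>z. \<bar>pmf (empirical N x) z - pmf \<mu> z\<bar>"]) auto
    then have "c / 2 \<le> pmf (empirical N x) z" using near(2) c_le[OF z] by linarith
    also have "\<dots> = (\<Sum>i = 1..N. indicator {z} (x i)) / N" by (rule pmf_empirical[OF N(2)])
    finally have "c / 2 * N \<le> (\<Sum>i = 1..N. indicator {z} (x i))"
      using N(2) by (simp add: field_simps)
    then have "c / 2 * N * gap z \<le> (\<Sum>i = 1..N. indicator {z} (x i)) * gap z"
      using gap[OF z] by (rule mult_right_mono)
    also have "\<dots> \<le> (\<Sum>i = 1..N. gap (x i))"
      unfolding sum_distrib_right using gap xi by (intro sum_mono) (auto split: split_indicator)
    also have "\<dots> \<le> 3 * e * N" by (rule total)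
    finally have "N * (c * gap z) \<le> N * (6 * e)" by (simp add: algebra_simps)
    then have "c * gap z \<le> 6 * e" using N(2) by (subst (asm) mult_le_cancel_left_pos) auto
    then show ?thesis using c by (simp add: field_simps)
  qed
  have "J_frozen \<gamma> m z \<le> v_frozen m z + \<epsilon>" if "z \<in> ?S" for z
    using gap_le[OF that] e_\<epsilon> e unfolding gap_def by linarith
  then have "\<gamma> \<in> M_relax \<epsilon> t \<mu>"
    using \<gamma> by (simp add: M_relax_def J_relax_frozen v_relax_frozen flip: m_def)
  moreover have "(SUP z\<in>?S. \<bar>\<phi> z - J_relax t \<mu> \<gamma> z \<gamma>\<bar>) \<le> \<epsilon>"
  proof (rule cSUP_least[OF S(2)])
    fix z assume z: "z \<in> ?S"
    let ?I = "{i \<in> {1..N}. x i = z}"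
    have I: "finite ?I" "?I \<noteq> {}" using full_starts_hit[OF x N(2) z] by auto
    let ?f = "\<lambda>i. \<bar>\<phi> z - v_game N L i t x \<alpha>\<bar>"
    have "Min (?f ` ?I) \<le> e"
      by (rule order_trans[OF Max_ge val]) (use z S in auto)
    moreover have "Min (?f ` ?I) \<in> ?f ` ?I" using I by (intro Min_in) auto
    ultimately obtain i where i: "i \<in> {1..N}" "x i = z" "?f i \<le> e" by auto
    show "\<bar>\<phi> z - J_relax t \<mu> \<gamma> z \<gamma>\<bar> \<le> \<epsilon>"
      unfolding J_relax_frozen m_def[symmetric]
      using i(3) v[OF i(1), unfolded i(2)] gap[OF z] gap_le[OF z] e_\<epsilon> e unfolding gap_def by linarith
  qed
  ultimately show ?thesis using \<phi>P unfolding V_relax_eps_def by blast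
qed

text \<open>The relaxed control and its environment are fixed before N; only the purified controls
  change with N, so every large N works and liminf is reached. These controls ignore the law, whence
  the Lipschitz constant 0.\<close>

lemma hetero_if_relax:
  assumes \<mu>: "\<mu> \<in> full_laws_on (stopped_paths T t)" and \<epsilon>: "0 < \<epsilon>"
    and xs: "\<forall>\<^sub>F N in sequentially. xs N \<in> full_starts N t"
    and conv: "(\<lambda>N. W1 (stopped_paths T t) (empirical N (xs N)) \<mu>) \<longlonglongrightarrow> 0"
    and \<phi>: "\<phi> \<in> V_relax t \<mu>"
  shows "\<phi> \<in> liminf (\<lambda>N. V_hetero N \<epsilon> 0 t (xs N))"
proof -
  let ?S = "stopped_paths T t :: 's path set" and ?P = "paths T :: 's path set"
  have S: "finite ?S" "?S \<noteq> {}" by (rule finite_stopped_paths, rule stopped_paths_nonempty)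
  have \<mu>L: "\<mu> \<in> laws_on ?S" using \<mu> by (simp add: full_laws_on_def laws_on_def)
  have T: "t + (T - t) \<le> T" using t by simp
  \<comment> \<open>In the equilibrium condition one quarter of \<epsilon> goes to the gap of the
    relaxed control, one to the purification, and two eighths to passing between game and frozen
    problem.\<close>
  have "\<phi> \<in> V_relax_eps (\<epsilon> / 4) t \<mu>" using \<phi> \<epsilon> by (auto simp: V_relax_def)
  then obtain \<gamma> where \<phi>P: "\<phi> \<in> ?S \<rightarrow>\<^sub>E UNIV" and \<gamma>M: "\<gamma> \<in> M_relax (\<epsilon> / 4) t \<mu>"
    and sup: "(SUP z\<in>?S. \<bar>\<phi> z - J_relax t \<mu> \<gamma> z \<gamma>\<bar>) \<le> \<epsilon> / 4"
    unfolding V_relax_eps_def by blast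
  have \<gamma>: "\<gamma> \<in> relaxed_controls" using \<gamma>M by (simp add: M_relax_def)
  define m where "m = mf_law t \<mu> \<gamma>"
  have m: "m \<in> laws_on (paths T)" using mf_law_in_laws[OF \<mu>L] by (simp add: m_def)
  have gap: "J_frozen \<gamma> m z \<le> v_frozen m z + \<epsilon> / 4" if "z \<in> ?S" for z
    using \<gamma>M that by (simp add: M_relax_def J_relax_frozen v_relax_frozen m_def)
  have \<phi>J: "\<bar>\<phi> z - J_frozen \<gamma> m z\<bar> \<le> \<epsilon> / 4" if "z \<in> ?S" for z
  proof -
    have "\<bar>\<phi> z - J_relax t \<mu> \<gamma> z \<gamma>\<bar> \<le> (SUP z\<in>?S. \<bar>\<phi> z - J_relax t \<mu> \<gamma> z \<gamma>\<bar>)"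
      using that S by (intro cSUP_upper bdd_above_finite) auto
    then show ?thesis using sup by (simp add: J_relax_frozen m_def)
  qed
  have e8: "0 < \<epsilon> / 8" using \<epsilon> by simp
  obtain \<eta> N0 where \<eta>: "\<eta> > 0" and approx: "\<And>N. N0 \<le> N \<Longrightarrow> approximated 0 (\<epsilon> / 8) \<eta> N"
    using game_approximation[OF order_refl e8] by blast
  \<comment> \<open>Growth rate of the squared deviation in \<open>purification\<close>. After
    division by N each deviation, of the cost or of the mass of a path, is at most
    \<open>sqrt D / sqrt N\<close>.\<close>
  define D where "D = card ?P + (2 * (C_0 + real (T - t) * C_0))\<^sup>2"
  have D: "D \<ge> 0" by (simp add: D_def)
  have lim: "(\<lambda>N. sqrt D / sqrt (real N)) \<longlonglongrightarrow> 0"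
    by (intro tendsto_divide_0[OF tendsto_const] filterlim_at_top_imp_at_infinity
        filterlim_compose[OF sqrt_at_top] filterlim_real_sequentially)
  \<comment> \<open>Bound for the distance from the average law of the pure controls to
    \<open>m\<close>: the deviations summed over all paths, and the effect of starting from the
    empirical measure instead of \<open>\<mu>\<close>.\<close>
  have lim': "(\<lambda>N. card ?P * (sqrt D / sqrt (real N)) + W1 ?S (empirical N (xs N)) \<mu>) \<longlonglongrightarrow> 0"
    using tendsto_add[OF tendsto_mult_right_zero[OF lim] conv] by simp
  have "\<forall>\<^sub>F N in sequentially. xs N \<in> full_starts N t \<and> sqrt D / sqrt (real N) < \<epsilon> / 4 \<and>
      card ?P * (sqrt D / sqrt (real N)) + W1 ?S (empirical N (xs N)) \<mu> < \<eta> \<and> max N0 1 \<le> N"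
    using xs order_tendstoD(2)[OF lim, of "\<epsilon> / 4"] order_tendstoD(2)[OF lim' \<eta>] \<epsilon>
      eventually_ge_at_top[of "max N0 1"]
    by (auto simp: eventually_conj_iff)
  then have "\<forall>\<^sub>F N in sequentially. \<phi> \<in> V_hetero N \<epsilon> 0 t (xs N)"
  proof (rule eventually_mono, elim conjE)
    fix N
    define x where "x = xs N"
    assume "xs N \<in> full_starts N t" and small: "sqrt D / sqrt (real N) < \<epsilon> / 4"
      and "card ?P * (sqrt D / sqrt (real N)) + W1 ?S (empirical N (xs N)) \<mu> < \<eta>" and "max N0 1 \<le> N"
    then have x: "x \<in> full_starts N t" and N: "N0 \<le> N" "1 \<le> N"
      and near: "card ?P * (sqrt D / sqrt (real N)) + W1 ?S (empirical N x) \<mu> < \<eta>"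
      by (auto simp: x_def)
    have xP: "x \<in> {1..N} \<rightarrow>\<^sub>E ?S" using x by (simp add: full_starts_def)
    have xi: "x i \<in> ?S" if "i \<in> {1..N}" for i using xP that by blast
    define dev where "dev b p = (\<Sum>i = 1..N. pmf (player_law m t (x i) (dirac (b i))) p - pmf (player_law m t (x i) \<gamma>) p)"
      for b p
    define devJ where "devJ b = (\<Sum>i = 1..N. J_frozen (dirac (b i)) m (x i) - J_frozen \<gamma> m (x i))" for b
    obtain b where b: "\<And>i. b i \<in> pure_controls"
      and pur: "(\<Sum>p\<in>paths T. (dev b p)\<^sup>2) + (devJ b)\<^sup>2 \<le> N * D"
      using purification[OF \<gamma> m, of N x, OF xi] unfolding dev_def devJ_def D_def by blast
    have root: "\<bar>z\<bar> / N \<le> sqrt D / sqrt N" if "z\<^sup>2 \<le> N * D" for z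
    proof -
      have "\<bar>z\<bar> \<le> sqrt N * sqrt D" using real_sqrt_le_mono[OF that] by (simp add: real_sqrt_mult)
      then have "\<bar>z\<bar> / N \<le> sqrt N * sqrt D / N" using N(2) by (intro divide_right_mono) auto
      also have "\<dots> = sqrt D / sqrt N"
        using N(2) real_sqrt_mult_self[of N] by (simp add: field_simps)
      finally show ?thesis .
    qed
    have devJ: "devJ b / N \<le> \<epsilon> / 4"
    proof -
      have "(devJ b)\<^sup>2 \<le> N * D" using pur sum_nonneg[of "paths T" "\<lambda>p. (dev b p)\<^sup>2"] by simp
      from root[OF this] have "\<bar>devJ b\<bar> / N \<le> \<epsilon> / 4" using small by linarith
      moreover have "devJ b / N \<le> \<bar>devJ b\<bar> / N" by (intro divide_right_mono) auto
      ultimately show ?thesis by linarith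
    qed
    define \<alpha> where "\<alpha> i = open_loop (b i)" for i
    have \<alpha>i: "\<alpha> i \<in> path_controls t 0" for i unfolding \<alpha>_def by (intro open_loop_control b order_refl)
    then have \<alpha>: "\<alpha> \<in> {1..N} \<rightarrow> path_controls t 0" by blast
    have avg: "W1 (paths T) (bind_pmf (pmf_of_set {1..N})
        (\<lambda>j. chain (relaxed_step (dirac (frozen (\<alpha> j) m)) m) t (x j) (T - t))) m \<le> \<eta>"
    proof -
      let ?b = "bind_pmf (pmf_of_set {1..N}) (\<lambda>j. player_law m t (x j) (dirac (b j)))"
        and ?g = "bind_pmf (pmf_of_set {1..N}) (\<lambda>j. player_law m t (x j) \<gamma>)"
      have "bind_pmf (pmf_of_set {1..N}) (\<lambda>j. chain (relaxed_step (dirac (frozen (\<alpha> j) m)) m) t (x j) (T - t)) = ?b"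
        unfolding \<alpha>_def player_law_def using N(2) xi T by (intro bind_pmf_cong refl chain_open_loop) auto
      moreover have "W1 (paths T) ?b ?g \<le> card ?P * (sqrt D / sqrt N)"
      proof -
        have "W1 (paths T) ?b ?g = (\<Sum>p\<in>?P. \<bar>dev b p\<bar> / N)"
          unfolding W1_def pmf_mixture[OF N(2)] dev_def using N(2)
          by (simp add: sum_subtractf abs_divide flip: diff_divide_distrib)
        also have "\<dots> \<le> (\<Sum>p\<in>?P. sqrt D / sqrt N)"
        proof (intro sum_mono root)
          fix p assume "p \<in> ?P"
          then have "(dev b p)\<^sup>2 \<le> (\<Sum>p\<in>paths T. (dev b p)\<^sup>2)"
            by (intro member_le_sum[where f = "\<lambda>p. (dev b p)\<^sup>2"] finite_paths) auto
          then show "(dev b p)\<^sup>2 \<le> N * D" using pur zero_le_power2[of "devJ b"] by linarith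
        qed
        finally show ?thesis by simp
      qed
      ultimately show ?thesis
        using W1_triangle[of "paths T" ?b m ?g] relaxed_mixture_near[OF \<mu>L \<gamma> N(2) xP] near
        by (simp add: m_def)
    qed
    note J = approximatedD[OF approx[OF N(1)] N(2) xP \<alpha> _ _ m avg]
    have v: "\<bar>v_game N 0 i t x \<alpha> - v_frozen m (x i)\<bar> \<le> \<epsilon> / 8" if "i \<in> {1..N}" for i
      by (intro v_game_approximation[OF order_refl m xi[OF that]] J that)
    have Ji: "\<bar>J_game N i t x \<alpha> - J_frozen (dirac (b i)) m (x i)\<bar> \<le> \<epsilon> / 8" if "i \<in> {1..N}" for i
    proof -
      have "J_frozen (dirac (frozen (\<alpha> i) m)) m (x i) = J_frozen (dirac (b i)) m (x i)"
        unfolding \<alpha>_def by (rule J_frozen_open_loop[OF xi[OF that]])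
      then show ?thesis using J[OF that \<alpha>i, of i] by (simp only: fun_upd_triv)
    qed
    have "(\<Sum>i = 1..N. J_game N i t x \<alpha> - v_game N 0 i t x \<alpha>)
        \<le> (\<Sum>i = 1..N. (J_frozen (dirac (b i)) m (x i) - J_frozen \<gamma> m (x i)) + \<epsilon> / 2)"
    proof (rule sum_mono)
      fix i assume "i \<in> {1..N}"
      from v[OF this] Ji[OF this] gap[OF xi[OF this]]
      show "J_game N i t x \<alpha> - v_game N 0 i t x \<alpha> \<le> (J_frozen (dirac (b i)) m (x i) - J_frozen \<gamma> m (x i)) + \<epsilon> / 2"
        by linarith
    qed
    also have "\<dots> = devJ b + N * (\<epsilon> / 2)" by (simp only: devJ_def sum.distrib) simp
    finally have "1 / real N * (\<Sum>i = 1..N. J_game N i t x \<alpha> - v_game N 0 i t x \<alpha>) \<le> devJ b / N + \<epsilon> / 2"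
      using N(2) by (simp add: field_simps)
    then have "1 / real N * (\<Sum>i = 1..N. J_game N i t x \<alpha> - v_game N 0 i t x \<alpha>) \<le> \<epsilon>"
      using devJ \<epsilon> by linarith
    then have "\<alpha> \<in> M_hetero N \<epsilon> 0 t x"
      unfolding M_hetero_def using \<alpha> by blast
    moreover have "(MAX z\<in>?S. MIN i\<in>{i \<in> {1..N}. x i = z}. \<bar>\<phi> z - v_game N 0 i t x \<alpha>\<bar>) \<le> \<epsilon>"
    proof (rule Max.boundedI)
      fix w assume "w \<in> (\<lambda>z. MIN i\<in>{i \<in> {1..N}. x i = z}. \<bar>\<phi> z - v_game N 0 i t x \<alpha>\<bar>) ` ?S"
      then obtain z where z: "z \<in> ?S" "w = (MIN i\<in>{i \<in> {1..N}. x i = z}. \<bar>\<phi> z - v_game N 0 i t x \<alpha>\<bar>)"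
        by blast
      \<comment> \<open>The minimum asks for one player only; the estimate below holds for every
        player who starts at \<open>z\<close>.\<close>
      obtain i where i: "i \<in> {1..N}" "x i = z" using full_starts_hit[OF x N(2) z(1)] by blast
      have "w \<le> \<bar>\<phi> z - v_game N 0 i t x \<alpha>\<bar>"
        unfolding z(2) using i by (intro Min_le) auto
      also have "\<dots> \<le> \<epsilon>"
        using v[OF i(1), unfolded i(2)] \<phi>J[OF z(1)] gap[OF z(1)] v_frozen_le[OF \<gamma> m z(1)] \<epsilon> by linarith
      finally show "w \<le> \<epsilon>" .
    qed (use S in auto)
    ultimately show "\<phi> \<in> V_hetero N \<epsilon> 0 t (xs N)"
      using \<phi>P unfolding V_hetero_def x_def by blast
  qed
  then obtain n where "\<And>N. N \<ge> n \<Longrightarrow> \<phi> \<in> V_hetero N \<epsilon> 0 t (xs N)"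
    by (auto simp: eventually_sequentially)
  then show ?thesis unfolding liminf_set by (intro UN_I[of "max n 1"]) auto
qed

end

theorem theorem5p3:
  fixes T t :: nat
    and A :: "(real ^ 'k) set"
    and q :: "nat \<Rightarrow> 's::finite path \<Rightarrow> 's path pmf \<Rightarrow> real ^ 'k \<Rightarrow> 's \<Rightarrow> real"
    and F :: "nat \<Rightarrow> 's path \<Rightarrow> 's path pmf \<Rightarrow> real ^ 'k \<Rightarrow> real"
    and G :: "'s path \<Rightarrow> 's path pmf \<Rightarrow> real"
    and c_q L_q C_0 :: real and \<rho> :: "real \<Rightarrow> real"
    and \<mu> :: "'s path pmf" and xs :: "nat \<Rightarrow> nat \<Rightarrow> 's path"
  assumes data: "mean_field_game T A q F"
    and c_q: "c_q > 0"
      "\<And>s x m a y. s \<le> T \<Longrightarrow> x \<in> paths T \<Longrightarrow> m \<in> laws_on (paths T) \<Longrightarrow> a \<in> A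
        \<Longrightarrow> c_q \<le> q s x m a y"
    and q_Lipschitz:
      "\<And>s x m m' a a' y. s \<le> T \<Longrightarrow> x \<in> paths T
        \<Longrightarrow> m \<in> laws_on (paths T) \<Longrightarrow> m' \<in> laws_on (paths T) \<Longrightarrow> a \<in> A \<Longrightarrow> a' \<in> A
        \<Longrightarrow> \<bar>q s x m a y - q s x m' a' y\<bar> \<le> L_q * (W1 (paths T) m m' + norm (a - a'))"
    and F_bounded:
      "\<And>s x m a. s \<le> T \<Longrightarrow> x \<in> paths T \<Longrightarrow> m \<in> laws_on (paths T) \<Longrightarrow> a \<in> A
        \<Longrightarrow> \<bar>F s x m a\<bar> \<le> C_0"
    and G_bounded:
      "\<And>x m. x \<in> paths T \<Longrightarrow> m \<in> laws_on (paths T) \<Longrightarrow> \<bar>G x m\<bar> \<le> C_0"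
    and \<rho>: "modulus_of_continuity \<rho>"
    and F_uniformly_continuous:
      "\<And>s x m m' a a'. s \<le> T \<Longrightarrow> x \<in> paths T
        \<Longrightarrow> m \<in> laws_on (paths T) \<Longrightarrow> m' \<in> laws_on (paths T) \<Longrightarrow> a \<in> A \<Longrightarrow> a' \<in> A
        \<Longrightarrow> \<bar>F s x m a - F s x m' a'\<bar> \<le> \<rho> (W1 (paths T) m m' + norm (a - a'))"
    and G_uniformly_continuous:
      "\<And>x m m'. x \<in> paths T \<Longrightarrow> m \<in> laws_on (paths T) \<Longrightarrow> m' \<in> laws_on (paths T)
        \<Longrightarrow> \<bar>G x m - G x m'\<bar> \<le> \<rho> (W1 (paths T) m m')"
    and t: "t \<le> T"
    and \<mu>: "\<mu> \<in> full_laws_on (stopped_paths T t)"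
    and xs: "\<forall>\<^sub>F N in sequentially. xs N \<in> mean_field_game.full_starts T N t"
    and convergence: "(\<lambda>N. W1 (stopped_paths T t) (empirical N (xs N)) \<mu>) \<longlonglongrightarrow> 0"
  shows "(\<Inter>\<epsilon>\<in>{0<..}. \<Union>L\<in>{0..}. limsup (\<lambda>N. mean_field_game.V_hetero T A q F G N \<epsilon> L t (xs N)))
           \<subseteq> mean_field_game.V_relax T A q F G t \<mu>
       \<and> mean_field_game.V_relax T A q F G t \<mu>
           \<subseteq> (\<Inter>\<epsilon>\<in>{0<..}. liminf (\<lambda>N. mean_field_game.V_hetero T A q F G N \<epsilon> 0 t (xs N)))
       \<and> (\<forall>\<epsilon>>0. liminf (\<lambda>N. mean_field_game.V_hetero T A q F G N \<epsilon> 0 t (xs N))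
           \<subseteq> (\<Union>L\<in>{0..}. limsup (\<lambda>N. mean_field_game.V_hetero T A q F G N \<epsilon> L t (xs N))))
       \<and> (\<Inter>\<epsilon>\<in>{0<..}. \<Union>L\<in>{0..}. limsup (\<lambda>N. mean_field_game.V_hetero T A q F G N \<epsilon> L t (xs N)))
           = mean_field_game.V_relax T A q F G t \<mu>
       \<and> mean_field_game.V_relax T A q F G t \<mu>
           = (\<Inter>\<epsilon>\<in>{0<..}. liminf (\<lambda>N. mean_field_game.V_hetero T A q F G N \<epsilon> 0 t (xs N)))"
proof -
  \<comment> \<open>The sign of \<open>L_q\<close> is not prescribed; the larger constant
    \<open>max 0 L_q\<close> keeps the Lipschitz bound.\<close>
  interpret continuous_mean_field_game T A q F G t "max 0 L_q" C_0 \<rho>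
  proof (intro continuous_mean_field_game.intro data continuous_mean_field_game_axioms.intro)
    fix s y a a' and x :: "'s path" and m m' :: "'s path pmf"
    assume *: "s \<le> T" "x \<in> paths T" "m \<in> laws_on (paths T)" "m' \<in> laws_on (paths T)" "a \<in> A" "a' \<in> A"
    have "\<bar>q s x m a y - q s x m' a' y\<bar> \<le> L_q * (W1 (paths T) m m' + norm (a - a'))"
      by (rule q_Lipschitz[OF *])
    also have "\<dots> \<le> max 0 L_q * (W1 (paths T) m m' + norm (a - a'))"
      by (intro mult_right_mono add_nonneg_nonneg W1_nonneg) auto
    finally show "\<bar>q s x m a y - q s x m' a' y\<bar> \<le> max 0 L_q * (W1 (paths T) m m' + norm (a - a'))" .
  qed (rule t F_bounded G_bounded \<rho> F_uniformly_continuous G_uniformly_continuous max.cobounded1; assumption)+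
  let ?V = "\<lambda>\<epsilon> L N. V_hetero N \<epsilon> L t (xs N)"
  have 1: "(\<Inter>\<epsilon>\<in>{0<..}. \<Union>L\<in>{0..}. limsup (?V \<epsilon> L)) \<subseteq> V_relax t \<mu>"
    using relax_if_hetero[OF \<mu> _ xs convergence] unfolding V_relax_def by blast
  have 2: "V_relax t \<mu> \<subseteq> (\<Inter>\<epsilon>\<in>{0<..}. liminf (?V \<epsilon> 0))"
    using hetero_if_relax[OF \<mu> _ xs convergence] by blast
  \<comment> \<open>L = 0 is one member of the union, and liminf is contained in limsup.\<close>
  have 3: "liminf (?V \<epsilon> 0) \<subseteq> (\<Union>L\<in>{0..}. limsup (?V \<epsilon> L))" for \<epsilon>
    using Liminf_le_Limsup[of sequentially "?V \<epsilon> 0"] by force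
  have "(\<Inter>\<epsilon>\<in>{0<..}. liminf (?V \<epsilon> 0)) \<subseteq> (\<Inter>\<epsilon>\<in>{0<..}. \<Union>L\<in>{0..}. limsup (?V \<epsilon> L))"
    by (rule INF_superset_mono[OF order_refl 3])
  note 4 = subset_trans[OF this 1] subset_trans[OF 2 this]
  show ?thesis
    by (intro conjI allI impI 1 2 3 subset_antisym[OF 1 4(2)] subset_antisym[OF 2 4(1)])
qed

end
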